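(* Let $\mathcal U\subset\mathbb R^{2}$ be open and let $U_t+f(U)_X=0$, $U(t,X)\in\mathcal U$, be a strictly hyperbolic $2\times 2$ system satisfying the structural assumptions listed in the context. Let its eigen-structure be given by $$Df(U)=\big[\,R_-(U)\,|\,R_+(U)\,\big]\begin{pmatrix}\lambda_-(U)&0\\0&\lambda_+(U)\end{pmatrix}\begin{pmatrix}L_-(U)\\L_+(U)\end{pmatrix},\qquad \lambda_-<\lambda_+,$$ with the right eigenvector fields $R_-$ and $R_+$ scaled to commute, $[R_+,R_-]\equiv 0$ in $\mathcal U$, and let $r,s$ denote the corresponding Riemann coordinates satisfying $$\nabla r\cdot R_-\equiv 1,\quad \nabla r\cdot R_+\equiv 0,\quad \nabla s\cdot R_-\equiv 0,\quad \nabla s\cdot R_+\equiv 1 .$$ Assume that $\varphi\in C^2(\mathcal U)$ is a Glimm-type TVD field for the system, and consider $\varphi$ as a function of $r$ and $s$. Define $$\mathcal V:=\{(r,s)\in\mathbb R^2 \mid U(r,s)\in\mathcal U\},\qquad \mathcal V':=\{(r,s)\in\mathcal V\mid \partial_r\varphi(r,s)\neq 0 \text{ and } \partial_s\varphi(r,s)\neq 0\}.$$ Then $\varphi$ admits a representation of the form $\varphi(r,s)=\theta(s)-\psi(r)$ on any open, convex subset of $\mathcal V'$. Furthermore, if $\mathcal V$ is convex and $\mathcal V'$ is dense in $\mathcal V$, then there exist functions $\theta(s)$ and $\psi(r)$ such that $\varphi(r,s)=\theta(s)-\psi(r)$ throughout $\mathcal V$.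
   Context: Structural assumptions on the system $U_t+f(U)_X=0$ ($t\ge 0$, $X\in\mathbb R$, $U\in\mathcal U\subset\mathbb R^2$ open, $f$ smooth): (1) Strict hyperbolicity: $Df(U)$ has real eigenvalues (characteristic speeds) $\lambda_-(U)<\lambda_+(U)$ (slow/backward and fast/forward), with right eigenvectors $R_\pm\in\mathbb R^{2\times1}$ and left eigenvectors $L_\pm\in\mathbb R^{1\times 2}$ satisfying $L_+R_-\equiv 0$, $L_-R_+\equiv 0$. (2) Each characteristic field is either genuinely nonlinear or linearly degenerate throughout $\mathcal U$. The eigenvectors are normalized by $\nabla\lambda_\pm\cdot R_\pm\ge 0$ and $L_\pm R_\pm\equiv 1$. (3) Any Riemann problem $(U_l,U_r)$ with $U_l,U_r\in\mathcal U$ has a unique self-similar solution consisting of one slow elementary wave and one fast elementary wave (each an entropic shock, a contact, or a centered rarefaction) connecting $U_l$ to $U_r$ through a middle state. The wave curves $W_\mp(\varepsilon;\bar U)$ (right states of slow, respectively fast, elementary waves with left state $\bar U$) are parametrized so that $W_\mp(0;\bar U)=\bar U$, $\varepsilon>0$ corresponds to rarefactions and $\varepsilon<0$ to shocks. (4) Given Riemann coordinates $r,s$ as in the claim, the map $(r,s)\mapsto U(r,s)$ is a diffeomorphism. The commutator of vector fields is $[X,Y]:=(DY)X-(DX)Y$. Gradients are row vectors taken with respect to $U$. Glimm-type TVD field: consider two approaching elementary waves (shocks, contacts or centered rarefactions) with left, middle and right states $U_l,U_m,U_r$, i.e. a wave $(U_l,U_m)$ located to the left of a wave $(U_m,U_r)$,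 where either the left wave is fast and the right wave is slow (head-on interaction), or both belong to the same family and at least one of them is a shock (overtaking interaction). The interaction is resolved, at the interaction time $t^*$, by solving the Riemann problem $(U_l,U_r)$; let $U(t,X)$, $t>t^*$, be its solution. A scalar field $\varphi:\mathcal U\to\mathbb R$ is a Glimm-type TVD field if for every such pairwise interaction the total variation in $X$ of $\varphi(U(t,X))$ for $t>t^*$ is less than or equal to the total spatial variation of $\varphi$ across the two incoming waves $(U_l,U_m)$ and $(U_m,U_r)$ combined. *)

theory Defs
  imports "HOL-Analysis.Analysis"
begin

text \<open>For open sets in finite dimensions, \<open>Ck_on k S g\<close> says that all iterated directional
  derivatives of \<open>g\<close> up to order \<open>k\<close> exist and are continuous on \<open>S\<close>.\<close>

primrec Ck_on ::
  "nat \<Rightarrow> 'a::real_normed_vector set \<Rightarrow> ('a \<Rightarrow> 'b::real_normed_vector) \<Rightarrow> bool"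
where
  "Ck_on 0 S g \<longleftrightarrow> continuous_on S g"
| "Ck_on (Suc k) S g \<longleftrightarrow>
     (\<forall>x\<in>S. g differentiable (at x)) \<and>
     (\<forall>h. Ck_on k S (\<lambda>x. frechet_derivative g (at x) h))"

definition smooth_on ::
  "'a::real_normed_vector set \<Rightarrow> ('a \<Rightarrow> 'b::real_normed_vector) \<Rightarrow> bool" where
  "smooth_on S g \<longleftrightarrow> (\<forall>k. Ck_on k S g)"

definition diffeomorphism_between ::
  "'a::real_normed_vector set \<Rightarrow> 'b::real_normed_vector set \<Rightarrow> ('a \<Rightarrow> 'b) \<Rightarrow> ('b \<Rightarrow> 'a) \<Rightarrow> bool"
where
  "diffeomorphism_between S T g h \<longleftrightarrow>
     g ` S = T \<and> h ` T = S \<and> (\<forall>x\<in>S. h (g x) = x) \<and> (\<forall>y\<in>T. g (h y) = y) \<and>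
     smooth_on S g \<and> smooth_on T h"

definition grad :: "(real^2 \<Rightarrow> real) \<Rightarrow> real^2 \<Rightarrow> real^2" where
  "grad g u = (\<chi> i. frechet_derivative g (at u) (axis i 1))"

text \<open>\<open>[X, Y] = (DY) X - (DX) Y\<close>\<close>

definition lie_bracket :: "(real^2 \<Rightarrow> real^2) \<Rightarrow> (real^2 \<Rightarrow> real^2) \<Rightarrow> real^2 \<Rightarrow> real^2" where
  "lie_bracket X Y u =
     frechet_derivative Y (at u) (X u) - frechet_derivative X (at u) (Y u)"

definition total_variation :: "(real \<Rightarrow> real) \<Rightarrow> ennreal" where
  "total_variation g =
     (SUP xs\<in>{xs. sorted xs}. \<Sum>k<length xs - 1. ennreal \<bar>g (xs ! Suc k) - g (xs ! k)\<bar>)"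

text \<open>Slow is the subscript minus, Fast the subscript plus.\<close>

datatype wave_family = Slow | Fast

locale conservation_law =
  fixes \<U> :: "(real^2) set"
    and f :: "real^2 \<Rightarrow> real^2"
    and lam :: "wave_family \<Rightarrow> real^2 \<Rightarrow> real"
    and R :: "wave_family \<Rightarrow> real^2 \<Rightarrow> real^2"
begin

definition genuinely_nonlinear :: "wave_family \<Rightarrow> bool" where
  "genuinely_nonlinear i \<longleftrightarrow> (\<forall>u\<in>\<U>. grad (lam i) u \<bullet> R i u \<noteq> 0)"

definition linearly_degenerate :: "wave_family \<Rightarrow> bool" where
  "linearly_degenerate i \<longleftrightarrow> (\<forall>u\<in>\<U>. grad (lam i) u \<bullet> R i u = 0)"

definition rankine_hugoniot :: "real \<Rightarrow> real^2 \<Rightarrow> real^2 \<Rightarrow> bool" where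
  "rankine_hugoniot \<sigma> ul ur \<longleftrightarrow> f ur - f ul = \<sigma> *\<^sub>R (ur - ul)"

definition lax_admissible :: "wave_family \<Rightarrow> real \<Rightarrow> real^2 \<Rightarrow> real^2 \<Rightarrow> bool" where
  "lax_admissible i \<sigma> ul ur \<longleftrightarrow>
     lam i ur < \<sigma> \<and> \<sigma> < lam i ul \<and>
     (i = Slow \<longrightarrow> \<sigma> < lam Fast ur) \<and> (i = Fast \<longrightarrow> lam Slow ul < \<sigma>)"

text \<open>A self-similar wave is represented by its profile \<open>v\<close>, a function of the similarity
  variable \<open>\<xi> = X / t\<close> (time and position measured from the centre of the wave). Jumps are made
  right continuous, so that a profile is determined at every point.\<close>

definition jump :: "real \<Rightarrow> real^2 \<Rightarrow> real^2 \<Rightarrow> real \<Rightarrow> real^2" where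
  "jump \<sigma> ul ur \<xi> = (if \<xi> < \<sigma> then ul else ur)"

definition shock :: "wave_family \<Rightarrow> (real \<Rightarrow> real^2) \<Rightarrow> real^2 \<Rightarrow> real^2 \<Rightarrow> bool" where
  "shock i v ul ur \<longleftrightarrow>
     genuinely_nonlinear i \<and> ul \<in> \<U> \<and> ur \<in> \<U> \<and> ul \<noteq> ur \<and>
     (\<exists>\<sigma>. rankine_hugoniot \<sigma> ul ur \<and> lax_admissible i \<sigma> ul ur \<and> v = jump \<sigma> ul ur)"

definition contact :: "wave_family \<Rightarrow> (real \<Rightarrow> real^2) \<Rightarrow> real^2 \<Rightarrow> real^2 \<Rightarrow> bool" where
  "contact i v ul ur \<longleftrightarrow>
     linearly_degenerate i \<and> ul \<in> \<U> \<and> ur \<in> \<U> \<and> ul \<noteq> ur \<and>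
     (\<exists>\<sigma>. rankine_hugoniot \<sigma> ul ur \<and> \<sigma> = lam i ul \<and> \<sigma> = lam i ur \<and> v = jump \<sigma> ul ur)"

definition rarefaction :: "wave_family \<Rightarrow> (real \<Rightarrow> real^2) \<Rightarrow> real^2 \<Rightarrow> real^2 \<Rightarrow> bool" where
  "rarefaction i v ul ur \<longleftrightarrow>
     genuinely_nonlinear i \<and> ul \<in> \<U> \<and> ur \<in> \<U> \<and> lam i ul < lam i ur \<and>
     (\<forall>\<xi> \<le> lam i ul. v \<xi> = ul) \<and> (\<forall>\<xi> \<ge> lam i ur. v \<xi> = ur) \<and>
     (\<forall>\<xi> \<in> {lam i ul..lam i ur}.
        v \<xi> \<in> \<U> \<and> lam i (v \<xi>) = \<xi> \<and>
        (\<exists>k. (v has_vector_derivative k *\<^sub>R R i (v \<xi>)) (at \<xi> within {lam i ul..lam i ur})))"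

definition elementary_wave :: "wave_family \<Rightarrow> (real \<Rightarrow> real^2) \<Rightarrow> real^2 \<Rightarrow> real^2 \<Rightarrow> bool" where
  "elementary_wave i v ul ur \<longleftrightarrow>
     shock i v ul ur \<or> contact i v ul ur \<or> rarefaction i v ul ur"

text \<open>The waves in the solution of a Riemann problem may have zero strength.\<close>

definition outgoing_wave :: "wave_family \<Rightarrow> (real \<Rightarrow> real^2) \<Rightarrow> real^2 \<Rightarrow> real^2 \<Rightarrow> bool" where
  "outgoing_wave i v ul ur \<longleftrightarrow>
     elementary_wave i v ul ur \<or> (ul \<in> \<U> \<and> ur = ul \<and> v = (\<lambda>_. ul))"

text \<open>The conditions at \<open>c\<close> say that the slow wave lies to the left of the fast wave: at \<open>c\<close> the
  slow wave has been completed and the fast wave has not yet started, so that \<open>v c = um\<close>.\<close>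

definition riemann_solution :: "(real \<Rightarrow> real^2) \<Rightarrow> real^2 \<Rightarrow> real^2 \<Rightarrow> bool" where
  "riemann_solution v ul ur \<longleftrightarrow>
     (\<exists>um vs vf c.
        outgoing_wave Slow vs ul um \<and> outgoing_wave Fast vf um ur \<and>
        (\<forall>\<xi>\<ge>c. vs \<xi> = um) \<and> (\<forall>\<xi>\<le>c. vf \<xi> = um) \<and>
        v = (\<lambda>\<xi>. if \<xi> \<le> c then vs \<xi> else vf \<xi>))"

definition wave_curve :: "wave_family \<Rightarrow> (real \<Rightarrow> real^2) \<Rightarrow> real^2 \<Rightarrow> bool" where
  "wave_curve i w ul \<longleftrightarrow>
     (\<exists>E. is_interval E \<and> 0 \<in> E \<and> continuous_on E w \<and> inj_on w E \<and> w 0 = ul \<and>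
        (genuinely_nonlinear i \<longrightarrow>
           w ` {\<epsilon>\<in>E. 0 < \<epsilon>} = {ur. \<exists>v. rarefaction i v ul ur} \<and>
           w ` {\<epsilon>\<in>E. \<epsilon> < 0} = {ur. \<exists>v. shock i v ul ur}) \<and>
        (linearly_degenerate i \<longrightarrow>
           w ` (E - {0}) = {ur. \<exists>v. contact i v ul ur}))"

definition approaching ::
  "wave_family \<Rightarrow> (real \<Rightarrow> real^2) \<Rightarrow> wave_family \<Rightarrow> (real \<Rightarrow> real^2) \<Rightarrow>
   real^2 \<Rightarrow> real^2 \<Rightarrow> real^2 \<Rightarrow> bool"
where
  "approaching i v1 j v2 ul um ur \<longleftrightarrow>
     elementary_wave i v1 ul um \<and> elementary_wave j v2 um ur \<and>
     ((i = Fast \<and> j = Slow) \<or> (i = j \<and> (shock i v1 ul um \<or> shock j v2 um ur)))"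

text \<open>Time and position are measured from the interaction point, so that the solution after the
  interaction is \<open>U(t, X) = v (X / t)\<close> for \<open>t > 0\<close>. The variation of a single incoming wave is
  that of its profile.\<close>

definition glimm_tvd_field :: "(real^2 \<Rightarrow> real) \<Rightarrow> bool" where
  "glimm_tvd_field \<phi> \<longleftrightarrow>
     (\<forall>i j v1 v2 ul um ur v t.
        approaching i v1 j v2 ul um ur \<longrightarrow> riemann_solution v ul ur \<longrightarrow> t > 0 \<longrightarrow>
        total_variation (\<lambda>X. \<phi> (v (X / t)))
          \<le> total_variation (\<lambda>\<xi>. \<phi> (v1 \<xi>)) + total_variation (\<lambda>\<xi>. \<phi> (v2 \<xi>)))"

end

locale hyperbolic_system = conservation_law \<U> f lam R
  for \<U> :: "(real^2) set"
    and f :: "real^2 \<Rightarrow> real^2"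
    and lam :: "wave_family \<Rightarrow> real^2 \<Rightarrow> real"
    and R :: "wave_family \<Rightarrow> real^2 \<Rightarrow> real^2" +
  fixes L :: "wave_family \<Rightarrow> real^2 \<Rightarrow> real^2"
    and W :: "wave_family \<Rightarrow> real \<Rightarrow> real^2 \<Rightarrow> real^2"
  assumes open_states: "open \<U>"
    and smooth_flux: "smooth_on \<U> f"
    and smooth_eigenvectors: "smooth_on \<U> (R i)"
    and strictly_hyperbolic: "u \<in> \<U> \<Longrightarrow> lam Slow u < lam Fast u"
    and eigen_structure: "u \<in> \<U> \<Longrightarrow>
      jacobian f (at u) =
        transpose (vector [R Slow u, R Fast u] :: real^2^2) **
        (vector [vector [lam Slow u, 0], vector [0, lam Fast u]] :: real^2^2) **
        (vector [L Slow u, L Fast u] :: real^2^2)"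
    and biorthogonal: "u \<in> \<U> \<Longrightarrow> L Fast u \<bullet> R Slow u = 0" "u \<in> \<U> \<Longrightarrow> L Slow u \<bullet> R Fast u = 0"
    and normalized: "u \<in> \<U> \<Longrightarrow> L i u \<bullet> R i u = 1"
    and oriented: "u \<in> \<U> \<Longrightarrow> grad (lam i) u \<bullet> R i u \<ge> 0"
    and field_type: "genuinely_nonlinear i \<or> linearly_degenerate i"
    and riemann_problem: "ul \<in> \<U> \<Longrightarrow> ur \<in> \<U> \<Longrightarrow> \<exists>!v. riemann_solution v ul ur"
    and wave_curves: "ul \<in> \<U> \<Longrightarrow> wave_curve i (\<lambda>\<epsilon>. W i \<epsilon> ul) ul"

end

theory Submission
  imports Defs
begin

text \<open>In Riemann coordinates \<open>z = (r, s)\<close> a weak slow wave moves essentially in the direction of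
  \<open>r\<close> and a weak fast wave in the direction of \<open>s\<close>. A head-on interaction of a fast and a slow wave
  of strengths \<open>b\<close> and \<open>a\<close> therefore exchanges two sides of a small rectangle with opposite
  corners \<open>z0\<close> and \<open>z0 + (a, b)\<close>: the incoming pair runs along one pair of adjacent sides, the
  outgoing pair along the other. Where both partial derivatives of \<open>\<phi>\<close> are nonzero, \<open>\<phi>\<close> is
  monotone along each side, so the variations are differences of corner values. If \<open>\<phi>\<close> increases
  across the fast waves and decreases across the slow ones, the inequality of the variations says
  that the second difference of \<open>\<phi>\<close> over the rectangle is at most \<open>0\<close>; reversing the signs of
  \<open>a\<close> and \<open>b\<close> reverses both monotonicities, and the second difference is at least \<open>0\<close>. In
  both cases it is \<open>a b\<close> times the mixed derivative of \<open>\<phi>\<close>, up to \<open>o(\<epsilon>\<^sup>2)\<close>, and \<open>a b\<close> has the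
  same sign. Hence the mixed derivative vanishes (\<open>corner_sign\<close>, \<open>mixed_derivative_zero\<close>), and a
  function with vanishing mixed derivative on an open convex set is a sum of functions of one
  variable (\<open>sum_decomposition\<close>). Where the set of such points is only dense, continuity of the
  mixed derivative extends its vanishing to all of \<open>V\<close>.

  Contacts and rarefactions follow the coordinate lines exactly. Shocks do not, and reversing the
  signs turns the rarefactions of a genuinely nonlinear family into shocks and conversely, so shocks
  cannot be avoided. What is needed is that the outgoing and incoming middle states
  differ from the corners of the rectangle by \<open>o(\<epsilon>\<^sup>2)\<close> only. The increment of a function between
  two states equals its derivative at the midpoint applied to the difference, up to \<open>o(\<epsilon>\<^sup>2)\<close>
  (\<open>symmetric_difference\<close>). Applied to \<open>U\<close> and \<open>f \<circ> U\<close>, whose partial derivatives differ only by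
  the factors \<open>\<lambda>\<^sub>\<plusminus>\<close>, this turns the determinant of the two jumps, which vanishes under the
  Rankine-Hugoniot condition, into the product of the two coordinate increments and a nonzero
  factor, up to \<open>o(\<epsilon>\<^sup>3)\<close> (\<open>hugoniot_defect\<close>). So a shock whose increment in its own coordinate is of
  size \<open>\<epsilon>\<close> changes the other coordinate by \<open>o(\<epsilon>\<^sup>2)\<close>. This also presents the waves through a
  continuous equation, and two consecutive waves between prescribed end states are a fixed point
  of a continuous map of a disc of radius \<open>o(\<epsilon>\<^sup>2)\<close>, provided by Brouwer's theorem
  (\<open>consecutive_waves\<close>). It is used twice, in the two orders of the families: once for
  the incoming waves, once for the solution of the Riemann problem.\<close>

section \<open>Partial derivatives in the plane\<close>

fun opp :: "wave_family \<Rightarrow> wave_family" where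
  "opp Slow = Fast" | "opp Fast = Slow"

text \<open>A slow wave moves along \<open>r\<close> and a fast wave along \<open>s\<close>, so the family names the coordinate
  direction and both families can be treated by the same lemmas.\<close>
fun dir :: "wave_family \<Rightarrow> real \<times> real" where
  "dir Slow = (1, 0)" | "dir Fast = (0, 1)"

lemma opp_opp [simp]: "opp (opp i) = i"
  by (cases i) auto

lemma inner_dir [simp]: "dir i \<bullet> dir i = 1" "dir i \<bullet> dir (opp i) = 0" "dir (opp i) \<bullet> dir i = 0"
  by (cases i; simp)+

lemma norm_dir [simp]: "norm (dir i) = 1"
  by (cases i) (auto simp: norm_Pair)

lemma abs_inner_dir_le: "\<bar>z \<bullet> dir i\<bar> \<le> norm z"
  using Cauchy_Schwarz_ineq2[of z "dir i"] by simp

lemma dir_decomposition: "z = (z \<bullet> dir i) *\<^sub>R dir i + (z \<bullet> dir (opp i)) *\<^sub>R dir (opp i)"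
  by (cases i; cases z) auto

text \<open>Total differentiability at \<open>z\<close>, with the two partial derivatives indexed by the wave family instead
  of by the coordinate.\<close>
definition has_partials ::
  "(real \<times> real \<Rightarrow> 'a::real_normed_vector) \<Rightarrow> (wave_family \<Rightarrow> 'a) \<Rightarrow> real \<times> real \<Rightarrow> bool" where
  "has_partials g G z \<longleftrightarrow>
     (g has_derivative (\<lambda>h. (h \<bullet> dir Slow) *\<^sub>R G Slow + (h \<bullet> dir Fast) *\<^sub>R G Fast)) (at z)"

lemma has_partials_family:
  "has_partials g G z \<longleftrightarrow>
     (g has_derivative (\<lambda>h. (h \<bullet> dir i) *\<^sub>R G i + (h \<bullet> dir (opp i)) *\<^sub>R G (opp i))) (at z)"
  unfolding has_partials_def by (cases i) (auto simp: add.commute)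

lemma has_partials_along:
  assumes "has_partials g G (z + t *\<^sub>R k)"
  shows "((\<lambda>t. g (z + t *\<^sub>R k)) has_vector_derivative
           (k \<bullet> dir i) *\<^sub>R G i + (k \<bullet> dir (opp i)) *\<^sub>R G (opp i)) (at t within T)"
proof -
  have 1: "((\<lambda>t. z + t *\<^sub>R k) has_derivative (\<lambda>x. x *\<^sub>R k)) (at t within T)"
    by (auto intro!: derivative_eq_intros)
  have "((\<lambda>t. g (z + t *\<^sub>R k)) has_derivative
     (\<lambda>x. ((x *\<^sub>R k) \<bullet> dir i) *\<^sub>R G i + ((x *\<^sub>R k) \<bullet> dir (opp i)) *\<^sub>R G (opp i))) (at t within T)"
    using has_derivative_compose[OF 1 assms[unfolded has_partials_family[of _ _ _ i]]] .
  then show ?thesis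
    unfolding has_vector_derivative_def by (simp add: scaleR_add_right)
qed

text \<open>Estimates between states near \<open>z0\<close> are uniform over a ball of radius \<open>\<rho>\<close>. They are stated as
  eventually true for \<open>\<rho>\<close> tending to \<open>0\<close> from the right, so that finitely many of them can be
  combined without naming radii.\<close>
lemma eventually_cball_subset:
  assumes "open S" "z0 \<in> S"
  shows "\<forall>\<^sub>F \<rho> in at_right 0. cball z0 \<rho> \<subseteq> S"
proof -
  obtain d where d: "d > 0" "cball z0 d \<subseteq> S"
    using assms open_contains_cball by blast
  show ?thesis
    unfolding eventually_at_right_field
    by (rule exI[of _ d]) (use d in \<open>auto simp: subset_iff\<close>)
qed

lemma continuous_near:
  assumes "continuous (at z0) G" "\<eta> > 0"
  shows "\<forall>\<^sub>F \<rho> in at_right 0. \<forall>z\<in>cball z0 \<rho>. norm (G z - G z0) \<le> \<eta>"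
proof -
  obtain d where d: "d > 0" "\<And>z. dist z z0 < d \<Longrightarrow> dist (G z) (G z0) < \<eta>"
    using assms unfolding continuous_at_eps_delta by blast
  show ?thesis
    unfolding eventually_at_right_field
  proof (intro exI[of _ d] conjI allI impI ballI)
    fix \<rho> z assume "\<rho> < d" "z \<in> cball z0 \<rho>"
    then have "dist z z0 < d" by (simp add: dist_commute)
    then show "norm (G z - G z0) \<le> \<eta>" using d(2) by (simp add: dist_norm less_imp_le)
  qed (rule d)
qed

text \<open>Differentiability at the single point \<open>z0\<close> controls the increment between any two nearby points:
  the errors of the two increments from \<open>z0\<close> add up.\<close>
lemma derivative_near:
  assumes "(G has_derivative G') (at z0)" "\<eta> > 0"
  shows "\<forall>\<^sub>F \<rho> in at_right 0. \<forall>z\<in>cball z0 \<rho>. \<forall>w\<in>cball z0 \<rho>.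
           norm (G z - G w - G' (z - w)) \<le> \<eta> * \<rho>"
proof -
  interpret bounded_linear G' using assms(1) by (rule has_derivative_bounded_linear)
  obtain d where d: "d > 0"
    "\<And>z. norm (z - z0) < d \<Longrightarrow> norm (G z - G z0 - G' (z - z0)) \<le> \<eta>/2 * norm (z - z0)"
    using assms unfolding has_derivative_at_alt by (metis half_gt_zero)
  have "norm (G z - G w - G' (z - w)) \<le> \<eta> * \<rho>"
    if "0 < \<rho>" "\<rho> < d" "z \<in> cball z0 \<rho>" "w \<in> cball z0 \<rho>" for \<rho> z w
  proof -
    have *: "norm (G x - G z0 - G' (x - z0)) \<le> \<eta>/2 * \<rho>" if "x \<in> cball z0 \<rho>" for x
    proof -
      have "norm (x - z0) \<le> \<rho>" using that by (simp add: dist_norm norm_minus_commute)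
      moreover have "norm (G x - G z0 - G' (x - z0)) \<le> \<eta>/2 * norm (x - z0)"
        using d(2) calculation \<open>\<rho> < d\<close> by simp
      moreover have "\<eta>/2 * norm (x - z0) \<le> \<eta>/2 * \<rho>"
        using calculation(1) assms(2) by (intro mult_left_mono) auto
      ultimately show ?thesis by linarith
    qed
    have "G z - G w - G' (z - w) = (G z - G z0 - G' (z - z0)) - (G w - G z0 - G' (w - z0))"
      by (simp add: diff)
    also have "norm \<dots> \<le> \<eta>/2 * \<rho> + \<eta>/2 * \<rho>"
      using *[OF that(3)] *[OF that(4)] norm_triangle_ineq4 by (smt (verit))
    finally show ?thesis by simp
  qed
  then show ?thesis
    unfolding eventually_at_right_field using d(1) by blast
qed

text \<open>Taken symmetrically about the midpoint, the second-order terms of the two half increments cancel.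
  Hence the linear approximation has an error \<open>o(\<rho>\<^sup>2)\<close> although the partial derivatives are
  differentiable at the one point \<open>z0\<close> only.\<close>
lemma symmetric_difference:
  fixes g :: "real \<times> real \<Rightarrow> 'a::real_normed_vector"
  assumes "open S" "z0 \<in> S"
    and g: "\<forall>z\<in>S. has_partials g (\<lambda>i. G i z) z"
    and G: "\<forall>i. G i differentiable (at z0)"
    and "\<eta> > 0"
  shows "\<forall>\<^sub>F \<rho> in at_right 0. \<forall>zl\<in>cball z0 \<rho>. \<forall>zr\<in>cball z0 \<rho>.
     norm (g zr - g zl - (((zr - zl) \<bullet> dir i) *\<^sub>R G i ((1/2) *\<^sub>R (zl + zr))
         + ((zr - zl) \<bullet> dir (opp i)) *\<^sub>R G (opp i) ((1/2) *\<^sub>R (zl + zr)))) \<le> \<eta> * \<rho>\<^sup>2"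
proof -
  define j where "j = opp i"
  obtain G' where G': "\<And>i. (G i has_derivative G' i) (at z0)"
    using G unfolding differentiable_def by metis
  have near: "\<forall>\<^sub>F \<rho> in at_right 0. \<forall>z\<in>cball z0 \<rho>. \<forall>w\<in>cball z0 \<rho>.
           norm (G i z - G i w - G' i (z - w)) \<le> \<eta>/4 * \<rho>" for i
    by (rule derivative_near[OF G']) (use assms in auto)
  have "norm (g zr - g zl - (((zr - zl) \<bullet> dir i) *\<^sub>R G i ((1/2) *\<^sub>R (zl + zr))
         + ((zr - zl) \<bullet> dir j) *\<^sub>R G j ((1/2) *\<^sub>R (zl + zr)))) \<le> \<eta> * \<rho>\<^sup>2"
    if \<rho>: "\<rho> > 0" "cball z0 \<rho> \<subseteq> S"
      and near: "\<And>i. i \<in> {Slow,Fast} \<Longrightarrow> \<forall>z\<in>cball z0 \<rho>. \<forall>w\<in>cball z0 \<rho>.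
           norm (G i z - G i w - G' i (z - w)) \<le> \<eta>/4 * \<rho>"
      and zlr: "zl \<in> cball z0 \<rho>" "zr \<in> cball z0 \<rho>" for \<rho> zl zr
  proof -
    define m where "m = (1/2) *\<^sub>R (zl + zr)"
    define k where "k = (1/2) *\<^sub>R (zr - zl)"
    have mk: "m + k = zr" "m - k = zl"
      unfolding m_def k_def by (simp_all add: prod_eq_iff algebra_simps)
    have in_ball: "m + t *\<^sub>R k \<in> cball z0 \<rho>" if "\<bar>t\<bar> \<le> 1" for t
    proof -
      have "m + t *\<^sub>R k = ((1-t)/2) *\<^sub>R zl + ((1+t)/2) *\<^sub>R zr"
        unfolding m_def k_def by (cases zl; cases zr) (simp add: field_simps)
      moreover have "convex (cball z0 \<rho>)" by simp
      ultimately show ?thesis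
        using convexD[of "cball z0 \<rho>" zl zr "(1-t)/2" "(1+t)/2"] zlr that by (simp add: field_simps)
    qed
    have m_ball: "m \<in> cball z0 \<rho>" using in_ball[of 0] by simp
    have norm_k: "norm k \<le> \<rho>"
    proof -
      have "norm (zr - zl) \<le> norm (zr - z0) + norm (z0 - zl)"
        by (rule norm_diff_triangle_ineq[of zr z0 z0 zl, simplified])
      also have "\<dots> \<le> \<rho> + \<rho>" using zlr by (simp add: dist_norm norm_minus_commute)
      finally show ?thesis by (simp add: k_def)
    qed
    define D where "D z = (k \<bullet> dir i) *\<^sub>R G i z + (k \<bullet> dir j) *\<^sub>R G j z" for z
    \<comment> \<open>The derivative of this function of \<open>t\<close> is a symmetric second difference of the partial derivatives, hence small.\<close>
    define p where "p t = g (m + t *\<^sub>R k) - g (m + t *\<^sub>R (-k)) - (2 * t) *\<^sub>R D m" for t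
    define p' where "p' t = D (m + t *\<^sub>R k) + D (m + t *\<^sub>R (-k)) - 2 *\<^sub>R D m" for t
    have dp: "(p has_vector_derivative p' t) (at t within {0..1})" if "t \<in> {0..1}" for t
    proof -
      have "m + t *\<^sub>R k \<in> S" "m + t *\<^sub>R (-k) \<in> S"
        using in_ball[of t] in_ball[of "-t"] that \<rho>(2) by auto
      note * = has_partials_along[OF bspec[OF g this(1)], of i] has_partials_along[OF bspec[OF g this(2)], of i]
      have "((\<lambda>t. (2 * t) *\<^sub>R D m) has_vector_derivative 2 *\<^sub>R D m) (at t within {0..1})"
        unfolding has_vector_derivative_def by (auto intro!: derivative_eq_intros)
      from has_vector_derivative_diff[OF has_vector_derivative_diff[OF *] this]
      show ?thesis
        unfolding p_def p'_def by (simp add: D_def j_def algebra_simps)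
    qed
    have bound: "norm (p' t) \<le> \<eta> * \<rho>\<^sup>2" if t: "t \<in> {0..1}" for t
    proof -
      have *: "norm (G i (m + t *\<^sub>R k) + G i (m + t *\<^sub>R (-k)) - 2 *\<^sub>R G i m) \<le> \<eta>/2 * \<rho>" for i
      proof -
        interpret bounded_linear "G' i" using G' by (rule has_derivative_bounded_linear)
        have n: "\<forall>z\<in>cball z0 \<rho>. \<forall>w\<in>cball z0 \<rho>. norm (G i z - G i w - G' i (z - w)) \<le> \<eta>/4 * \<rho>"
          by (rule near) (cases i; simp)
        have "norm (G i (m + t *\<^sub>R k) - G i m - G' i (t *\<^sub>R k)) \<le> \<eta>/4 * \<rho>"
          using n[rule_format, OF in_ball[of t] m_ball] t by simp
        moreover have "norm (G i (m + t *\<^sub>R (-k)) - G i m + G' i (t *\<^sub>R k)) \<le> \<eta>/4 * \<rho>"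
          using n[rule_format, OF in_ball[of "-t"] m_ball] t by (simp add: neg)
        moreover have "G i (m + t *\<^sub>R k) + G i (m + t *\<^sub>R (-k)) - 2 *\<^sub>R G i m =
          (G i (m + t *\<^sub>R k) - G i m - G' i (t *\<^sub>R k)) + (G i (m + t *\<^sub>R (-k)) - G i m + G' i (t *\<^sub>R k))"
          by (simp add: scaleR_2)
        ultimately have "norm (G i (m + t *\<^sub>R k) + G i (m + t *\<^sub>R (-k)) - 2 *\<^sub>R G i m) \<le> \<eta>/4 * \<rho> + \<eta>/4 * \<rho>"
          by (simp only: norm_triangle_le[OF add_mono])
        then show ?thesis by simp
      qed
      have **: "norm ((k \<bullet> dir i) *\<^sub>R (G i (m + t *\<^sub>R k) + G i (m + t *\<^sub>R (-k)) - 2 *\<^sub>R G i m)) \<le> \<eta>/2 * \<rho>\<^sup>2" for i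
      proof -
        have "\<bar>k \<bullet> dir i\<bar> \<le> \<rho>" using abs_inner_dir_le[of k i] norm_k by linarith
        then have "norm ((k \<bullet> dir i) *\<^sub>R (G i (m + t *\<^sub>R k) + G i (m + t *\<^sub>R (-k)) - 2 *\<^sub>R G i m)) \<le> \<rho> * (\<eta>/2 * \<rho>)"
          unfolding norm_scaleR by (intro mult_mono *) (use \<rho> in auto)
        then show ?thesis by (simp add: power2_eq_square algebra_simps)
      qed
      have "p' t = (k \<bullet> dir i) *\<^sub>R (G i (m + t *\<^sub>R k) + G i (m + t *\<^sub>R (-k)) - 2 *\<^sub>R G i m)
         + (k \<bullet> dir j) *\<^sub>R (G j (m + t *\<^sub>R k) + G j (m + t *\<^sub>R (-k)) - 2 *\<^sub>R G j m)"
        unfolding p'_def D_def by (simp add: algebra_simps)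
      also have "norm \<dots> \<le> \<eta>/2 * \<rho>\<^sup>2 + \<eta>/2 * \<rho>\<^sup>2"
        by (rule norm_triangle_le, rule add_mono[OF ** **])
      finally show ?thesis by simp
    qed
    have "norm (p 1 - p 0) \<le> \<eta> * \<rho>\<^sup>2 * norm (1 - (0::real))"
    proof (rule differentiable_bound[of "{0..1::real}"])
      show "(p has_derivative (\<lambda>x. x *\<^sub>R p' t)) (at t within {0..1})" if "t \<in> {0..1}" for t
        using dp[OF that] by (simp add: has_vector_derivative_def)
      show "onorm (\<lambda>x. x *\<^sub>R p' t) \<le> \<eta> * \<rho>\<^sup>2" if "t \<in> {0..1}" for t
      proof (rule onorm_le)
        show "norm (x *\<^sub>R p' t) \<le> \<eta> * \<rho>\<^sup>2 * norm x" for x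
          using mult_right_mono[OF bound[OF that], of "\<bar>x\<bar>"] by (simp add: mult.commute)
      qed
    qed auto
    moreover have "p 1 - p 0 = g zr - g zl - 2 *\<^sub>R D m"
      unfolding p_def using mk by simp
    moreover have "2 *\<^sub>R D m = ((zr - zl) \<bullet> dir i) *\<^sub>R G i m + ((zr - zl) \<bullet> dir j) *\<^sub>R G j m"
      unfolding D_def k_def by (simp add: algebra_simps)
    ultimately show ?thesis unfolding m_def by simp
  qed
  then have main: "\<forall>zl\<in>cball z0 \<rho>. \<forall>zr\<in>cball z0 \<rho>.
     norm (g zr - g zl - (((zr - zl) \<bullet> dir i) *\<^sub>R G i ((1/2) *\<^sub>R (zl + zr))
         + ((zr - zl) \<bullet> dir j) *\<^sub>R G j ((1/2) *\<^sub>R (zl + zr)))) \<le> \<eta> * \<rho>\<^sup>2"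
    if "\<rho> > 0" "cball z0 \<rho> \<subseteq> S" 
      "\<forall>z\<in>cball z0 \<rho>. \<forall>w\<in>cball z0 \<rho>. norm (G Slow z - G Slow w - G' Slow (z - w)) \<le> \<eta>/4 * \<rho>" 
      "\<forall>z\<in>cball z0 \<rho>. \<forall>w\<in>cball z0 \<rho>. norm (G Fast z - G Fast w - G' Fast (z - w)) \<le> \<eta>/4 * \<rho>" for \<rho>
    using that by blast
  show ?thesis
    unfolding j_def[symmetric]
    using eventually_at_right_less[of "0::real"] eventually_cball_subset[OF assms(1,2)] near[of Slow] near[of Fast]
    by eventually_elim (rule main)
qed

section \<open>Functions with vanishing mixed derivative\<close>

lemma antiderivative_on_interval:
  fixes q :: "real \<Rightarrow> real"
  assumes "open J" "is_interval J" "continuous_on J q"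
  shows "\<exists>\<theta>. \<forall>y\<in>J. (\<theta> has_real_derivative q y) (at y)"
proof (cases "J = {}")
  case False
  define a where "a = Inf (ereal ` J)"
  define b where "b = Sup (ereal ` J)"
  have "a < y \<and> y < b \<longleftrightarrow> y \<in> J" for y
  proof
    assume *: "a < y \<and> y < b"
    then obtain u v where "u \<in> J" "v \<in> J" "u < y" "y < v"
      unfolding a_def b_def Inf_less_iff less_Sup_iff by auto
    then show "y \<in> J" using assms(2) unfolding is_interval_1 by (meson less_imp_le)
  next
    assume "y \<in> J"
    then obtain d where d: "d > 0" "cball y d \<subseteq> J"
      using assms(1) open_contains_cball by blast
    then have "y - d \<in> J" "y + d \<in> J" by (auto simp: dist_norm subset_iff)
    then have "a \<le> ereal (y - d)" "ereal (y + d) \<le> b"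
      unfolding a_def b_def by (auto intro: Inf_lower Sup_upper)
    with d show "a < y \<and> y < b"
      by (meson ereal_less_le less_ereal.simps(1) less_add_same_cancel1 diff_less_eq le_less_trans less_le_trans)
  qed
  note J = this
  have "a < b" using False J by (meson equals0I less_trans)
  moreover have "isCont q y" if "a < y" "y < b" for y
    using that J assms(1,3) continuous_on_eq_continuous_at by blast
  ultimately obtain \<theta> where "\<forall>y. a < ereal y \<longrightarrow> ereal y < b \<longrightarrow> (\<theta> has_vector_derivative q y) (at y)"
    using einterval_antiderivative[of a b q] by blast
  then show ?thesis
    using J by (auto simp: has_real_derivative_iff_has_vector_derivative)
qed auto

lemma convex_sections:
  fixes S :: "(real \<times> real) set"
  assumes "convex S"
  shows "convex {x. (x, b) \<in> S}" "convex {y. (a, y) \<in> S}"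
proof -
  have *: "u *\<^sub>R p + v *\<^sub>R q \<in> S" if "p \<in> S" "q \<in> S" "0 \<le> u" "0 \<le> v" "u + v = 1" for p q and u v :: real
    using assms that by (blast intro: convexD)
  have **: "u * c + v * c = c" if "u + v = 1" for u v c :: real
    using that by (metis mult_1 distrib_right)
  show "convex {x. (x, b) \<in> S}"
  proof (rule convexI)
    fix x y u v :: real
    assume "x \<in> {x. (x, b) \<in> S}" "y \<in> {x. (x, b) \<in> S}" and uv: "0 \<le> u" "0 \<le> v" "u + v = 1"
    with *[of "(x, b)" "(y, b)" u v] have "(u * x + v * y, u * b + v * b) \<in> S" by simp
    then show "u *\<^sub>R x + v *\<^sub>R y \<in> {x. (x, b) \<in> S}" by (simp only: **[OF uv(3)] mem_Collect_eq real_scaleR_def)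
  qed
  show "convex {y. (a, y) \<in> S}"
  proof (rule convexI)
    fix x y u v :: real
    assume "x \<in> {y. (a, y) \<in> S}" "y \<in> {y. (a, y) \<in> S}" and uv: "0 \<le> u" "0 \<le> v" "u + v = 1"
    with *[of "(a, x)" "(a, y)" u v] have "(u * a + v * a, u * x + v * y) \<in> S" by simp
    then show "u *\<^sub>R x + v *\<^sub>R y \<in> {y. (a, y) \<in> S}" by (simp only: **[OF uv(3)] mem_Collect_eq real_scaleR_def)
  qed
qed

lemma zero_derivative_imp_eq:
  fixes g :: "real \<Rightarrow> real"
  assumes "convex T" "\<And>x. x \<in> T \<Longrightarrow> (g has_real_derivative 0) (at x)" "x \<in> T" "y \<in> T"
  shows "g x = g y"
proof -
  have "(g has_field_derivative 0) (at x within T)" if "x \<in> T" for x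
    using assms(2)[OF that] by (rule has_field_derivative_at_within)
  then obtain c where "\<And>x. x \<in> T \<Longrightarrow> g x = c"
    using has_field_derivative_zero_constant[OF assms(1)] by blast
  then show ?thesis using assms(3,4) by simp
qed

text \<open>The derivative in the second variable is constant on the horizontal sections, which are intervals
  because \<open>S\<close> is convex, and so depends on the second variable alone. Its antiderivative over the
  projection of \<open>S\<close> differs from \<open>\<Phi>\<close> by a function that is constant on the vertical sections.\<close>
lemma sum_decomposition:
  fixes \<Phi> q :: "real \<times> real \<Rightarrow> real"
  assumes "open S" "convex S"
    and \<Phi>: "\<And>a b. (a, b) \<in> S \<Longrightarrow> ((\<lambda>y. \<Phi> (a, y)) has_real_derivative q (a, b)) (at b)"
    and q: "\<And>a b. (a, b) \<in> S \<Longrightarrow> ((\<lambda>x. q (x, b)) has_real_derivative 0) (at a)"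
    and cont: "continuous_on S q"
  shows "\<exists>\<theta> \<psi>. \<forall>(a, b)\<in>S. \<Phi> (a, b) = \<theta> b - \<psi> a"
proof -
  have row: "q (a, b) = q (a', b)" if "(a, b) \<in> S" "(a', b) \<in> S" for a a' b
    by (rule zero_derivative_imp_eq[where g = "\<lambda>a. q (a, b)", OF convex_sections(1)[OF \<open>convex S\<close>, of b]]) (use q that in auto)
  define Q where "Q b = q (SOME a. (a, b) \<in> S, b)" for b
  have Q: "Q b = q (a, b)" if "(a, b) \<in> S" for a b
    unfolding Q_def by (rule row[OF someI[of "\<lambda>a. (a, b) \<in> S"]]) (use that in blast)+
  define J where "J = snd ` S"
  have "open J" unfolding J_def using \<open>open S\<close> by (rule open_image_snd)
  have "is_interval J"
    unfolding J_def is_interval_convex_1 using \<open>convex S\<close> by (rule convex_linear_image[OF linear_snd])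
  have "isCont Q b" if bJ: "b \<in> J" for b
  proof -
    obtain a where ab: "(a, b) \<in> S" using bJ unfolding J_def by (metis imageE prod.collapse)
    then obtain A B where AB: "open A" "open B" "a \<in> A" "b \<in> B" "A \<times> B \<subseteq> S"
      using open_prod_elim[OF \<open>open S\<close> ab] by (metis mem_Sigma_iff)
    have "continuous_on B (\<lambda>y. (a, y))" by (intro continuous_intros)
    then have "continuous_on B (\<lambda>y. q (a, y))"
      by (rule continuous_on_compose2[OF cont]) (use AB in blast)
    moreover have "q (a, y) = Q y" if "y \<in> B" for y
      using Q[of a y] AB that by (metis SigmaI subsetD)
    ultimately have "continuous_on B Q" by (metis (no_types, lifting) continuous_on_cong)
    then show ?thesis using AB continuous_on_eq_continuous_at by blast
  qed
  then have "continuous_on J Q" by (rule continuous_at_imp_continuous_on[OF ballI])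
  from antiderivative_on_interval[OF \<open>open J\<close> \<open>is_interval J\<close> this]
  obtain \<theta> where \<theta>: "\<And>y. y \<in> J \<Longrightarrow> (\<theta> has_real_derivative Q y) (at y)" by blast
  have column: "\<theta> b - \<Phi> (a, b) = \<theta> b' - \<Phi> (a, b')" if "(a, b) \<in> S" "(a, b') \<in> S" for a b b'
  proof (rule zero_derivative_imp_eq[where g = "\<lambda>y. \<theta> y - \<Phi> (a, y)",
        OF convex_sections(2)[OF \<open>convex S\<close>, of a]])
    show "((\<lambda>y. \<theta> y - \<Phi> (a, y)) has_real_derivative 0) (at y)" if "y \<in> {y. (a, y) \<in> S}" for y
    proof -
      have y: "(a, y) \<in> S" "y \<in> J" unfolding J_def using that by force+
      from DERIV_diff[OF \<theta>[OF y(2)] \<Phi>[OF y(1)]] Q[OF y(1)] show ?thesis by simp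
    qed
  qed (use that in auto)
  define \<psi> where "\<psi> a = \<theta> (SOME b. (a, b) \<in> S) - \<Phi> (a, SOME b. (a, b) \<in> S)" for a
  have "\<psi> a = \<theta> b - \<Phi> (a, b)" if "(a, b) \<in> S" for a b
    unfolding \<psi>_def by (rule column[OF someI[of "\<lambda>b. (a, b) \<in> S"]]) (use that in blast)+
  then have "\<forall>(a, b)\<in>S. \<Phi> (a, b) = \<theta> b - \<psi> a" by auto
  then show ?thesis by blast
qed

section \<open>Derivatives along vector fields\<close>

text \<open>The iterated derivatives see \<open>g\<close> in a neighbourhood of each point, so openness of \<open>S\<close> is what
  makes agreement on \<open>S\<close> sufficient.\<close>
lemma Ck_on_cong:
  assumes "open S" "\<And>x. x \<in> S \<Longrightarrow> g x = h x" "Ck_on k S g"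
  shows "Ck_on k S h"
  using assms(2,3)
proof (induction k arbitrary: g h)
  case 0
  then show ?case by (auto cong: continuous_on_cong)
next
  case (Suc k)
  have *: "(h has_derivative frechet_derivative g (at x)) (at x)" if "x \<in> S" for x
  proof (rule has_derivative_transform_within_open[OF _ assms(1) that Suc.prems(1)])
    show "(g has_derivative frechet_derivative g (at x)) (at x)"
      using Suc.prems(2) that by (simp add: frechet_derivative_works)
  qed
  then have "frechet_derivative g (at x) = frechet_derivative h (at x)" if "x \<in> S" for x
    using frechet_derivative_at that by blast
  then have "Ck_on k S (\<lambda>x. frechet_derivative h (at x) v)" for v
    using Suc.IH[of "\<lambda>x. frechet_derivative g (at x) v" "\<lambda>x. frechet_derivative h (at x) v"] Suc.prems(2)
    by simp
  with * show ?case by (auto simp: differentiable_def)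
qed

lemma Ck_on_imp_continuous_on: "Ck_on k S g \<Longrightarrow> continuous_on S g"
proof (cases k)
  case (Suc n)
  moreover assume "Ck_on k S g"
  ultimately have "\<forall>x\<in>S. g differentiable (at x)" by simp
  then show ?thesis
    by (intro continuous_at_imp_continuous_on ballI differentiable_imp_continuous_within) blast
qed simp

lemma Ck_on_pred: "Ck_on (Suc k) S g \<Longrightarrow> Ck_on k S g"
proof (induction k arbitrary: g)
  case 0
  then show ?case using Ck_on_imp_continuous_on[OF 0] by simp
qed simp

lemma Ck_on_add:
  assumes "open S" "Ck_on k S g" "Ck_on k S h"
  shows "Ck_on k S (\<lambda>x. g x + h x)"
  using assms(2,3)
proof (induction k arbitrary: g h)
  case 0
  then show ?case by (auto intro: continuous_on_add)
next
  case (Suc k)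
  have *: "((\<lambda>x. g x + h x) has_derivative (\<lambda>v. frechet_derivative g (at x) v + frechet_derivative h (at x) v)) (at x)"
    if "x \<in> S" for x
    using Suc.prems that by (auto intro!: has_derivative_add simp: frechet_derivative_works[symmetric])
  have "Ck_on k S (\<lambda>x. frechet_derivative (\<lambda>x. g x + h x) (at x) v)" for v
    by (rule Ck_on_cong[OF assms(1), of "\<lambda>x. frechet_derivative g (at x) v + frechet_derivative h (at x) v"])
      (use Suc.prems Suc.IH frechet_derivative_at[OF *] in \<open>auto dest: fun_cong\<close>)
  with * show ?case by (auto simp: differentiable_def)
qed

lemma Ck_on_bounded_linear:
  assumes "open S" "bounded_linear T" "Ck_on k S g"
  shows "Ck_on k S (\<lambda>x. T (g x))"
  using assms(3)
proof (induction k arbitrary: g)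
  case 0
  then show ?case using bounded_linear.continuous_on[OF assms(2)] by auto
next
  case (Suc k)
  have *: "((\<lambda>x. T (g x)) has_derivative (\<lambda>v. T (frechet_derivative g (at x) v))) (at x)"
    if "x \<in> S" for x
    using Suc.prems that
    by (auto intro!: bounded_linear.has_derivative[OF assms(2)] simp: frechet_derivative_works[symmetric])
  have "Ck_on k S (\<lambda>x. frechet_derivative (\<lambda>x. T (g x)) (at x) v)" for v
    by (rule Ck_on_cong[OF assms(1), of "\<lambda>x. T (frechet_derivative g (at x) v)"])
      (use Suc.prems Suc.IH frechet_derivative_at[OF *] in \<open>auto dest: fun_cong\<close>)
  with * show ?case by (auto simp: differentiable_def)
qed

lemma Ck_on_scaleR:
  assumes "open S" "Ck_on k S g" "Ck_on k S h"
  shows "Ck_on k S (\<lambda>x. g x *\<^sub>R h x)"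
  using assms(2,3)
proof (induction k arbitrary: g h)
  case 0
  then show ?case by (auto intro: continuous_on_scaleR)
next
  case (Suc k)
  let ?D = "\<lambda>x v. g x *\<^sub>R frechet_derivative h (at x) v + frechet_derivative g (at x) v *\<^sub>R h x"
  have *: "((\<lambda>x. g x *\<^sub>R h x) has_derivative ?D x) (at x)" if "x \<in> S" for x
    using Suc.prems that by (auto intro!: has_derivative_scaleR simp: frechet_derivative_works[symmetric])
  have "Ck_on k S (\<lambda>x. ?D x v)" for v
    by (rule Ck_on_add[OF assms(1)])
      (use Suc.prems Ck_on_pred[of k S g] Ck_on_pred[of k S h] in \<open>auto intro!: Suc.IH\<close>)
  then have "Ck_on k S (\<lambda>x. frechet_derivative (\<lambda>x. g x *\<^sub>R h x) (at x) v)" for v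
    by (rule Ck_on_cong[OF assms(1), rotated])
      (use frechet_derivative_at[OF *] in \<open>auto dest: fun_cong\<close>)
  with * show ?case by (auto simp: differentiable_def)
qed

definition directional_derivative ::
  "(real^2 \<Rightarrow> real^2) \<Rightarrow> (real^2 \<Rightarrow> 'a::real_normed_vector) \<Rightarrow> real^2 \<Rightarrow> 'a" where
  "directional_derivative X g u = frechet_derivative g (at u) (X u)"

lemma linear_cart2_expand:
  assumes "linear D"
  shows "D v = v $ 1 *\<^sub>R D (axis 1 1) + v $ 2 *\<^sub>R D (axis 2 1 :: real^2)"
proof -
  have "v = v $ 1 *\<^sub>R axis 1 1 + v $ 2 *\<^sub>R axis 2 1"
    by (simp add: vec_eq_iff forall_2 axis_def)
  then have "D v = D (v $ 1 *\<^sub>R axis 1 1 + v $ 2 *\<^sub>R axis 2 1)" by simp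
  then show ?thesis using assms by (simp add: linear_add linear_scale)
qed

text \<open>\<open>Ck_on\<close> speaks of derivatives in constant directions. Expanding \<open>X u\<close> in the standard basis
  reduces the varying direction to these, with components of \<open>X\<close> as coefficients.\<close>
lemma Ck_on_directional_derivative:
  assumes "open S" "Ck_on (Suc k) S g" "Ck_on k S X"
  shows "Ck_on k S (directional_derivative X g)"
proof (rule Ck_on_cong[OF assms(1)])
  show "Ck_on k S (\<lambda>u. X u $ 1 *\<^sub>R frechet_derivative g (at u) (axis 1 1)
                    + X u $ 2 *\<^sub>R frechet_derivative g (at u) (axis 2 1))"
    using assms
    by (intro Ck_on_add Ck_on_scaleR Ck_on_bounded_linear[of _ "\<lambda>x. x $ i" for i]) auto
next
  fix u assume "u \<in> S"
  then have "linear (frechet_derivative g (at u))"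
    using assms(2) by (auto simp: linear_frechet_derivative)
  from linear_cart2_expand[OF this, of "X u"]
  show "X u $ 1 *\<^sub>R frechet_derivative g (at u) (axis 1 1)
                    + X u $ 2 *\<^sub>R frechet_derivative g (at u) (axis 2 1) = directional_derivative X g u"
    by (simp add: directional_derivative_def)
qed

lemma grad_inner:
  assumes "g differentiable (at u)"
  shows "grad g u \<bullet> v = frechet_derivative g (at u) v"
  using linear_cart2_expand[OF linear_frechet_derivative[OF assms], of v]
  by (simp add: grad_def inner_vec_def sum_2)

text \<open>The determinant of two plane vectors. Collinearity of the jump of the flux and the jump of the
  state is the Rankine-Hugoniot condition with the speed eliminated.\<close>
definition wedge :: "real^2 \<Rightarrow> real^2 \<Rightarrow> real" where
  "wedge p q = p $ 1 * q $ 2 - p $ 2 * q $ 1"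

lemma wedge_simps [simp]:
  "wedge (p + p') q = wedge p q + wedge p' q" "wedge p (q + q') = wedge p q + wedge p q'"
  "wedge (p - p') q = wedge p q - wedge p' q" "wedge p (q - q') = wedge p q - wedge p q'"
  "wedge (a *\<^sub>R p) q = a * wedge p q" "wedge p (a *\<^sub>R q) = a * wedge p q"
  "wedge p p = 0"
  by (simp_all add: wedge_def algebra_simps)

lemma wedge_commute: "wedge p q = - wedge q p"
  by (simp add: wedge_def)

lemma abs_wedge_le: "\<bar>wedge p q\<bar> \<le> 2 * norm p * norm q"
proof -
  have "\<bar>p $ 1 * q $ 2\<bar> \<le> norm p * norm q" "\<bar>p $ 2 * q $ 1\<bar> \<le> norm p * norm q"
    by (auto simp: abs_mult intro!: mult_mono component_le_norm_cart)
  then show ?thesis unfolding wedge_def by linarith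
qed

lemma wedge_zero_imp_multiple:
  assumes "wedge p q = 0" "q \<noteq> 0"
  shows "\<exists>\<sigma>. p = \<sigma> *\<^sub>R q"
proof (cases "q $ 1 = 0")
  case True
  with assms(2) have "q $ 2 \<noteq> 0" by (simp add: vec_eq_iff forall_2)
  with assms(1) True show ?thesis
    by (intro exI[of _ "p $ 2 / q $ 2"]) (auto simp: vec_eq_iff forall_2 wedge_def)
next
  case False
  with assms(1) show ?thesis
    by (intro exI[of _ "p $ 1 / q $ 1"]) (auto simp: vec_eq_iff forall_2 wedge_def field_simps)
qed

lemma wedge_dual_bases: "wedge l l' * wedge p p' = (l \<bullet> p) * (l' \<bullet> p') - (l \<bullet> p') * (l' \<bullet> p)"
  by (simp add: wedge_def inner_vec_def sum_2 algebra_simps)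

section \<open>The system in Riemann coordinates\<close>

locale riemann_coordinates = hyperbolic_system +
  fixes r s :: "real^2 \<Rightarrow> real"
    and U :: "real \<times> real \<Rightarrow> real^2"
    and V :: "(real \<times> real) set"
  assumes grad_r: "u \<in> \<U> \<Longrightarrow> grad r u \<bullet> R Slow u = 1" "u \<in> \<U> \<Longrightarrow> grad r u \<bullet> R Fast u = 0"
    and grad_s: "u \<in> \<U> \<Longrightarrow> grad s u \<bullet> R Slow u = 0" "u \<in> \<U> \<Longrightarrow> grad s u \<bullet> R Fast u = 1"
    and diffeo: "diffeomorphism_between V \<U> U (\<lambda>u. (r u, s u))"
begin

lemma U_in [simp]: "z \<in> V \<Longrightarrow> U z \<in> \<U>"
  using diffeo by (auto simp: diffeomorphism_between_def)

lemma coordinates_U: "z \<in> V \<Longrightarrow> (r (U z), s (U z)) = z"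
  using diffeo by (auto simp: diffeomorphism_between_def)

lemma U_coordinates: "u \<in> \<U> \<Longrightarrow> U (r u, s u) = u"
  using diffeo by (auto simp: diffeomorphism_between_def)

lemma inj_U: "\<lbrakk>z \<in> V; w \<in> V; U z = U w\<rbrakk> \<Longrightarrow> z = w"
  using coordinates_U by metis

lemma coordinates_differentiable: "u \<in> \<U> \<Longrightarrow> (\<lambda>u. (r u, s u)) differentiable (at u)"
  using diffeo Ck_on.simps(2)[of 0 \<U> "\<lambda>u. (r u, s u)"]
  by (auto simp: diffeomorphism_between_def smooth_on_def simp del: Ck_on.simps)

lemma U_differentiable: "z \<in> V \<Longrightarrow> U differentiable (at z)"
  using diffeo Ck_on.simps(2)[of 0 V U]
  by (auto simp: diffeomorphism_between_def smooth_on_def simp del: Ck_on.simps)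

text \<open>The coordinate map is injective and continuous between planes: invariance of domain applies.\<close>
lemma open_V: "open V"
proof -
  let ?h = "\<lambda>u. (r u, s u)"
  have "open (?h ` \<U>)"
  proof (rule invariance_of_domain_gen[OF open_states])
    show "continuous_on \<U> ?h"
      using coordinates_differentiable
      by (auto intro!: continuous_at_imp_continuous_on differentiable_imp_continuous_within)
    show "inj_on ?h \<U>" by (rule inj_on_inverseI[where g = U]) (rule U_coordinates)
  qed simp
  moreover have "?h ` \<U> = V" using diffeo by (auto simp: diffeomorphism_between_def)
  ultimately show ?thesis by simp
qed

text \<open>The derivative of \<open>(r, s)\<close> maps the eigenvectors to the coordinate directions, and the derivative
  of \<open>U\<close> inverts it.\<close>
lemma U_has_partials:
  assumes z: "z \<in> V"
  shows "has_partials U (\<lambda>i. R i (U z)) z"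
proof -
  let ?u = "U z" and ?h = "\<lambda>u. (r u, s u)"
  define D where "D = frechet_derivative U (at z)"
  define E where "E = frechet_derivative ?h (at ?u)"
  have u: "?u \<in> \<U>" using z by simp
  have dU: "(U has_derivative D) (at z)"
    unfolding D_def using U_differentiable[OF z] by (simp add: frechet_derivative_works)
  have dh: "(?h has_derivative E) (at ?u)"
    unfolding E_def using coordinates_differentiable[OF u] by (simp add: frechet_derivative_works)
  have "E (R i ?u) = dir i" for i
  proof -
    have "(r has_derivative (\<lambda>v. fst (E v))) (at ?u)" "(s has_derivative (\<lambda>v. snd (E v))) (at ?u)"
      using has_derivative_fst[OF dh] has_derivative_snd[OF dh] by simp_all
    then have "grad r ?u \<bullet> v = fst (E v)" "grad s ?u \<bullet> v = snd (E v)" for v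
      using grad_inner frechet_derivative_at differentiableI by metis+
    then show ?thesis
      using grad_r[OF u] grad_s[OF u] by (cases i) (auto simp: prod_eq_iff)
  qed
  moreover have "D (E v) = v" for v
  proof -
    have "(U \<circ> ?h has_derivative D \<circ> E) (at ?u)"
      using diff_chain_at[OF dh] dU coordinates_U[OF z] by simp
    moreover have "(U \<circ> ?h has_derivative id) (at ?u)"
      by (rule has_derivative_transform_within_open[OF has_derivative_id open_states u])
        (simp add: U_coordinates)
    ultimately have "D \<circ> E = id" by (rule has_derivative_unique)
    then show ?thesis by (metis comp_apply id_apply)
  qed
  ultimately have "D (dir i) = R i ?u" for i by metis
  then have "D h = (h \<bullet> dir Slow) *\<^sub>R R Slow ?u + (h \<bullet> dir Fast) *\<^sub>R R Fast ?u" for h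
  proof -
    have "D h = D ((h \<bullet> dir Slow) *\<^sub>R dir Slow + (h \<bullet> dir Fast) *\<^sub>R dir Fast)"
      using dir_decomposition[of h Slow] by simp
    then show ?thesis
      using \<open>\<And>i. D (dir i) = R i ?u\<close> has_derivative_linear[OF dU]
      by (simp add: linear_add linear_scale del: dir.simps)
  qed
  then have "D = (\<lambda>h. (h \<bullet> dir Slow) *\<^sub>R R Slow ?u + (h \<bullet> dir Fast) *\<^sub>R R Fast ?u)" by (rule ext)
  then show ?thesis unfolding has_partials_def using dU by simp
qed

lemma compose_U_has_partials:
  assumes "z \<in> V" "g differentiable (at (U z))"
  shows "has_partials (\<lambda>z. g (U z)) (\<lambda>i. directional_derivative (R i) g (U z)) z"
proof -
  have dg: "(g has_derivative frechet_derivative g (at (U z))) (at (U z))"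
    using assms(2) by (simp add: frechet_derivative_works)
  show ?thesis
    using has_derivative_compose[OF U_has_partials[OF assms(1), unfolded has_partials_def] dg]
      linear_frechet_derivative[OF assms(2)]
    unfolding has_partials_def directional_derivative_def by (simp add: linear_add linear_scale)
qed

lemma compose_U_differentiable:
  assumes "z \<in> V" "g differentiable (at (U z))"
  shows "(\<lambda>z. g (U z)) differentiable (at z)"
  using compose_U_has_partials[OF assms] unfolding has_partials_def differentiable_def by blast

lemma compose_U_continuous_on:
  assumes "continuous_on \<U> g" "S \<subseteq> V"
  shows "continuous_on S (\<lambda>z. g (U z))"
proof (rule continuous_on_compose2[OF assms(1)])
  show "continuous_on S U"
    using U_differentiable assms(2)
    by (auto intro!: continuous_at_imp_continuous_on differentiable_imp_continuous_within)
qed (use assms(2) in auto)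

lemma flux_differentiable: "u \<in> \<U> \<Longrightarrow> f differentiable (at u)"
  using smooth_flux Ck_on.simps(2)[of 0 \<U> f] by (auto simp: smooth_on_def simp del: Ck_on.simps)

lemma R_differentiable: "u \<in> \<U> \<Longrightarrow> R i differentiable (at u)"
  using smooth_eigenvectors[of i] Ck_on.simps(2)[of 0 \<U> "R i"]
  by (auto simp: smooth_on_def simp del: Ck_on.simps)

lemma R_nonzero: "u \<in> \<U> \<Longrightarrow> R i u \<noteq> 0"
  using normalized[of u i] by auto

lemma biorthogonal_opp: "u \<in> \<U> \<Longrightarrow> L i u \<bullet> R (opp i) u = 0"
  using biorthogonal by (cases i) auto

lemma directional_derivative_flux:
  assumes "u \<in> \<U>"
  shows "directional_derivative (R i) f u = lam i u *\<^sub>R R i u"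
proof -
  have "frechet_derivative f (at u) v = jacobian f (at u) *v v" for v
    using flux_differentiable[OF assms] by (metis jacobian_works frechet_derivative_at)
  moreover have "jacobian f (at u) *v v = (lam Slow u * (L Slow u \<bullet> v)) *\<^sub>R R Slow u
      + (lam Fast u * (L Fast u \<bullet> v)) *\<^sub>R R Fast u" for v
    unfolding eigen_structure[OF assms]
    by (simp add: vec_eq_iff forall_2 matrix_vector_mult_def matrix_matrix_mult_def transpose_def
        vector_2 sum_2 inner_vec_def algebra_simps)
  ultimately show ?thesis
    using normalized[OF assms] biorthogonal[OF assms]
    by (cases i) (auto simp: directional_derivative_def)
qed

text \<open>The eigenvalue is the Rayleigh quotient of \<open>Df R\<close> and \<open>R\<close>, which consists of smooth data.\<close>
lemma lam_differentiable:
  assumes "u \<in> \<U>"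
  shows "lam i differentiable (at u)"
proof -
  let ?g = "\<lambda>u. (directional_derivative (R i) f u \<bullet> R i u) / (R i u \<bullet> R i u)"
  have "Ck_on 1 \<U> (directional_derivative (R i) f)"
    using smooth_flux smooth_eigenvectors[of i] open_states
    by (intro Ck_on_directional_derivative) (auto simp: smooth_on_def simp del: Ck_on.simps)
  then have "directional_derivative (R i) f differentiable (at u)"
    using assms by simp
  then have "?g differentiable (at u)"
    using R_differentiable[OF assms] R_nonzero[OF assms]
    by (intro differentiable_divide differentiable_inner) auto
  then obtain g' where g': "(?g has_derivative g') (at u)" by (auto simp: differentiable_def)
  have "(lam i has_derivative g') (at u)"
    by (rule has_derivative_transform_within_open[OF g' open_states assms])
      (simp add: directional_derivative_flux R_nonzero)
  then show ?thesis by (auto simp: differentiable_def)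
qed

lemma wedge_R_nonzero:
  assumes "u \<in> \<U>"
  shows "wedge (R i u) (R (opp i) u) \<noteq> 0"
  using wedge_dual_bases[of "L i u" "L (opp i) u" "R i u" "R (opp i) u"]
    normalized[OF assms] biorthogonal_opp[OF assms, of i] by auto

lemma lam_opp_neq: "u \<in> \<U> \<Longrightarrow> lam i u \<noteq> lam (opp i) u"
  using strictly_hyperbolic[of u] by (cases i) auto

end

section \<open>Total variation of monotone profiles\<close>

lemma total_variation_mono_le:
  assumes "mono g" "\<And>\<xi>. a \<le> g \<xi>" "\<And>\<xi>. g \<xi> \<le> b"
  shows "total_variation g \<le> ennreal (b - a)"
  unfolding total_variation_def
proof (rule SUP_least)
  fix xs :: "real list" assume "xs \<in> {xs. sorted xs}"
  then have "g (xs ! k) \<le> g (xs ! Suc k)" if "k < length xs - 1" for k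
    using that by (intro monoD[OF assms(1)]) (auto simp: sorted_iff_nth_mono_less)
  then have "(\<Sum>k<length xs - 1. ennreal \<bar>g (xs ! Suc k) - g (xs ! k)\<bar>)
      = (\<Sum>k<length xs - 1. ennreal (g (xs ! Suc k) - g (xs ! k)))"
    by (intro sum.cong) auto
  also have "\<dots> = ennreal (\<Sum>k<length xs - 1. g (xs ! Suc k) - g (xs ! k))"
    by (rule sum_ennreal) (use \<open>\<And>k. k < length xs - 1 \<Longrightarrow> _\<close> in auto)
  also have "(\<Sum>k<length xs - 1. g (xs ! Suc k) - g (xs ! k)) = g (xs ! (length xs - 1)) - g (xs ! 0)"
    by (rule sum_lessThan_telescope)
  also have "ennreal \<dots> \<le> ennreal (b - a)"
    using assms(2,3) by (intro ennreal_leI diff_mono) auto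
  finally show "(\<Sum>k<length xs - 1. ennreal \<bar>g (xs ! Suc k) - g (xs ! k)\<bar>) \<le> ennreal (b - a)" .
qed

lemma total_variation_uminus: "total_variation (\<lambda>\<xi>. - g \<xi>) = total_variation g"
  unfolding total_variation_def by (intro SUP_cong sum.cong refl) (simp add: abs_minus_commute)

text \<open>For a wave that runs through a segment by the profile \<open>m\<close>, with \<open>p\<close> the values of a scalar field
  along the segment: if the field is monotone there, only its end values matter, not the profile.\<close>
lemma total_variation_comp_mono_le:
  fixes p m :: "real \<Rightarrow> real"
  assumes p: "mono_on {0..1} p \<or> antimono_on {0..1} p"
    and m: "mono m" "range m \<subseteq> {0..1}"
  shows "total_variation (\<lambda>\<xi>. p (m \<xi>)) \<le> ennreal \<bar>p 1 - p 0\<bar>"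
proof -
  have *: "total_variation (\<lambda>\<xi>. q (m \<xi>)) \<le> ennreal (q 1 - q 0)" if "mono_on {0..1} q" for q :: "real \<Rightarrow> real"
  proof (rule total_variation_mono_le)
    have "m \<xi> \<in> {0..1}" for \<xi> using m(2) by (auto simp: image_subset_iff)
    then show "mono (\<lambda>\<xi>. q (m \<xi>))" "q 0 \<le> q (m \<xi>)" "q (m \<xi>) \<le> q 1" for \<xi>
      using monoD[OF m(1)] by (auto intro!: monoI mono_onD[OF that])
  qed
  show ?thesis
  proof (cases "mono_on {0..1} p")
    case True
    have "p 0 \<le> p 1" by (rule mono_onD[OF True]) auto
    then show ?thesis using *[OF True] by simp
  next
    case False
    with p have "monotone_on {0..1} (\<le>) (\<ge>) p" by simp
    then have "mono_on {0..1} (\<lambda>x. - p x)" "p 1 \<le> p 0"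
      by (auto simp: monotone_on_def)
    then show ?thesis using *[of "\<lambda>x. - p x"] total_variation_uminus[of "\<lambda>\<xi>. p (m \<xi>)"] by simp
  qed
qed

lemma total_variation_three_points:
  assumes "x \<le> y" "y \<le> z"
  shows "ennreal (\<bar>g y - g x\<bar> + \<bar>g z - g y\<bar>) \<le> total_variation g"
proof -
  have "(\<Sum>k<length [x, y, z] - 1. ennreal \<bar>g ([x, y, z] ! Suc k) - g ([x, y, z] ! k)\<bar>) \<le> total_variation g"
    unfolding total_variation_def by (rule SUP_upper) (use assms in auto)
  then show ?thesis by (simp add: numeral_2_eq_2)
qed

section \<open>Elementary waves and head-on interactions\<close>

context riemann_coordinates
begin

text \<open>An elementary wave whose profile runs monotonically through the segment from \<open>zl\<close> to \<open>zr\<close> in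
  Riemann coordinates (jumping over it in the case of a shock or contact). A slow wave is completed
  before the speed \<open>c\<close> and a fast wave starts after it, so that a slow and a fast wave with a
  common state and the same \<open>c\<close> together solve a Riemann problem.\<close>
definition localized_wave :: "real \<Rightarrow> wave_family \<Rightarrow> real \<times> real \<Rightarrow> real \<times> real \<Rightarrow> bool" where
  "localized_wave c i zl zr \<longleftrightarrow>
     (\<exists>v m \<alpha> \<beta>. elementary_wave i v (U zl) (U zr) \<and> v = (\<lambda>\<xi>. U (zl + m \<xi> *\<^sub>R (zr - zl))) \<and>
        mono m \<and> range m \<subseteq> {0..1} \<and> \<alpha> < \<beta> \<and> (\<forall>\<xi>\<le>\<alpha>. m \<xi> = 0) \<and> (\<forall>\<xi>\<ge>\<beta>. m \<xi> = 1) \<and>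
        (i = Slow \<longrightarrow> \<beta> \<le> c) \<and> (i = Fast \<longrightarrow> c \<le> \<alpha>))"

lemma localized_jump:
  assumes "elementary_wave i (jump \<sigma> (U zl) (U zr)) (U zl) (U zr)"
    and "i = Slow \<Longrightarrow> \<sigma> < c" "i = Fast \<Longrightarrow> c < \<sigma>"
  shows "localized_wave c i zl zr"
  unfolding localized_wave_def
proof (intro exI conjI)
  let ?m = "\<lambda>\<xi>. if \<xi> < \<sigma> then 0 else 1 :: real" and ?\<alpha> = "if i = Slow then \<sigma> - 1 else c"
  show "jump \<sigma> (U zl) (U zr) = (\<lambda>\<xi>. U (zl + ?m \<xi> *\<^sub>R (zr - zl)))"
    by (auto simp: jump_def)
  show "mono ?m" by (auto intro: monoI)
  show "?\<alpha> < \<sigma>" "\<forall>\<xi>\<le>?\<alpha>. ?m \<xi> = 0" "i = Fast \<longrightarrow> c \<le> ?\<alpha>" "i = Slow \<longrightarrow> \<sigma> \<le> c"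
    using assms(2,3) by (cases i; auto)+
qed (use assms in auto)

lemma lam_along:
  assumes "zl + t *\<^sub>R (h *\<^sub>R dir i) \<in> V"
  shows "((\<lambda>t. lam i (U (zl + t *\<^sub>R (h *\<^sub>R dir i)))) has_real_derivative
     h * (grad (lam i) (U (zl + t *\<^sub>R (h *\<^sub>R dir i))) \<bullet> R i (U (zl + t *\<^sub>R (h *\<^sub>R dir i))))) (at t within T)"
  using has_partials_along[OF compose_U_has_partials[OF assms lam_differentiable[OF U_in[OF assms]]], where i = i and T = T]
    grad_inner[OF lam_differentiable[OF U_in[OF assms]]]
  by (simp add: has_real_derivative_iff_has_vector_derivative directional_derivative_def)

lemma U_along:
  assumes "zl + t *\<^sub>R (h *\<^sub>R dir i) \<in> V"
  shows "((\<lambda>t. U (zl + t *\<^sub>R (h *\<^sub>R dir i))) has_vector_derivative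
     h *\<^sub>R R i (U (zl + t *\<^sub>R (h *\<^sub>R dir i)))) (at t within T)"
  using has_partials_along[OF U_has_partials[OF assms], where i = i and T = T] by simp

lemma flux_along:
  assumes "zl + t *\<^sub>R (h *\<^sub>R dir i) \<in> V"
  shows "((\<lambda>t. f (U (zl + t *\<^sub>R (h *\<^sub>R dir i)))) has_vector_derivative
     h *\<^sub>R (lam i (U (zl + t *\<^sub>R (h *\<^sub>R dir i))) *\<^sub>R R i (U (zl + t *\<^sub>R (h *\<^sub>R dir i))))) (at t within T)"
  using has_partials_along[OF compose_U_has_partials[OF assms flux_differentiable[OF U_in[OF assms]]], where i = i and T = T]
    directional_derivative_flux[OF U_in[OF assms]]
  by simp

text \<open>Along a coordinate line of a linearly degenerate family the characteristic speed is a constant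
  \<open>\<sigma>\<close>, and \<open>f(U) - \<sigma> U\<close> then has vanishing derivative.\<close>
lemma localized_contact:
  assumes ld: "linearly_degenerate i" and "h \<noteq> 0"
    and seg: "\<And>t. t \<in> {0..1} \<Longrightarrow> zl + t *\<^sub>R (h *\<^sub>R dir i) \<in> V"
    and c: "i = Slow \<Longrightarrow> lam i (U zl) < c" "i = Fast \<Longrightarrow> c < lam i (U zl)"
  shows "localized_wave c i zl (zl + h *\<^sub>R dir i)"
proof -
  define zr where "zr = zl + h *\<^sub>R dir i"
  define \<sigma> where "\<sigma> = lam i (U zl)"
  have V: "zl \<in> V" "zr \<in> V" using seg[of 0] seg[of 1] by (auto simp: zr_def)
  have const: "lam i (U (zl + t *\<^sub>R (h *\<^sub>R dir i))) = \<sigma>" if "t \<in> {0..1}" for t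
  proof -
    have "((\<lambda>t. lam i (U (zl + t *\<^sub>R (h *\<^sub>R dir i)))) has_real_derivative 0) (at x)" if "x \<in> {0..1}" for x
      using lam_along[OF seg[OF that], of UNIV] U_in[OF seg[OF that]] ld
      by (simp add: linearly_degenerate_def)
    from zero_derivative_imp_eq[where g = "\<lambda>t. lam i (U (zl + t *\<^sub>R (h *\<^sub>R dir i)))", OF _ this that, of 0]
    show ?thesis by (simp add: \<sigma>_def)
  qed
  have "((\<lambda>t. f (U (zl + t *\<^sub>R (h *\<^sub>R dir i))) - \<sigma> *\<^sub>R U (zl + t *\<^sub>R (h *\<^sub>R dir i))) has_derivative (\<lambda>x. 0))
      (at t within {0..1})" if t: "t \<in> {0..1}" for t
  proof -
    have "((\<lambda>t. \<sigma> *\<^sub>R U (zl + t *\<^sub>R (h *\<^sub>R dir i))) has_vector_derivative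
        \<sigma> *\<^sub>R (h *\<^sub>R R i (U (zl + t *\<^sub>R (h *\<^sub>R dir i))))) (at t within {0..1})"
      by (rule bounded_linear.has_vector_derivative[OF bounded_linear_scaleR_right U_along[OF seg[OF t]]])
    from has_vector_derivative_diff[OF flux_along[OF seg[OF t]] this]
    show ?thesis
      unfolding has_vector_derivative_def const[OF t] by (simp only: scaleR_left_commute diff_self scaleR_zero_right)
  qed
  from has_derivative_zero_constant[OF convex_real_interval(5) this]
  obtain k where "\<And>t. t \<in> {0..1} \<Longrightarrow> f (U (zl + t *\<^sub>R (h *\<^sub>R dir i))) - \<sigma> *\<^sub>R U (zl + t *\<^sub>R (h *\<^sub>R dir i)) = k"
    by blast
  from this[of 0] this[of 1] have "f (U zr) - \<sigma> *\<^sub>R U zr = f (U zl) - \<sigma> *\<^sub>R U zl"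
    by (simp add: zr_def)
  then have "rankine_hugoniot \<sigma> (U zl) (U zr)"
    unfolding rankine_hugoniot_def by (simp add: scaleR_diff_right algebra_simps)
  moreover have "U zl \<noteq> U zr"
    using inj_U[OF V] \<open>h \<noteq> 0\<close> by (cases i) (auto simp: zr_def prod_eq_iff)
  moreover have "\<sigma> = lam i (U zr)" using const[of 1] by (simp add: zr_def)
  ultimately have "contact i (jump \<sigma> (U zl) (U zr)) (U zl) (U zr)"
    unfolding contact_def using V ld \<sigma>_def by auto
  then show ?thesis
    using localized_jump[of i \<sigma> zl zr c] c unfolding elementary_wave_def zr_def \<sigma>_def by auto
qed

text \<open>Along a coordinate line of a genuinely nonlinear family the characteristic speed increases
  strictly. The profile of the rarefaction is the line parametrized by that speed.\<close>
lemma localized_rarefaction: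
  assumes gnl: "genuinely_nonlinear i" and "h > 0"
    and seg: "\<And>t. t \<in> {0..1} \<Longrightarrow> zl + t *\<^sub>R (h *\<^sub>R dir i) \<in> V"
    and c: "i = Slow \<Longrightarrow> lam i (U (zl + h *\<^sub>R dir i)) \<le> c" "i = Fast \<Longrightarrow> c \<le> lam i (U zl)"
  shows "localized_wave c i zl (zl + h *\<^sub>R dir i)"
proof -
  define z where "z t = zl + t *\<^sub>R (h *\<^sub>R dir i)" for t
  define l where "l t = lam i (U (z t))" for t
  define l' where "l' t = h * (grad (lam i) (U (z t)) \<bullet> R i (U (z t)))" for t
  have zV: "z t \<in> V" if "t \<in> {0..1}" for t using seg[OF that] by (simp add: z_def)
  have dl: "(l has_real_derivative l' t) (at t within T)" if "t \<in> {0..1}" for t T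
    unfolding l_def[abs_def] l'_def z_def using lam_along[OF seg[OF that]] .
  have l'_pos: "l' t > 0" if "t \<in> {0..1}" for t
    using gnl oriented[OF U_in[OF zV[OF that]], of i] \<open>h > 0\<close> U_in[OF zV[OF that]]
    unfolding l'_def genuinely_nonlinear_def by (metis less_eq_real_def mult_pos_pos)
  have less: "l x < l y" if "0 \<le> x" "x < y" "y \<le> 1" for x y
    by (rule DERIV_pos_imp_increasing[OF that(2)]) (use that dl l'_pos in \<open>meson atLeastAtMost_iff order_trans\<close>)
  have cont: "continuous_on {0..1} l"
    using dl by (meson DERIV_continuous continuous_on_eq_continuous_within)
  have inj: "inj_on l {0..1}"
    by (intro inj_onI) (use less in \<open>metis atLeastAtMost_iff less_irrefl linorder_neqE_linordered_idom\<close>)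
  have image: "l ` {0..1} = {l 0..l 1}"
  proof
    show "l ` {0..1} \<subseteq> {l 0..l 1}"
    proof clarify
      fix t :: real assume "t \<in> {0..1}"
      then show "l t \<in> {l 0..l 1}"
        using less[of 0 t] less[of t 1] by (cases "t = 0"; cases "t = 1") auto
    qed
    show "{l 0..l 1} \<subseteq> l ` {0..1}"
    proof
      fix \<xi> assume "\<xi> \<in> {l 0..l 1}"
      then obtain t where "0 \<le> t" "t \<le> 1" "l t = \<xi>" using IVT'[of l 0 \<xi> 1] cont by auto
      then show "\<xi> \<in> l ` {0..1}" by auto
    qed
  qed
  define g where "g = the_inv_into {0..1} l"
  have gl: "g (l t) = t" if "t \<in> {0..1}" for t
    unfolding g_def using the_inv_into_f_f[OF inj that] .
  have g: "g \<xi> \<in> {0..1}" "l (g \<xi>) = \<xi>" if "\<xi> \<in> {l 0..l 1}" for \<xi>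
    using that gl unfolding image[symmetric] by auto
  have g_le: "g x \<le> g y" if "x \<in> {l 0..l 1}" "y \<in> {l 0..l 1}" "x \<le> y" for x y
    using g[OF that(1)] g[OF that(2)] less[of "g y" "g x"] that(3) by fastforce
  have "l 0 < l 1" using less by simp
  \<comment> \<open>Clamping the speed keeps the profile constant outside the fan and monotone throughout.\<close>
  define m where "m \<xi> = g (max (l 0) (min (l 1) \<xi>))" for \<xi>
  have clamp: "max (l 0) (min (l 1) \<xi>) \<in> {l 0..l 1}" for \<xi> using \<open>l 0 < l 1\<close> by auto
  have m_g: "m \<xi> = g \<xi>" if "\<xi> \<in> {l 0..l 1}" for \<xi> using that by (simp add: m_def)
  have m: "mono m" "range m \<subseteq> {0..1}" "\<forall>\<xi>\<le>l 0. m \<xi> = 0" "\<forall>\<xi>\<ge>l 1. m \<xi> = 1"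
  proof -
    show "mono m" unfolding m_def by (intro monoI g_le clamp) auto
    show "range m \<subseteq> {0..1}" unfolding m_def using g(1)[OF clamp] by blast
    show "\<forall>\<xi>\<le>l 0. m \<xi> = 0" "\<forall>\<xi>\<ge>l 1. m \<xi> = 1"
      unfolding m_def using \<open>l 0 < l 1\<close> gl by (auto simp: max_def min_def)
  qed
  define v where "v \<xi> = U (z (m \<xi>))" for \<xi>
  have "\<exists>k. (v has_vector_derivative k *\<^sub>R R i (v \<xi>)) (at \<xi> within {l 0..l 1})" if \<xi>: "\<xi> \<in> {l 0..l 1}" for \<xi>
  proof -
    define t where "t = g \<xi>"
    have t: "t \<in> {0..1}" "l t = \<xi>" using g[OF \<xi>] by (simp_all add: t_def)
    have "(g has_derivative (\<lambda>x. x / l' t)) (at (l t) within l ` {0..1})"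
    proof (rule has_derivative_inverse_within)
      show "(l has_derivative (*) (l' t)) (at t within {0..1})"
        using dl[OF t(1)] by (simp add: has_field_derivative_def)
      have "continuous_on (l ` {0..1}) g"
        using continuous_on_inv[OF cont] gl by auto
      then show "continuous (at (l t) within l ` {0..1}) g"
        using t(1) by (auto simp: continuous_on_eq_continuous_within)
      show "linear (\<lambda>x. x / l' t)"
        by (rule linearI) (simp_all add: add_divide_distrib)
      show "(\<lambda>x. x / l' t) \<circ> (*) (l' t) = id" using l'_pos[OF t(1)] by auto
    qed (use t gl in auto)
    then have dg: "(g has_vector_derivative (1 / l' t)) (at \<xi> within {l 0..l 1})"
      by (simp add: has_vector_derivative_def image t(2))
    have "((\<lambda>t. U (z t)) has_vector_derivative h *\<^sub>R R i (U (z t))) (at (g \<xi>) within g ` {l 0..l 1})"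
      using U_along[OF seg[OF t(1)]] unfolding z_def t_def by simp
    from vector_diff_chain_within[OF dg this]
    have "((\<lambda>\<xi>. U (z (g \<xi>))) has_vector_derivative ((1 / l' t) * h) *\<^sub>R R i (U (z t))) (at \<xi> within {l 0..l 1})"
      by (simp add: o_def)
    then have "(v has_vector_derivative ((1 / l' t) * h) *\<^sub>R R i (U (z t))) (at \<xi> within {l 0..l 1})"
      by (rule has_vector_derivative_transform[OF \<xi>, rotated]) (simp add: v_def m_g)
    moreover have "U (z t) = v \<xi>" by (simp add: v_def m_g[OF \<xi>] t_def)
    ultimately show ?thesis by auto
  qed
  moreover have "v \<xi> \<in> \<U> \<and> lam i (v \<xi>) = \<xi>" if "\<xi> \<in> {l 0..l 1}" for \<xi>
    using g[OF that] zV m_g[OF that] by (simp add: v_def l_def)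
  moreover have "U (z 0) \<in> \<U>" "U (z 1) \<in> \<U>" using zV by simp_all
  ultimately have "rarefaction i v (U (z 0)) (U (z 1))"
    unfolding rarefaction_def using gnl m(3,4) \<open>l 0 < l 1\<close> by (auto simp: l_def v_def)
  moreover have "z 0 = zl" "z 1 = zl + h *\<^sub>R dir i" by (simp_all add: z_def)
  moreover have "v = (\<lambda>\<xi>. U (zl + m \<xi> *\<^sub>R (zl + h *\<^sub>R dir i - zl)))"
    by (simp add: v_def[abs_def] z_def)
  ultimately show ?thesis
    unfolding localized_wave_def elementary_wave_def
    using m \<open>l 0 < l 1\<close> c
    by (intro exI[of _ v] exI[of _ m] exI[of _ "l 0"] exI[of _ "l 1"]) (auto simp: l_def)
qed

lemma localized_wave_profile_variation:
  assumes "localized_wave c i zl zr"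
    and "mono_on {0..1} (\<lambda>t. \<phi> (U (zl + t *\<^sub>R (zr - zl)))) \<or> antimono_on {0..1} (\<lambda>t. \<phi> (U (zl + t *\<^sub>R (zr - zl))))"
  shows "\<exists>v. elementary_wave i v (U zl) (U zr) \<and>
     total_variation (\<lambda>\<xi>. \<phi> (v \<xi>)) \<le> ennreal \<bar>\<phi> (U zr) - \<phi> (U zl)\<bar>"
proof -
  obtain v m where v: "elementary_wave i v (U zl) (U zr)" "v = (\<lambda>\<xi>. U (zl + m \<xi> *\<^sub>R (zr - zl)))"
    and m: "mono m" "range m \<subseteq> {0..1}"
    using assms(1) unfolding localized_wave_def by blast
  show ?thesis
    using total_variation_comp_mono_le[OF assms(2) m] v by (intro exI[of _ v]) simp
qed

lemma localized_waves_riemann_solution: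
  assumes "localized_wave c Slow zl zm" "localized_wave c Fast zm zr"
  shows "\<exists>v \<alpha> \<beta>. riemann_solution v (U zl) (U zr) \<and> \<alpha> \<le> c \<and> c \<le> \<beta> \<and>
     v \<alpha> = U zl \<and> v c = U zm \<and> v \<beta> = U zr"
proof -
  obtain vs m \<alpha> \<beta> where s: "elementary_wave Slow vs (U zl) (U zm)" "vs = (\<lambda>\<xi>. U (zl + m \<xi> *\<^sub>R (zm - zl)))"
    "\<alpha> < \<beta>" "\<forall>\<xi>\<le>\<alpha>. m \<xi> = 0" "\<forall>\<xi>\<ge>\<beta>. m \<xi> = 1" "\<beta> \<le> c"
    using assms(1) unfolding localized_wave_def by blast
  obtain vf m' \<alpha>' \<beta>' where f: "elementary_wave Fast vf (U zm) (U zr)" "vf = (\<lambda>\<xi>. U (zm + m' \<xi> *\<^sub>R (zr - zm)))"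
    "\<alpha>' < \<beta>'" "\<forall>\<xi>\<le>\<alpha>'. m' \<xi> = 0" "\<forall>\<xi>\<ge>\<beta>'. m' \<xi> = 1" "c \<le> \<alpha>'"
    using assms(2) unfolding localized_wave_def by blast
  define v where "v = (\<lambda>\<xi>. if \<xi> \<le> c then vs \<xi> else vf \<xi>)"
  have "\<forall>\<xi>\<ge>c. vs \<xi> = U zm" "\<forall>\<xi>\<le>c. vf \<xi> = U zm"
    using s f by auto
  then have "riemann_solution v (U zl) (U zr)"
    unfolding riemann_solution_def outgoing_wave_def v_def using s(1) f(1) by blast
  moreover have "v \<alpha> = U zl" "v c = U zm" "v \<beta>' = U zr"
    unfolding v_def using s f by auto
  ultimately show ?thesis using s f by (intro exI[of _ v] exI[of _ \<alpha>] exI[of _ \<beta>']) auto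
qed

text \<open>The outgoing profile attains its end states and its middle state in order, which bounds its
  variation from below by the two differences. The incoming variations are at most the
  differences of the end values, by monotonicity.\<close>
lemma head_on_inequality:
  assumes tvd: "glimm_tvd_field \<phi>"
    and incoming: "localized_wave c Fast zl zm" "localized_wave c Slow zm zr"
    and outgoing: "localized_wave c Slow zl zm'" "localized_wave c Fast zm' zr"
    and monotone: "mono_on {0..1} (\<lambda>t. \<phi> (U (zl + t *\<^sub>R (zm - zl)))) \<or> antimono_on {0..1} (\<lambda>t. \<phi> (U (zl + t *\<^sub>R (zm - zl))))"
      "mono_on {0..1} (\<lambda>t. \<phi> (U (zm + t *\<^sub>R (zr - zm)))) \<or> antimono_on {0..1} (\<lambda>t. \<phi> (U (zm + t *\<^sub>R (zr - zm))))"
  shows "\<bar>\<phi> (U zm') - \<phi> (U zl)\<bar> + \<bar>\<phi> (U zr) - \<phi> (U zm')\<bar>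
       \<le> \<bar>\<phi> (U zm) - \<phi> (U zl)\<bar> + \<bar>\<phi> (U zr) - \<phi> (U zm)\<bar>"
proof -
  obtain v1 where v1: "elementary_wave Fast v1 (U zl) (U zm)"
    "total_variation (\<lambda>\<xi>. \<phi> (v1 \<xi>)) \<le> ennreal \<bar>\<phi> (U zm) - \<phi> (U zl)\<bar>"
    using localized_wave_profile_variation[OF incoming(1) monotone(1)] by blast
  obtain v2 where v2: "elementary_wave Slow v2 (U zm) (U zr)"
    "total_variation (\<lambda>\<xi>. \<phi> (v2 \<xi>)) \<le> ennreal \<bar>\<phi> (U zr) - \<phi> (U zm)\<bar>"
    using localized_wave_profile_variation[OF incoming(2) monotone(2)] by blast
  obtain v \<alpha> \<beta> where v: "riemann_solution v (U zl) (U zr)" "\<alpha> \<le> c" "c \<le> \<beta>"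
     "v \<alpha> = U zl" "v c = U zm'" "v \<beta> = U zr"
    using localized_waves_riemann_solution[OF outgoing] by blast
  have "approaching Fast v1 Slow v2 (U zl) (U zm) (U zr)"
    unfolding approaching_def using v1(1) v2(1) by simp
  then have "total_variation (\<lambda>X. \<phi> (v (X / 1)))
      \<le> total_variation (\<lambda>\<xi>. \<phi> (v1 \<xi>)) + total_variation (\<lambda>\<xi>. \<phi> (v2 \<xi>))"
    using tvd v(1) unfolding glimm_tvd_field_def by (meson zero_less_one)
  also have "\<dots> \<le> ennreal \<bar>\<phi> (U zm) - \<phi> (U zl)\<bar> + ennreal \<bar>\<phi> (U zr) - \<phi> (U zm)\<bar>"
    using v1(2) v2(2) by (rule add_mono)
  also have "\<dots> = ennreal (\<bar>\<phi> (U zm) - \<phi> (U zl)\<bar> + \<bar>\<phi> (U zr) - \<phi> (U zm)\<bar>)"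
    by simp
  finally have "total_variation (\<lambda>X. \<phi> (v X)) \<le> \<dots>" by simp
  with total_variation_three_points[OF v(2,3), of "\<lambda>X. \<phi> (v X)"]
  have "ennreal (\<bar>\<phi> (U zm') - \<phi> (U zl)\<bar> + \<bar>\<phi> (U zr) - \<phi> (U zm')\<bar>)
      \<le> ennreal (\<bar>\<phi> (U zm) - \<phi> (U zl)\<bar> + \<bar>\<phi> (U zr) - \<phi> (U zm)\<bar>)"
    unfolding v(4,5,6) by (rule order_trans)
  then show ?thesis by (subst (asm) ennreal_le_iff) auto
qed

end

section \<open>Weak shocks\<close>

lemma eventually_at_right_scale:
  fixes k :: real
  assumes "eventually P (at_right 0)" "k > 0"
  shows "\<forall>\<^sub>F \<epsilon> in at_right 0. P (k * \<epsilon>)"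
proof -
  obtain b where b: "b > 0" "\<And>y. 0 < y \<Longrightarrow> y < b \<Longrightarrow> P y"
    using assms(1) unfolding eventually_at_right_field by auto
  show ?thesis unfolding eventually_at_right_field
    by (rule exI[of _ "b / k"]) (use b assms(2) in \<open>auto simp: field_simps\<close>)
qed

lemma eventually_at_right_0_le: "b > 0 \<Longrightarrow> \<forall>\<^sub>F \<rho> in at_right (0::real). \<rho> \<le> b"
  unfolding eventually_at_right_field by (auto intro!: exI[of _ b])

lemma eventually_bounded:
  fixes G :: "real \<times> real \<Rightarrow> 'a::real_normed_vector"
  assumes "continuous (at z0) G" "norm (G z0) < M"
  shows "\<forall>\<^sub>F \<rho> in at_right 0. \<forall>z\<in>cball z0 \<rho>. norm (G z) \<le> M"
proof -
  have "M - norm (G z0) > 0" using assms(2) by simp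
  from continuous_near[OF assms(1) this] show ?thesis
  proof eventually_elim
    case (elim \<rho>)
    show ?case
    proof
      fix z assume "z \<in> cball z0 \<rho>"
      with elim have "norm (G z - G z0) \<le> M - norm (G z0)" by blast
      then show "norm (G z) \<le> M" using norm_triangle_sub[of "G z" "G z0"] by linarith
    qed
  qed
qed

lemma midpoint_in_cball:
  fixes x y z0 :: "'a::real_normed_vector"
  assumes "x \<in> cball z0 \<rho>" "y \<in> cball z0 \<rho>"
  shows "(1/2) *\<^sub>R (x + y) \<in> cball z0 \<rho>"
  using convexD[OF convex_cball(1) assms, of "1/2" "1/2"] by (simp add: scaleR_add_right)

lemma small_factor:
  fixes C e :: real
  assumes "C > 0" "e > 0"
  obtains d where "d > 0" "d \<le> 1" "d * C \<le> e"
proof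
  show "min 1 (e / C) > 0" "min 1 (e / C) \<le> 1" using assms by auto
  have "min 1 (e / C) * C \<le> e / C * C" by (rule mult_right_mono) (use assms in auto)
  then show "min 1 (e / C) * C \<le> e" using assms by simp
qed

lemma abs_increment_le:
  assumes "zl \<in> cball z0 \<rho>" "zr \<in> cball z0 \<rho>"
  shows "\<bar>(zr - zl) \<bullet> dir i\<bar> \<le> 2 * \<rho>"
proof -
  have "norm (zr - zl) \<le> norm (zr - z0) + norm (z0 - zl)"
    by (rule norm_diff_triangle_ineq[of zr z0 z0 zl, simplified])
  then show ?thesis
    using assms abs_inner_dir_le[of "zr - zl" i] by (simp add: dist_norm norm_minus_commute)
qed

context riemann_coordinates
begin

abbreviation "lm i z \<equiv> lam i (U z)"
abbreviation "Rv i z \<equiv> R i (U z)"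
abbreviation "mid zl zr \<equiv> (1/2) *\<^sub>R (zl + zr)"

lemma Rv_differentiable: "z \<in> V \<Longrightarrow> Rv i differentiable (at z)"
  by (intro compose_U_differentiable R_differentiable U_in)

lemma lm_differentiable: "z \<in> V \<Longrightarrow> lm i differentiable (at z)"
  by (intro compose_U_differentiable lam_differentiable U_in)

lemma Rv_continuous: "z \<in> V \<Longrightarrow> continuous (at z) (Rv i)"
  and lm_continuous: "z \<in> V \<Longrightarrow> continuous (at z) (lm i)"
  using Rv_differentiable lm_differentiable differentiable_imp_continuous_within by blast+

lemma flux_has_partials:
  assumes "z \<in> V"
  shows "has_partials (\<lambda>z. f (U z)) (\<lambda>i. lm i z *\<^sub>R Rv i z) z"
  using compose_U_has_partials[OF assms flux_differentiable[OF U_in[OF assms]]]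
  by (simp add: directional_derivative_flux[OF U_in[OF assms]])

text \<open>The partial derivatives of the flux are those of the state times the characteristic speeds, so
  the two jumps have expansions in the same vectors, taken at the midpoint.\<close>
lemma jump_expansions:
  assumes z0: "z0 \<in> V" and "\<eta> > 0"
  shows "\<forall>\<^sub>F \<rho> in at_right 0. \<forall>zl\<in>cball z0 \<rho>. \<forall>zr\<in>cball z0 \<rho>.
    norm (U zr - U zl - (((zr - zl) \<bullet> dir i) *\<^sub>R Rv i (mid zl zr)
         + ((zr - zl) \<bullet> dir (opp i)) *\<^sub>R Rv (opp i) (mid zl zr))) \<le> \<eta> * \<rho>\<^sup>2 \<and>
    norm (f (U zr) - f (U zl) - (((zr - zl) \<bullet> dir i) *\<^sub>R (lm i (mid zl zr) *\<^sub>R Rv i (mid zl zr))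
         + ((zr - zl) \<bullet> dir (opp i)) *\<^sub>R (lm (opp i) (mid zl zr) *\<^sub>R Rv (opp i) (mid zl zr)))) \<le> \<eta> * \<rho>\<^sup>2"
proof -
  have F: "\<forall>z\<in>V. has_partials (\<lambda>z. f (U z)) (\<lambda>i. lm i z *\<^sub>R Rv i z) z"
    and F': "\<forall>i. (\<lambda>z. lm i z *\<^sub>R Rv i z) differentiable (at z0)"
    and U: "\<forall>z\<in>V. has_partials U (\<lambda>i. Rv i z) z" and U': "\<forall>i. Rv i differentiable (at z0)"
    using z0 flux_has_partials U_has_partials Rv_differentiable lm_differentiable
    by (auto intro: differentiable_scaleR)
  from symmetric_difference[OF open_V z0 F F' assms(2), where i = i]
    symmetric_difference[OF open_V z0 U U' assms(2), where i = i]
  show ?thesis by eventually_elim blast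
qed

lemma fields_bounded:
  assumes z0: "z0 \<in> V"
  obtains M where "M > 0" "\<forall>\<^sub>F \<rho> in at_right 0. \<forall>z\<in>cball z0 \<rho>. \<forall>k. norm (Rv k z) \<le> M \<and> \<bar>lm k z\<bar> \<le> M"
proof -
  define M where "M = 1 + norm (Rv Slow z0) + norm (Rv Fast z0) + \<bar>lm Slow z0\<bar> + \<bar>lm Fast z0\<bar>"
  have "norm (Rv k z0) < M" "norm (lm k z0) < M" for k
    by (cases k; simp add: M_def add_pos_nonneg)+
  note * = eventually_bounded[OF Rv_continuous[OF z0] this(1)] eventually_bounded[OF lm_continuous[OF z0] this(2)]
  have "\<forall>\<^sub>F \<rho> in at_right 0. \<forall>z\<in>cball z0 \<rho>. \<forall>k. norm (Rv k z) \<le> M \<and> \<bar>lm k z\<bar> \<le> M"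
    using *[of Slow] *[of Fast]
  proof eventually_elim
    case (elim \<rho>)
    show ?case
    proof (intro ballI allI)
      fix z k assume "z \<in> cball z0 \<rho>"
      with elim show "norm (Rv k z) \<le> M \<and> \<bar>lm k z\<bar> \<le> M" by (cases k) auto
    qed
  qed
  moreover have "M > 0" by (simp add: M_def add_pos_nonneg)
  ultimately show ?thesis using that by blast
qed

text \<open>The coefficient of the product of the two coordinate increments in the determinant of the jumps of
  flux and state. It is nonzero by strict hyperbolicity.\<close>
definition separation :: "wave_family \<Rightarrow> real \<times> real \<Rightarrow> real" where
  "separation i z = (lm i z - lm (opp i) z) * wedge (Rv i z) (Rv (opp i) z)"

lemma separation_nonzero: "z \<in> V \<Longrightarrow> separation i z \<noteq> 0"
  unfolding separation_def using wedge_R_nonzero lam_opp_neq by simp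

lemma wedge_Rv_continuous_on: "continuous_on V (\<lambda>z. wedge (Rv i z) (Rv j z))"
  and separation_continuous_on: "continuous_on V (separation i)"
  unfolding separation_def[abs_def] wedge_def
  by (intro continuous_intros continuous_at_imp_continuous_on ballI Rv_continuous lm_continuous; assumption)+

text \<open>In the determinant of the two expansions the squares of the coordinate increments drop out, since
  each eigenvector is collinear with its multiple by the characteristic speed. The remainders are
  \<open>o(\<rho>\<^sup>2)\<close> against vectors of size \<open>\<rho>\<close>.\<close>
lemma hugoniot_defect:
  assumes z0: "z0 \<in> V" and "\<eta> > 0"
  shows "\<forall>\<^sub>F \<rho> in at_right 0. \<forall>zl\<in>cball z0 \<rho>. \<forall>zr\<in>cball z0 \<rho>.
    \<bar>wedge (f (U zr) - f (U zl)) (U zr - U zl)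
       - ((zr - zl) \<bullet> dir i) * ((zr - zl) \<bullet> dir (opp i)) * separation i (mid zl zr)\<bar> \<le> \<eta> * \<rho> ^ 3"
proof -
  obtain M where "M > 0" and M: "\<forall>\<^sub>F \<rho> in at_right 0. \<forall>z\<in>cball z0 \<rho>. \<forall>k. norm (Rv k z) \<le> M \<and> \<bar>lm k z\<bar> \<le> M"
    using fields_bounded[OF z0] by blast
  define B where "B = M + M * M"
  have "B > 0" "M \<le> B" "M * M \<le> B" using \<open>M > 0\<close> by (auto simp: B_def add_pos_pos)
  obtain \<eta>' where \<eta>': "\<eta>' > 0" "\<eta>' \<le> 1" "\<eta>' * (16 * B + 2) \<le> \<eta>"
    using small_factor[of "16 * B + 2" \<eta>] \<open>\<eta> > 0\<close> \<open>B > 0\<close> by auto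
  show ?thesis
    using M jump_expansions[OF z0 \<eta>'(1), of i] eventually_at_right_less[of "0::real"] eventually_at_right_0_le[OF zero_less_one]
  proof eventually_elim
    case (elim \<rho>)
    show ?case
    proof (intro ballI)
      fix zl zr assume z: "zl \<in> cball z0 \<rho>" "zr \<in> cball z0 \<rho>"
      define m where "m = mid zl zr"
      define x where "x = (zr - zl) \<bullet> dir i"
      define y where "y = (zr - zl) \<bullet> dir (opp i)"
      define A where "A = x *\<^sub>R Rv i m + y *\<^sub>R Rv (opp i) m"
      define A' where "A' = x *\<^sub>R (lm i m *\<^sub>R Rv i m) + y *\<^sub>R (lm (opp i) m *\<^sub>R Rv (opp i) m)"
      define E where "E = U zr - U zl - A"
      define E' where "E' = f (U zr) - f (U zl) - A'"
      have E: "norm E \<le> \<eta>' * \<rho>\<^sup>2" "norm E' \<le> \<eta>' * \<rho>\<^sup>2"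
        using elim(2) z unfolding E_def E'_def A_def A'_def x_def y_def m_def by blast+
      have xy: "\<bar>x\<bar> \<le> 2 * \<rho>" "\<bar>y\<bar> \<le> 2 * \<rho>"
        unfolding x_def y_def using abs_increment_le[OF z] by blast+
      have "m \<in> cball z0 \<rho>" unfolding m_def using midpoint_in_cball[OF z] .
      then have Mm: "norm (Rv k m) \<le> M" "\<bar>lm k m\<bar> \<le> M" for k using elim(1) by blast+
      have 1: "norm (a *\<^sub>R Rv k m) \<le> 2 * \<rho> * B" if "\<bar>a\<bar> \<le> 2 * \<rho>" for a k
        unfolding norm_scaleR by (intro mult_mono that order_trans[OF Mm(1) \<open>M \<le> B\<close>]) (use elim in auto)
      have 2: "norm (a *\<^sub>R (lm k m *\<^sub>R Rv k m)) \<le> 2 * \<rho> * B" if "\<bar>a\<bar> \<le> 2 * \<rho>" for a k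
      proof -
        have "\<bar>lm k m\<bar> * norm (Rv k m) \<le> M * M"
          by (intro mult_mono Mm) (use \<open>M > 0\<close> in auto)
        then show ?thesis
          unfolding norm_scaleR by (intro mult_mono that) (use \<open>M * M \<le> B\<close> elim in auto)
      qed
      have nA: "norm A \<le> 4 * \<rho> * B" "norm A' \<le> 4 * \<rho> * B"
        using norm_triangle_le[OF add_mono[OF 1[OF xy(1), of i] 1[OF xy(2), of "opp i"]]]
          norm_triangle_le[OF add_mono[OF 2[OF xy(1), of i] 2[OF xy(2), of "opp i"]]]
        unfolding A_def A'_def by linarith+
      have "wedge A' A = x * y * separation i m"
        unfolding A_def A'_def separation_def
        by (simp add: wedge_commute[of "Rv (opp i) m" "Rv i m"] algebra_simps)
      moreover have "f (U zr) - f (U zl) = A' + E'" "U zr - U zl = A + E"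
        by (simp_all add: E_def E'_def)
      ultimately have "wedge (f (U zr) - f (U zl)) (U zr - U zl) - x * y * separation i m
          = wedge A' E + wedge E' A + wedge E' E" by simp
      also have "\<bar>\<dots>\<bar> \<le> \<bar>wedge A' E\<bar> + \<bar>wedge E' A\<bar> + \<bar>wedge E' E\<bar>" by linarith
      also have "\<dots> \<le> 2 * (4 * \<rho> * B) * (\<eta>' * \<rho>\<^sup>2) + 2 * (\<eta>' * \<rho>\<^sup>2) * (4 * \<rho> * B) + 2 * (\<eta>' * \<rho>\<^sup>2) * (\<eta>' * \<rho>\<^sup>2)"
        by (intro add_mono order_trans[OF abs_wedge_le] mult_mono order_refl E nA)
          (use elim \<eta>' \<open>B > 0\<close> in auto)
      also have "\<dots> = \<eta>' * (16 * B + 2 * (\<eta>' * \<rho>)) * \<rho> ^ 3"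
        by (simp add: power2_eq_square power3_eq_cube algebra_simps)
      also have "\<dots> \<le> \<eta> * \<rho> ^ 3"
      proof (intro mult_right_mono)
        have "\<eta>' * \<rho> \<le> 1 * 1" by (rule mult_mono) (use \<eta>' elim in auto)
        then have "\<eta>' * (16 * B + 2 * (\<eta>' * \<rho>)) \<le> \<eta>' * (16 * B + 2)"
          using \<eta>'(1) by (intro mult_left_mono) auto
        then show "\<eta>' * (16 * B + 2 * (\<eta>' * \<rho>)) \<le> \<eta>" using \<eta>'(3) by linarith
      qed (use elim in auto)
      finally show "\<bar>wedge (f (U zr) - f (U zl)) (U zr - U zl)
        - ((zr - zl) \<bullet> dir i) * ((zr - zl) \<bullet> dir (opp i)) * separation i (mid zl zr)\<bar> \<le> \<eta> * \<rho> ^ 3"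
        unfolding x_def y_def m_def .
    qed
  qed
qed

lemma eventually_bounded_below:
  fixes K :: "real \<times> real \<Rightarrow> real"
  assumes "continuous_on V K" "z0 \<in> V" "K z0 \<noteq> 0"
  shows "\<forall>\<^sub>F \<rho> in at_right 0. \<forall>z\<in>cball z0 \<rho>. \<bar>K z0\<bar> / 2 \<le> \<bar>K z\<bar>"
proof -
  have "continuous (at z0) K"
    using assms open_V continuous_on_eq_continuous_at by blast
  from continuous_near[OF this, of "\<bar>K z0\<bar> / 2"] assms(3)
  have "\<forall>\<^sub>F \<rho> in at_right 0. \<forall>z\<in>cball z0 \<rho>. norm (K z - K z0) \<le> \<bar>K z0\<bar> / 2" by simp
  then show ?thesis
  proof eventually_elim
    case (elim \<rho>)
    show ?case
    proof
      fix z assume "z \<in> cball z0 \<rho>"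
      with elim have "\<bar>K z - K z0\<bar> \<le> \<bar>K z0\<bar> / 2" by simp
      then show "\<bar>K z0\<bar> / 2 \<le> \<bar>K z\<bar>" by linarith
    qed
  qed
qed

text \<open>Pairing the Rankine-Hugoniot condition with the eigenvector of the other family eliminates the
  increment in the other coordinate and leaves the increment of the own coordinate times the
  difference of shock speed and characteristic speed.\<close>
lemma shock_speed_near:
  assumes z0: "z0 \<in> V" and "\<eta> > 0"
  shows "\<forall>\<^sub>F \<rho> in at_right 0. \<forall>zl\<in>cball z0 \<rho>. \<forall>zr\<in>cball z0 \<rho>. \<forall>\<sigma>.
    \<rho> / 8 \<le> \<bar>(zr - zl) \<bullet> dir i\<bar> \<longrightarrow> f (U zr) - f (U zl) = \<sigma> *\<^sub>R (U zr - U zl) \<longrightarrow>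
    \<bar>\<sigma> - lm i (mid zl zr)\<bar> \<le> \<eta> * \<rho>"
proof -
  obtain M where "M > 0" and M: "\<forall>\<^sub>F \<rho> in at_right 0. \<forall>z\<in>cball z0 \<rho>. \<forall>k. norm (Rv k z) \<le> M \<and> \<bar>lm k z\<bar> \<le> M"
    using fields_bounded[OF z0] by blast
  define w where "w = \<bar>wedge (Rv i z0) (Rv (opp i) z0)\<bar>"
  have "w > 0" using wedge_R_nonzero[OF U_in[OF z0]] by (simp add: w_def)
  have "64 * M * (1 + M) > 0" "\<eta> * w > 0" using \<open>\<eta> > 0\<close> \<open>M > 0\<close> \<open>w > 0\<close> by simp_all
  then obtain \<eta>' where \<eta>': "\<eta>' > 0" "\<eta>' \<le> 1" "\<eta>' * (64 * M * (1 + M)) \<le> \<eta> * w"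
    using small_factor by blast
  have W: "\<forall>\<^sub>F \<rho> in at_right 0. \<forall>z\<in>cball z0 \<rho>. w / 2 \<le> \<bar>wedge (Rv i z) (Rv (opp i) z)\<bar>"
    unfolding w_def by (rule eventually_bounded_below[OF wedge_Rv_continuous_on z0]) (rule wedge_R_nonzero[OF U_in[OF z0]])
  have "w / (64 * M) > 0" using \<open>w > 0\<close> \<open>M > 0\<close> by simp
  show ?thesis
    using W M jump_expansions[OF z0 \<eta>'(1), of i] eventually_at_right_less[of "0::real"] eventually_at_right_0_le[OF \<open>w / (64 * M) > 0\<close>]
  proof (eventually_elim, intro ballI allI impI)
    fix \<rho> zl zr \<sigma>
    assume W: "\<forall>z\<in>cball z0 \<rho>. w / 2 \<le> \<bar>wedge (Rv i z) (Rv (opp i) z)\<bar>"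
      and M: "\<forall>z\<in>cball z0 \<rho>. \<forall>k. norm (Rv k z) \<le> M \<and> \<bar>lm k z\<bar> \<le> M"
      and ex: "\<forall>zl\<in>cball z0 \<rho>. \<forall>zr\<in>cball z0 \<rho>.
        norm (U zr - U zl - (((zr - zl) \<bullet> dir i) *\<^sub>R Rv i (mid zl zr)
         + ((zr - zl) \<bullet> dir (opp i)) *\<^sub>R Rv (opp i) (mid zl zr))) \<le> \<eta>' * \<rho>\<^sup>2 \<and>
        norm (f (U zr) - f (U zl) - (((zr - zl) \<bullet> dir i) *\<^sub>R (lm i (mid zl zr) *\<^sub>R Rv i (mid zl zr))
         + ((zr - zl) \<bullet> dir (opp i)) *\<^sub>R (lm (opp i) (mid zl zr) *\<^sub>R Rv (opp i) (mid zl zr)))) \<le> \<eta>' * \<rho>\<^sup>2"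
      and \<rho>: "0 < \<rho>" "\<rho> \<le> w / (64 * M)"
      and z: "zl \<in> cball z0 \<rho>" "zr \<in> cball z0 \<rho>"
      and h: "\<rho> / 8 \<le> \<bar>(zr - zl) \<bullet> dir i\<bar>"
      and \<sigma>: "f (U zr) - f (U zl) = \<sigma> *\<^sub>R (U zr - U zl)"
    define m where "m = mid zl zr"
    define x where "x = (zr - zl) \<bullet> dir i"
    define y where "y = (zr - zl) \<bullet> dir (opp i)"
    define P where "P = Rv i m"
    define Q where "Q = Rv (opp i) m"
    define E where "E = U zr - U zl - (x *\<^sub>R P + y *\<^sub>R Q)"
    define E' where "E' = f (U zr) - f (U zl) - (x *\<^sub>R (lm i m *\<^sub>R P) + y *\<^sub>R (lm (opp i) m *\<^sub>R Q))"
    define d where "d = lm i m - \<sigma>"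
    have E: "norm E \<le> \<eta>' * \<rho>\<^sup>2" "norm E' \<le> \<eta>' * \<rho>\<^sup>2"
      using ex z unfolding E_def E'_def x_def y_def m_def P_def Q_def by blast+
    have "m \<in> cball z0 \<rho>" unfolding m_def using midpoint_in_cball[OF z] .
    then have Mm: "norm Q \<le> M" "\<bar>lm i m\<bar> \<le> M" and Wm: "w / 2 \<le> \<bar>wedge P Q\<bar>"
      using M W unfolding P_def Q_def by blast+
    have "wedge (f (U zr) - f (U zl)) Q = \<sigma> * wedge (U zr - U zl) Q" by (simp add: \<sigma>)
    moreover have "U zr - U zl = x *\<^sub>R P + y *\<^sub>R Q + E"
      "f (U zr) - f (U zl) = x *\<^sub>R (lm i m *\<^sub>R P) + y *\<^sub>R (lm (opp i) m *\<^sub>R Q) + E'"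
      by (simp_all add: E_def E'_def)
    ultimately have "x * (lm i m * wedge P Q) + wedge E' Q = \<sigma> * (x * wedge P Q + wedge E Q)" by simp
    then have eq: "d * (x * wedge P Q) = - wedge (E' - lm i m *\<^sub>R E) Q - d * wedge E Q"
      by (simp add: d_def algebra_simps)
    have E2: "norm (E' - lm i m *\<^sub>R E) \<le> (1 + M) * (\<eta>' * \<rho>\<^sup>2)"
    proof -
      have "norm (lm i m *\<^sub>R E) \<le> M * (\<eta>' * \<rho>\<^sup>2)"
        unfolding norm_scaleR by (intro mult_mono Mm E) (use \<open>M > 0\<close> in auto)
      then show ?thesis
        using norm_triangle_ineq4[of E' "lm i m *\<^sub>R E"] E(2) by (simp add: algebra_simps)
    qed
    have w1: "\<bar>wedge (E' - lm i m *\<^sub>R E) Q\<bar> \<le> 2 * ((1 + M) * (\<eta>' * \<rho>\<^sup>2)) * M"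
      by (intro order_trans[OF abs_wedge_le] mult_mono order_refl E2 Mm) (use \<open>M > 0\<close> \<eta>' in auto)
    have "\<bar>wedge E Q\<bar> \<le> 2 * (\<eta>' * \<rho>\<^sup>2) * M"
      by (intro order_trans[OF abs_wedge_le] mult_mono order_refl E Mm) (use \<open>M > 0\<close> \<eta>' in auto)
    also have "\<dots> \<le> 2 * (1 * \<rho>\<^sup>2) * M"
      by (intro mult_right_mono mult_left_mono) (use \<open>M > 0\<close> \<eta>' in auto)
    also have "\<dots> = 2 * M * \<rho> * \<rho>" by (simp add: power2_eq_square)
    also have "\<dots> \<le> w / 32 * \<rho>"
      by (rule mult_right_mono) (use \<rho> \<open>M > 0\<close> in \<open>auto simp: field_simps\<close>)
    finally have w2: "\<bar>wedge E Q\<bar> \<le> w / 32 * \<rho>" .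
    have "\<rho> / 8 * (w / 2) \<le> \<bar>x * wedge P Q\<bar>"
      unfolding abs_mult by (intro mult_mono Wm) (use h \<rho> \<open>w > 0\<close> in \<open>auto simp: x_def\<close>)
    then have "\<bar>d\<bar> * (w / 16 * \<rho>) \<le> \<bar>d * (x * wedge P Q)\<bar>"
      unfolding abs_mult[of d] by (intro mult_left_mono) (auto simp: mult.commute)
    also have "\<dots> \<le> \<bar>wedge (E' - lm i m *\<^sub>R E) Q\<bar> + \<bar>d\<bar> * \<bar>wedge E Q\<bar>"
      unfolding eq abs_mult[symmetric] by linarith
    also have "\<dots> \<le> 2 * ((1 + M) * (\<eta>' * \<rho>\<^sup>2)) * M + \<bar>d\<bar> * (w / 32 * \<rho>)"
      by (intro add_mono w1 mult_left_mono w2) auto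
    finally have "\<bar>d\<bar> * (w * \<rho>) \<le> \<eta>' * (64 * M * (1 + M)) * \<rho>\<^sup>2" by (simp add: algebra_simps)
    also have "\<dots> \<le> \<eta> * w * \<rho>\<^sup>2" by (rule mult_right_mono[OF \<eta>'(3)]) simp
    finally have "\<bar>d\<bar> * (w * \<rho>) \<le> (\<eta> * \<rho>) * (w * \<rho>)" by (simp add: power2_eq_square algebra_simps)
    then have "\<bar>d\<bar> \<le> \<eta> * \<rho>" using \<rho>(1) \<open>w > 0\<close> by (simp add: mult_le_cancel_right)
    then show "\<bar>\<sigma> - lm i (mid zl zr)\<bar> \<le> \<eta> * \<rho>" by (simp add: d_def m_def abs_minus_commute)
  qed
qed

text \<open>By genuine nonlinearity the characteristic speed differs between an end state and the midpoint by
  an amount of order \<open>\<rho>\<close>. This exceeds the error \<open>o(\<rho>)\<close> with which the shock speed agrees with the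
  characteristic speed at the midpoint, and so gives the Lax inequalities.\<close>
lemma characteristic_gap:
  assumes z0: "z0 \<in> V" and gnl: "genuinely_nonlinear i"
  obtains g where "g > 0" "\<forall>\<^sub>F \<rho> in at_right 0. \<forall>zl\<in>cball z0 \<rho>. \<forall>zr\<in>cball z0 \<rho>.
     \<rho> / 8 \<le> - ((zr - zl) \<bullet> dir i) \<longrightarrow> \<bar>(zr - zl) \<bullet> dir (opp i)\<bar> \<le> \<rho>\<^sup>2 \<longrightarrow>
     lm i (mid zl zr) + g * \<rho> \<le> lm i zl \<and> lm i zr + g * \<rho> \<le> lm i (mid zl zr)"
proof -
  define a where "a = directional_derivative (R i) (lam i) (U z0)"
  define b where "b = directional_derivative (R (opp i)) (lam i) (U z0)"
  have "a > 0"
    using gnl oriented[OF U_in[OF z0], of i] U_in[OF z0] grad_inner[OF lam_differentiable[OF U_in[OF z0]]]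
    unfolding a_def genuinely_nonlinear_def directional_derivative_def by (metis less_eq_real_def)
  have der: "(lm i has_derivative (\<lambda>h. (h \<bullet> dir i) *\<^sub>R a + (h \<bullet> dir (opp i)) *\<^sub>R b)) (at z0)"
    using compose_U_has_partials[OF z0 lam_differentiable[OF U_in[OF z0]], of i]
    unfolding has_partials_family[of _ _ _ i] a_def b_def .
  have "a / 64 > 0" using \<open>a > 0\<close> by simp
  have "\<bar>b\<bar> + 1 > 0" by simp
  from small_factor[OF this \<open>a / 64 > 0\<close>]
  obtain d where d: "d > 0" "d \<le> 1" "d * (\<bar>b\<bar> + 1) \<le> a / 64" by blast
  have "\<forall>\<^sub>F \<rho> in at_right 0. \<forall>zl\<in>cball z0 \<rho>. \<forall>zr\<in>cball z0 \<rho>.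
     \<rho> / 8 \<le> - ((zr - zl) \<bullet> dir i) \<longrightarrow> \<bar>(zr - zl) \<bullet> dir (opp i)\<bar> \<le> \<rho>\<^sup>2 \<longrightarrow>
     lm i (mid zl zr) + a / 64 * \<rho> \<le> lm i zl \<and> lm i zr + a / 64 * \<rho> \<le> lm i (mid zl zr)"
    using derivative_near[OF der \<open>a / 64 > 0\<close>] eventually_at_right_less[of "0::real"] eventually_at_right_0_le[OF d(1)]
  proof (eventually_elim, intro ballI impI)
    fix \<rho> zl zr
    assume near: "\<forall>z\<in>cball z0 \<rho>. \<forall>w\<in>cball z0 \<rho>.
        norm (lm i z - lm i w - (((z - w) \<bullet> dir i) *\<^sub>R a + ((z - w) \<bullet> dir (opp i)) *\<^sub>R b)) \<le> a / 64 * \<rho>"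
      and \<rho>: "0 < \<rho>" "\<rho> \<le> d"
      and z: "zl \<in> cball z0 \<rho>" "zr \<in> cball z0 \<rho>"
      and h: "\<rho> / 8 \<le> - ((zr - zl) \<bullet> dir i)" "\<bar>(zr - zl) \<bullet> dir (opp i)\<bar> \<le> \<rho>\<^sup>2"
    define x where "x = (zr - zl) \<bullet> dir i"
    define y where "y = (zr - zl) \<bullet> dir (opp i)"
    define m where "m = mid zl zr"
    have m: "m \<in> cball z0 \<rho>" unfolding m_def using midpoint_in_cball[OF z] .
    have half: "zl - m = (-1/2) *\<^sub>R (zr - zl)" "m - zr = (-1/2) *\<^sub>R (zr - zl)"
      by (simp_all add: m_def prod_eq_iff field_simps)
    have n1: "\<bar>lm i zl - lm i m - (- (x * a) / 2 - y * b / 2)\<bar> \<le> a / 64 * \<rho>"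
      using near[rule_format, OF z(1) m] unfolding half x_def y_def by simp
    have n2: "\<bar>lm i m - lm i zr - (- (x * a) / 2 - y * b / 2)\<bar> \<le> a / 64 * \<rho>"
      using near[rule_format, OF m z(2)] unfolding half x_def y_def by simp
    have "\<rho> / 8 * a \<le> - x * a" by (rule mult_right_mono) (use h \<open>a > 0\<close> in \<open>auto simp: x_def\<close>)
    moreover have "\<bar>y * b\<bar> \<le> a / 64 * \<rho>"
    proof -
      have "\<bar>y * b\<bar> \<le> \<rho>\<^sup>2 * (\<bar>b\<bar> + 1)"
        unfolding abs_mult by (intro mult_mono) (use h in \<open>auto simp: y_def\<close>)
      also have "\<dots> = \<rho> * (\<rho> * (\<bar>b\<bar> + 1))" by (simp add: power2_eq_square)
      also have "\<dots> \<le> \<rho> * (d * (\<bar>b\<bar> + 1))"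
        by (intro mult_left_mono mult_right_mono) (use \<rho> in auto)
      also have "\<dots> \<le> \<rho> * (a / 64)" by (intro mult_left_mono d) (use \<rho> in auto)
      finally show ?thesis by (simp add: mult.commute)
    qed
    moreover have combine: "q + K / 64 \<le> p"
      if "K / 8 \<le> - X" "\<bar>Y\<bar> \<le> K / 64" "\<bar>p - q - (- X / 2 - Y / 2)\<bar> \<le> K / 64" for p q X Y K :: real
      using that by linarith
    ultimately have "lm i m + a / 64 * \<rho> \<le> lm i zl" "lm i zr + a / 64 * \<rho> \<le> lm i m"
      using n1 n2 combine[of "a * \<rho>" "x * a" "y * b"] by (simp_all add: mult.commute)
    then show "lm i (mid zl zr) + a / 64 * \<rho> \<le> lm i zl \<and> lm i zr + a / 64 * \<rho> \<le> lm i (mid zl zr)"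
      unfolding m_def by blast
  qed
  with \<open>a / 64 > 0\<close> show ?thesis by (rule that)
qed

definition separates :: "real \<Rightarrow> real \<times> real \<Rightarrow> bool" where
  "separates c z \<longleftrightarrow> lm Slow z < c \<and> c < lm Fast z"

lemma separates_near:
  assumes "z0 \<in> V" "separates c z0"
  shows "\<forall>\<^sub>F \<rho> in at_right 0. \<forall>z\<in>cball z0 \<rho>. separates c z"
proof -
  define \<eta> where "\<eta> = min (c - lm Slow z0) (lm Fast z0 - c) / 2"
  have "\<eta> > 0" using assms(2) by (simp add: \<eta>_def separates_def)
  have "\<eta> < c - lm Slow z0" "\<eta> < lm Fast z0 - c" using assms(2) by (auto simp: \<eta>_def separates_def)
  note gaps = this
  from continuous_near[OF lm_continuous[OF assms(1), of Slow] \<open>\<eta> > 0\<close>]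
    continuous_near[OF lm_continuous[OF assms(1), of Fast] \<open>\<eta> > 0\<close>]
  show ?thesis
  proof eventually_elim
    case (elim \<rho>)
    show ?case
    proof
      fix z assume "z \<in> cball z0 \<rho>"
      with elim have "\<bar>lm Slow z - lm Slow z0\<bar> \<le> \<eta>" "\<bar>lm Fast z - lm Fast z0\<bar> \<le> \<eta>" by simp_all
      with gaps show "separates c z" unfolding separates_def by linarith
    qed
  qed
qed

text \<open>Pairs of states whose increment in the coordinate of the family \<open>i\<close> has the sign \<open>\<tau>\<close> and is
  comparable to the radius \<open>\<rho>\<close>.\<close>
definition wave_domain :: "wave_family \<Rightarrow> real \<Rightarrow> real \<times> real \<Rightarrow> real \<Rightarrow> ((real \<times> real) \<times> (real \<times> real)) set" where
  "wave_domain i \<tau> z0 \<rho> = {(zl, zr). zl \<in> cball z0 \<rho> \<and> zr \<in> cball z0 \<rho> \<and> \<rho> / 8 \<le> \<tau> * ((zr - zl) \<bullet> dir i)}"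

text \<open>Solving the determinant for the increment in the other coordinate: that increment equals
  \<open>wave_defect i\<close> if and only if the jumps of flux and state are collinear, provided the
  increment in the own coordinate is nonzero. In this form the
  condition prescribes the other coordinate by a small continuous function of the two states.\<close>
definition wave_defect :: "wave_family \<Rightarrow> (real \<times> real) \<times> (real \<times> real) \<Rightarrow> real" where
  "wave_defect i p = (snd p - fst p) \<bullet> dir (opp i)
     - wedge (f (U (snd p)) - f (U (fst p))) (U (snd p) - U (fst p))
       / (((snd p - fst p) \<bullet> dir i) * separation i (mid (fst p) (snd p)))"

lemma wave_defect_continuous_on:
  assumes "cball z0 \<rho> \<subseteq> V" "0 < \<rho>"
  shows "continuous_on (wave_domain i \<tau> z0 \<rho>) (wave_defect i)"
proof -
  let ?D = "wave_domain i \<tau> z0 \<rho>"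
  have c: "continuous_on ?D (\<lambda>p. G (U (fst p)))" "continuous_on ?D (\<lambda>p. G (U (snd p)))"
    if "continuous_on V (\<lambda>z. G (U z))" for G :: "real^2 \<Rightarrow> real^2"
  proof -
    have "fst ` ?D \<subseteq> V" "snd ` ?D \<subseteq> V" using assms(1) by (auto simp: wave_domain_def)
    then show "continuous_on ?D (\<lambda>p. G (U (fst p)))" "continuous_on ?D (\<lambda>p. G (U (snd p)))"
      using continuous_on_compose2[OF that] continuous_on_fst[OF continuous_on_id]
        continuous_on_snd[OF continuous_on_id] by blast+
  qed
  have U: "continuous_on V (\<lambda>z. U z)"
    using U_differentiable by (intro continuous_at_imp_continuous_on ballI differentiable_imp_continuous_within) blast
  have F: "continuous_on V (\<lambda>z. f (U z))"
    using flux_differentiable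
    by (intro compose_U_continuous_on continuous_at_imp_continuous_on ballI differentiable_imp_continuous_within order_refl) blast
  have mV: "mid (fst p) (snd p) \<in> V" if "p \<in> ?D" for p
    using that assms(1) midpoint_in_cball[of "fst p" z0 \<rho> "snd p"] by (auto simp: wave_domain_def)
  have "continuous_on ?D (\<lambda>p. separation i (mid (fst p) (snd p)))"
    by (rule continuous_on_compose2[OF separation_continuous_on _ image_subsetI[OF mV]]) (intro continuous_intros)
  moreover have "((snd p - fst p) \<bullet> dir i) * separation i (mid (fst p) (snd p)) \<noteq> 0" if "p \<in> ?D" for p
    using that separation_nonzero[OF mV[OF that]] assms(2) by (auto simp: wave_domain_def)
  ultimately show ?thesis
    unfolding wave_defect_def[abs_def] wedge_def
    by (intro continuous_intros c[OF F] c[OF U, unfolded id_def] c[of "\<lambda>x. x", OF U]) auto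
qed

lemma wave_defect_small:
  assumes z0: "z0 \<in> V" and "\<eta> > 0" and "\<tau> = 1 \<or> \<tau> = -1"
  shows "\<forall>\<^sub>F \<rho> in at_right 0. \<forall>p\<in>wave_domain i \<tau> z0 \<rho>. \<bar>wave_defect i p\<bar> \<le> \<eta> * \<rho>\<^sup>2"
proof -
  define k where "k = \<bar>separation i z0\<bar>"
  have "k > 0" using separation_nonzero[OF z0] by (simp add: k_def)
  define \<eta>' where "\<eta>' = \<eta> * k / 16"
  have "\<eta>' > 0" using \<open>\<eta> > 0\<close> \<open>k > 0\<close> by (simp add: \<eta>'_def)
  show ?thesis
    using eventually_bounded_below[OF separation_continuous_on z0 separation_nonzero[OF z0], of i]
      hugoniot_defect[OF z0 \<open>\<eta>' > 0\<close>, of i] eventually_at_right_less[of "0::real"]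
  proof (eventually_elim, intro ballI)
    fix \<rho> p
    assume K: "\<forall>z\<in>cball z0 \<rho>. \<bar>separation i z0\<bar> / 2 \<le> \<bar>separation i z\<bar>"
      and H: "\<forall>zl\<in>cball z0 \<rho>. \<forall>zr\<in>cball z0 \<rho>.
        \<bar>wedge (f (U zr) - f (U zl)) (U zr - U zl)
       - ((zr - zl) \<bullet> dir i) * ((zr - zl) \<bullet> dir (opp i)) * separation i (mid zl zr)\<bar> \<le> \<eta>' * \<rho> ^ 3"
      and "0 < \<rho>" and "p \<in> wave_domain i \<tau> z0 \<rho>"
    obtain zl zr where p: "p = (zl, zr)" by (cases p)
    with \<open>p \<in> _\<close> have z: "zl \<in> cball z0 \<rho>" "zr \<in> cball z0 \<rho>" "\<rho> / 8 \<le> \<bar>(zr - zl) \<bullet> dir i\<bar>"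
      using assms(3) by (auto simp: wave_domain_def)
    define x where "x = (zr - zl) \<bullet> dir i"
    define y where "y = (zr - zl) \<bullet> dir (opp i)"
    define s where "s = separation i (mid zl zr)"
    define W where "W = wedge (f (U zr) - f (U zl)) (U zr - U zl)"
    have s: "k / 2 \<le> \<bar>s\<bar>" using K midpoint_in_cball[OF z(1,2)] by (simp add: k_def s_def)
    have lower: "\<rho> / 8 * (k / 2) \<le> \<bar>x * s\<bar>"
      unfolding abs_mult by (intro mult_mono s) (use z(3) \<open>k > 0\<close> in \<open>auto simp: x_def\<close>)
    moreover have "0 < \<rho> / 8 * (k / 2)" using \<open>0 < \<rho>\<close> \<open>k > 0\<close> by simp
    ultimately have "x * s \<noteq> 0" by linarith
    have "wave_defect i p = - (W - x * y * s) / (x * s)"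
      unfolding wave_defect_def p x_def[symmetric] y_def[symmetric] s_def[symmetric] W_def[symmetric] fst_conv snd_conv
      using \<open>x * s \<noteq> 0\<close> by (simp add: field_simps)
    then have "\<bar>wave_defect i p\<bar> * \<bar>x * s\<bar> = \<bar>W - x * y * s\<bar>"
      using \<open>x * s \<noteq> 0\<close> by (simp add: abs_divide abs_minus_commute)
    also have "\<dots> \<le> \<eta>' * \<rho> ^ 3" using H z(1,2) unfolding W_def x_def y_def s_def by blast
    finally have "\<bar>wave_defect i p\<bar> * (\<rho> / 8 * (k / 2)) \<le> \<eta>' * \<rho> ^ 3"
      using mult_left_mono[OF lower abs_ge_zero[of "wave_defect i p"]] by linarith
    also have "\<eta>' * \<rho> ^ 3 = \<eta> * \<rho>\<^sup>2 * (\<rho> / 8 * (k / 2))"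
      by (simp add: \<eta>'_def power3_eq_cube power2_eq_square)
    finally show "\<bar>wave_defect i p\<bar> \<le> \<eta> * \<rho>\<^sup>2"
      by (rule mult_right_le_imp_le) (use \<open>0 < \<rho>\<close> \<open>k > 0\<close> in simp)
  qed
qed

lemma wave_defect_eq_imp_hugoniot:
  assumes V: "zl \<in> V" "zr \<in> V" "mid zl zr \<in> V" and x: "(zr - zl) \<bullet> dir i \<noteq> 0"
    and eq: "(zr - zl) \<bullet> dir (opp i) = wave_defect i (zl, zr)"
  shows "\<exists>\<sigma>. f (U zr) - f (U zl) = \<sigma> *\<^sub>R (U zr - U zl)"
proof (rule wedge_zero_imp_multiple)
  show "wedge (f (U zr) - f (U zl)) (U zr - U zl) = 0"
    using eq x separation_nonzero[OF V(3), of i] by (simp add: wave_defect_def)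
  show "U zr - U zl \<noteq> 0" using inj_U[OF V(1,2)] x by auto
qed

text \<open>On the side of decreasing characteristic speed, collinear jumps are an entropic shock: its speed is
  close to the characteristic speed at the midpoint, hence strictly between the characteristic
  speeds of the end states.\<close>
lemma shock_branch:
  assumes z0: "z0 \<in> V" and c: "separates c z0" and gnl: "genuinely_nonlinear i"
  shows "\<forall>\<^sub>F \<rho> in at_right 0. \<forall>(zl, zr)\<in>wave_domain i (-1) z0 \<rho>.
    (zr - zl) \<bullet> dir (opp i) = wave_defect i (zl, zr) \<longrightarrow> localized_wave c i zl zr"
proof -
  obtain g where "g > 0" and gap: "\<forall>\<^sub>F \<rho> in at_right 0. \<forall>zl\<in>cball z0 \<rho>. \<forall>zr\<in>cball z0 \<rho>.
     \<rho> / 8 \<le> - ((zr - zl) \<bullet> dir i) \<longrightarrow> \<bar>(zr - zl) \<bullet> dir (opp i)\<bar> \<le> \<rho>\<^sup>2 \<longrightarrow>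
     lm i (mid zl zr) + g * \<rho> \<le> lm i zl \<and> lm i zr + g * \<rho> \<le> lm i (mid zl zr)"
    using characteristic_gap[OF z0 gnl] by blast
  have "g / 2 > 0" using \<open>g > 0\<close> by simp
  have small: "\<forall>\<^sub>F \<rho> in at_right 0. \<forall>p\<in>wave_domain i (-1) z0 \<rho>. \<bar>wave_defect i p\<bar> \<le> 1 * \<rho>\<^sup>2"
    using wave_defect_small[OF z0 zero_less_one] by blast
  show ?thesis
    using gap small shock_speed_near[OF z0 \<open>g / 2 > 0\<close>, of i] separates_near[OF z0 c]
      eventually_cball_subset[OF open_V z0] eventually_at_right_less[of "0::real"]
  proof (eventually_elim, clarify)
    fix \<rho> and zl zr :: "real \<times> real"
    assume gap: "\<forall>zl\<in>cball z0 \<rho>. \<forall>zr\<in>cball z0 \<rho>.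
       \<rho> / 8 \<le> - ((zr - zl) \<bullet> dir i) \<longrightarrow> \<bar>(zr - zl) \<bullet> dir (opp i)\<bar> \<le> \<rho>\<^sup>2 \<longrightarrow>
       lm i (mid zl zr) + g * \<rho> \<le> lm i zl \<and> lm i zr + g * \<rho> \<le> lm i (mid zl zr)"
      and small: "\<forall>p\<in>wave_domain i (-1) z0 \<rho>. \<bar>wave_defect i p\<bar> \<le> 1 * \<rho>\<^sup>2"
      and speed: "\<forall>zl\<in>cball z0 \<rho>. \<forall>zr\<in>cball z0 \<rho>. \<forall>\<sigma>.
        \<rho> / 8 \<le> \<bar>(zr - zl) \<bullet> dir i\<bar> \<longrightarrow> f (U zr) - f (U zl) = \<sigma> *\<^sub>R (U zr - U zl) \<longrightarrow>
        \<bar>\<sigma> - lm i (mid zl zr)\<bar> \<le> g / 2 * \<rho>"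
      and sep: "\<forall>z\<in>cball z0 \<rho>. separates c z"
      and ball: "cball z0 \<rho> \<subseteq> V" and "0 < \<rho>"
      and D: "(zl, zr) \<in> wave_domain i (-1) z0 \<rho>"
      and eq: "(zr - zl) \<bullet> dir (opp i) = wave_defect i (zl, zr)"
    have z: "zl \<in> cball z0 \<rho>" "zr \<in> cball z0 \<rho>" and h: "\<rho> / 8 \<le> - ((zr - zl) \<bullet> dir i)"
      using D by (auto simp: wave_domain_def)
    have V: "zl \<in> V" "zr \<in> V" "mid zl zr \<in> V"
      using z midpoint_in_cball[OF z] ball by auto
    have "(zr - zl) \<bullet> dir i \<noteq> 0" using h \<open>0 < \<rho>\<close> by auto
    from wave_defect_eq_imp_hugoniot[OF V this eq]
    obtain \<sigma> where \<sigma>: "f (U zr) - f (U zl) = \<sigma> *\<^sub>R (U zr - U zl)" by blast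
    have "\<bar>\<sigma> - lm i (mid zl zr)\<bar> \<le> g / 2 * \<rho>"
      using speed z \<sigma> h by fastforce
    moreover have "lm i (mid zl zr) + g * \<rho> \<le> lm i zl" "lm i zr + g * \<rho> \<le> lm i (mid zl zr)"
      using gap z h small D eq by auto
    moreover have "g / 2 * \<rho> < g * \<rho>" using \<open>g > 0\<close> \<open>0 < \<rho>\<close> by simp
    ultimately have lax: "lm i zr < \<sigma>" "\<sigma> < lm i zl" by linarith+
    have "separates c zl" "separates c zr" using sep z by blast+
    then have "i = Slow \<Longrightarrow> \<sigma> < c" "i = Fast \<Longrightarrow> c < \<sigma>"
      and "i = Slow \<longrightarrow> \<sigma> < lm Fast zr" "i = Fast \<longrightarrow> lm Slow zl < \<sigma>"
      using lax unfolding separates_def by auto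
    moreover have "U zl \<noteq> U zr" using inj_U[OF V(1,2)] \<open>(zr - zl) \<bullet> dir i \<noteq> 0\<close> by auto
    ultimately have "shock i (jump \<sigma> (U zl) (U zr)) (U zl) (U zr)"
      unfolding shock_def rankine_hugoniot_def lax_admissible_def
      using gnl V \<sigma> lax by auto
    then show "localized_wave c i zl zr"
      using localized_jump[of i \<sigma> zl zr c] \<open>i = Slow \<Longrightarrow> \<sigma> < c\<close> \<open>i = Fast \<Longrightarrow> c < \<sigma>\<close>
      unfolding elementary_wave_def by blast
  qed
qed

text \<open>A uniform description of the weak waves of either family and either sign: the increment in the
  other coordinate is a prescribed continuous function \<open>N\<close> of size \<open>o(\<rho>\<^sup>2)\<close>. For contacts and
  rarefactions, which stay on the coordinate line, this function is \<open>0\<close>.\<close>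
lemma wave_branch:
  assumes z0: "z0 \<in> V" and c: "separates c z0" and \<tau>: "\<tau> = 1 \<or> \<tau> = -1" and "\<eta> > 0"
  shows "\<forall>\<^sub>F \<rho> in at_right 0. \<exists>N. continuous_on (wave_domain i \<tau> z0 \<rho>) N \<and>
    (\<forall>(zl, zr)\<in>wave_domain i \<tau> z0 \<rho>. \<bar>N (zl, zr)\<bar> \<le> \<eta> * \<rho>\<^sup>2 \<and>
       ((zr - zl) \<bullet> dir (opp i) = N (zl, zr) \<longrightarrow> localized_wave c i zl zr))"
proof (cases "genuinely_nonlinear i \<and> \<tau> = -1")
  case True
  then have "genuinely_nonlinear i" "\<tau> = -1" by auto
  then show ?thesis
    using eventually_conj[OF eventually_conj[OF shock_branch[OF z0 c \<open>genuinely_nonlinear i\<close>]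
      wave_defect_small[OF z0 \<open>\<eta> > 0\<close> \<tau>, of i]]
      eventually_conj[OF eventually_cball_subset[OF open_V z0] eventually_at_right_less[of "0::real"]]]
    by (elim eventually_mono) (use wave_defect_continuous_on in blast)
next
  case False
  show ?thesis
    using separates_near[OF z0 c] eventually_cball_subset[OF open_V z0] eventually_at_right_less[of "0::real"]
  proof (eventually_elim, intro exI[of _ "\<lambda>_. 0"] conjI, simp, clarify)
    fix \<rho> and zl zr :: "real \<times> real"
    assume sep: "\<forall>z\<in>cball z0 \<rho>. separates c z" and ball: "cball z0 \<rho> \<subseteq> V" and "0 < \<rho>"
      and D: "(zl, zr) \<in> wave_domain i \<tau> z0 \<rho>"
    define h where "h = (zr - zl) \<bullet> dir i"
    have z: "zl \<in> cball z0 \<rho>" "zr \<in> cball z0 \<rho>" and h: "\<rho> / 8 \<le> \<tau> * h"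
      using D by (auto simp: wave_domain_def h_def)
    have "localized_wave c i zl zr" if y: "(zr - zl) \<bullet> dir (opp i) = 0"
    proof -
      have "zr - zl = h *\<^sub>R dir i"
        using dir_decomposition[of "zr - zl" i] y by (simp add: h_def)
      then have zr: "zr = zl + h *\<^sub>R dir i" by (simp add: algebra_simps)
      have seg: "zl + t *\<^sub>R (h *\<^sub>R dir i) \<in> V" if "t \<in> {0..1}" for t
      proof -
        have "(1 - t) *\<^sub>R zl + t *\<^sub>R zr \<in> cball z0 \<rho>"
          by (rule convexD[OF convex_cball(1) z]) (use that in auto)
        moreover have "(1 - t) *\<^sub>R zl + t *\<^sub>R zr = zl + t *\<^sub>R (h *\<^sub>R dir i)"
          unfolding zr by (simp add: algebra_simps)
        ultimately show ?thesis using ball by auto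
      qed
      have sz: "separates c zl" "separates c zr" using sep z by blast+
      show ?thesis
      proof (cases "genuinely_nonlinear i")
        case True
        with False \<tau> have "\<tau> = 1" by auto
        then have "h > 0" using h \<open>0 < \<rho>\<close> by auto
        show ?thesis
          unfolding zr by (rule localized_rarefaction[OF True \<open>h > 0\<close> seg])
            (use sz zr in \<open>auto simp: separates_def\<close>)
      next
        case False
        with field_type[of i] have ld: "linearly_degenerate i" by blast
        have "h \<noteq> 0" using h \<open>0 < \<rho>\<close> by auto
        show ?thesis
          unfolding zr by (rule localized_contact[OF ld \<open>h \<noteq> 0\<close> seg])
            (use sz in \<open>auto simp: separates_def\<close>)
      qed
    qed
    then show "\<bar>0\<bar> \<le> \<eta> * \<rho>\<^sup>2 \<and> ((zr - zl) \<bullet> dir (opp i) = 0 \<longrightarrow> localized_wave c i zl zr)"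
      using \<open>\<eta> > 0\<close> by simp
  qed
qed

end

section \<open>Second-order analysis of a scalar field\<close>

text \<open>Along the segment the increment in the direction \<open>i\<close> is of order \<open>\<rho>\<close> and that in the other
  direction of order \<open>\<rho>\<^sup>2\<close>, so the partial derivative in direction \<open>i\<close> decides the sign.\<close>
lemma segment_monotone:
  fixes \<Phi> :: "real \<times> real \<Rightarrow> real"
  assumes "open S" "z0 \<in> S"
    and \<Phi>: "\<forall>z\<in>S. has_partials \<Phi> (\<lambda>i. q i z) z"
    and q: "\<forall>i. continuous (at z0) (q i)"
    and \<tau>: "\<tau> = 1 \<or> \<tau> = -1" "\<tau> * q i z0 > 0"
  shows "\<forall>\<^sub>F \<rho> in at_right 0. \<forall>zl\<in>cball z0 \<rho>. \<forall>zr\<in>cball z0 \<rho>.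
     \<rho> / 8 \<le> \<tau> * ((zr - zl) \<bullet> dir i) \<longrightarrow> \<bar>(zr - zl) \<bullet> dir (opp i)\<bar> \<le> \<rho>\<^sup>2 \<longrightarrow>
     mono_on {0..1} (\<lambda>t. \<Phi> (zl + t *\<^sub>R (zr - zl)))"
proof -
  define k where "k = \<tau> * q i z0 / 2"
  define M where "M = \<bar>q (opp i) z0\<bar> + 1"
  have "k > 0" "M > 0" using \<tau>(2) by (simp_all add: k_def M_def)
  have qM: "\<forall>\<^sub>F \<rho> in at_right 0. \<forall>z\<in>cball z0 \<rho>. norm (q (opp i) z) \<le> M"
    using q by (intro eventually_bounded) (auto simp: M_def)
  have "8 * M > 0" "k > 0" using \<open>M > 0\<close> \<open>k > 0\<close> by auto
  then obtain d where d: "d > 0" "d * (8 * M) \<le> k" using small_factor by blast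
  show ?thesis
    using continuous_near[OF q[rule_format, of i] \<open>k > 0\<close>] qM eventually_cball_subset[OF assms(1,2)]
      eventually_at_right_less[of "0::real"] eventually_at_right_0_le[OF d(1)]
  proof (eventually_elim, intro ballI impI)
    fix \<rho> zl zr
    assume near: "\<forall>z\<in>cball z0 \<rho>. norm (q i z - q i z0) \<le> k"
      and qM: "\<forall>z\<in>cball z0 \<rho>. norm (q (opp i) z) \<le> M"
      and ball: "cball z0 \<rho> \<subseteq> S" and \<rho>: "0 < \<rho>" "\<rho> \<le> d"
      and z: "zl \<in> cball z0 \<rho>" "zr \<in> cball z0 \<rho>"
      and h: "\<rho> / 8 \<le> \<tau> * ((zr - zl) \<bullet> dir i)" "\<bar>(zr - zl) \<bullet> dir (opp i)\<bar> \<le> \<rho>\<^sup>2"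
    define x where "x = (zr - zl) \<bullet> dir i"
    define y where "y = (zr - zl) \<bullet> dir (opp i)"
    have der: "\<exists>D. ((\<lambda>t. \<Phi> (zl + t *\<^sub>R (zr - zl))) has_real_derivative D) (at t) \<and> 0 \<le> D"
      if "0 \<le> t" "t \<le> 1" for t
    proof -
      define z where "z = zl + t *\<^sub>R (zr - zl)"
      have "(1 - t) *\<^sub>R zl + t *\<^sub>R zr \<in> cball z0 \<rho>"
        by (rule convexD[OF convex_cball(1) z]) (use that in auto)
      then have zb: "z \<in> cball z0 \<rho>" by (simp add: z_def algebra_simps)
      have "((\<lambda>t. \<Phi> (zl + t *\<^sub>R (zr - zl))) has_real_derivative x * q i z + y * q (opp i) z) (at t)"
        using has_partials_along[of \<Phi> "\<lambda>i. q i z" zl t "zr - zl" i UNIV] \<Phi> zb ball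
        by (auto simp: has_real_derivative_iff_has_vector_derivative x_def y_def z_def)
      moreover have "0 \<le> x * q i z + y * q (opp i) z"
      proof -
        have "\<bar>q i z - q i z0\<bar> \<le> k" using near zb by auto
        moreover have "\<tau> * q i z0 - \<tau> * q i z \<le> \<bar>q i z - q i z0\<bar>"
          using \<tau>(1) by (auto simp: abs_if)
        ultimately have "k \<le> \<tau> * q i z" unfolding k_def by linarith
        then have "\<rho> / 8 * k \<le> (\<tau> * x) * (\<tau> * q i z)"
          by (intro mult_mono) (use h \<open>k > 0\<close> \<rho> in \<open>auto simp: x_def\<close>)
        also have "\<dots> = x * q i z" using \<tau>(1) by auto
        finally have 1: "\<rho> / 8 * k \<le> x * q i z" .
        have "\<bar>y * q (opp i) z\<bar> \<le> \<rho>\<^sup>2 * M"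
          unfolding abs_mult by (intro mult_mono) (use h qM zb in \<open>auto simp: y_def\<close>)
        also have "\<dots> = \<rho> / 8 * (\<rho> * (8 * M))" by (simp add: power2_eq_square)
        also have "\<dots> \<le> \<rho> / 8 * (d * (8 * M))"
          by (intro mult_left_mono mult_right_mono) (use \<rho> \<open>M > 0\<close> in auto)
        also have "\<dots> \<le> \<rho> / 8 * k" by (intro mult_left_mono d) (use \<rho> in auto)
        finally show ?thesis using 1 by linarith
      qed
      ultimately show ?thesis by blast
    qed
    show "mono_on {0..1} (\<lambda>t. \<Phi> (zl + t *\<^sub>R (zr - zl)))"
    proof (rule mono_onI)
      fix t u :: real assume tu: "t \<in> {0..1}" "u \<in> {0..1}" "t \<le> u"
      show "\<Phi> (zl + t *\<^sub>R (zr - zl)) \<le> \<Phi> (zl + u *\<^sub>R (zr - zl))"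
        by (rule DERIV_nonneg_imp_nondecreasing[OF tu(3)]) (use der tu in auto)
    qed
  qed
qed

lemma lipschitz_near:
  fixes \<Phi> :: "real \<times> real \<Rightarrow> real"
  assumes "open S" "z0 \<in> S"
    and \<Phi>: "\<forall>z\<in>S. has_partials \<Phi> (\<lambda>i. q i z) z"
    and q: "\<forall>i. continuous (at z0) (q i)"
  obtains M where "M > 0" "\<forall>\<^sub>F \<rho> in at_right 0. \<forall>zl\<in>cball z0 \<rho>. \<forall>zr\<in>cball z0 \<rho>.
     \<bar>\<Phi> zr - \<Phi> zl\<bar> \<le> M * norm (zr - zl)"
proof -
  define M where "M = \<bar>q Slow z0\<bar> + \<bar>q Fast z0\<bar> + 1"
  have "\<bar>q k z0\<bar> < M" for k by (cases k) (auto simp: M_def)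
  then have b: "\<forall>\<^sub>F \<rho> in at_right 0. \<forall>z\<in>cball z0 \<rho>. norm (q k z) \<le> M" for k
    using q by (intro eventually_bounded) auto
  have "\<forall>\<^sub>F \<rho> in at_right 0. \<forall>zl\<in>cball z0 \<rho>. \<forall>zr\<in>cball z0 \<rho>.
     \<bar>\<Phi> zr - \<Phi> zl\<bar> \<le> 2 * M * norm (zr - zl)"
    using b[of Slow] b[of Fast] eventually_cball_subset[OF assms(1,2)]
  proof (eventually_elim, intro ballI)
    fix \<rho> zl zr
    assume qS: "\<forall>z\<in>cball z0 \<rho>. norm (q Slow z) \<le> M" and qF: "\<forall>z\<in>cball z0 \<rho>. norm (q Fast z) \<le> M"
      and ball: "cball z0 \<rho> \<subseteq> S" and z: "zl \<in> cball z0 \<rho>" "zr \<in> cball z0 \<rho>"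
    have "norm (\<Phi> zr - \<Phi> zl) \<le> 2 * M * norm (zr - zl)"
    proof (rule differentiable_bound[of "cball z0 \<rho>"])
      show "(\<Phi> has_derivative (\<lambda>h. (h \<bullet> dir Slow) *\<^sub>R q Slow z + (h \<bullet> dir Fast) *\<^sub>R q Fast z)) (at z within cball z0 \<rho>)"
        if "z \<in> cball z0 \<rho>" for z
      proof -
        have "has_partials \<Phi> (\<lambda>i. q i z) z" using \<Phi> ball that by blast
        then show ?thesis unfolding has_partials_def by (rule has_derivative_at_withinI)
      qed
      show "onorm (\<lambda>h. (h \<bullet> dir Slow) *\<^sub>R q Slow z + (h \<bullet> dir Fast) *\<^sub>R q Fast z) \<le> 2 * M"
        if "z \<in> cball z0 \<rho>" for z
      proof (rule onorm_le)
        fix h :: "real \<times> real"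
        have *: "norm ((h \<bullet> dir k) *\<^sub>R q k z) \<le> norm h * M" for k
          unfolding norm_scaleR
          by (rule mult_mono) (use qS qF that abs_inner_dir_le[of h k] in \<open>cases k; auto\<close>)+
        have "norm h * M + norm h * M = 2 * M * norm h" by simp
        then show "norm ((h \<bullet> dir Slow) *\<^sub>R q Slow z + (h \<bullet> dir Fast) *\<^sub>R q Fast z) \<le> 2 * M * norm h"
          using norm_triangle_le[OF add_mono[OF *[of Slow] *[of Fast]]] by (rule subst)
      qed
    qed (use z in auto)
    then show "\<bar>\<Phi> zr - \<Phi> zl\<bar> \<le> 2 * M * norm (zr - zl)" by simp
  qed
  then show ?thesis using that[of "2 * M"] by (simp add: M_def add_nonneg_pos)
qed

text \<open>Two parallel increments are compared through the partial derivative at their midpoints, where the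
  error is \<open>o(\<epsilon>\<^sup>2)\<close>. The midpoints differ by the increment in the other direction.\<close>
lemma second_difference:
  fixes \<Phi> :: "real \<times> real \<Rightarrow> real"
  assumes "open S" "z0 \<in> S"
    and \<Phi>: "\<forall>z\<in>S. has_partials \<Phi> (\<lambda>i. q i z) z"
    and q: "\<forall>i. q i differentiable (at z0)"
    and Q: "has_partials (q Fast) Q z0"
    and "\<eta> > 0"
  shows "\<forall>\<^sub>F \<epsilon> in at_right 0. \<forall>a b. \<bar>a\<bar> \<le> \<epsilon> \<longrightarrow> \<bar>b\<bar> \<le> \<epsilon> \<longrightarrow>
    \<bar>\<Phi> (z0 + a *\<^sub>R dir Slow + b *\<^sub>R dir Fast) + \<Phi> z0 - \<Phi> (z0 + a *\<^sub>R dir Slow) - \<Phi> (z0 + b *\<^sub>R dir Fast)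
       - a * b * Q Slow\<bar> \<le> \<eta> * \<epsilon>\<^sup>2"
proof -
  have "\<eta> / 16 > 0" "\<eta> / 4 > 0" using \<open>\<eta> > 0\<close> by auto
  have two: "(2::real) > 0" by simp
  show ?thesis
    using eventually_at_right_scale[OF symmetric_difference[OF assms(1,2) \<Phi> q \<open>\<eta> / 16 > 0\<close>, of Fast] two]
      eventually_at_right_scale[OF derivative_near[OF Q[unfolded has_partials_def] \<open>\<eta> / 4 > 0\<close>] two]
      eventually_at_right_less[of "0::real"]
  proof (eventually_elim, intro allI impI)
    fix \<epsilon> a b :: real
    assume sd: "\<forall>zl\<in>cball z0 (2 * \<epsilon>). \<forall>zr\<in>cball z0 (2 * \<epsilon>).
        norm (\<Phi> zr - \<Phi> zl - (((zr - zl) \<bullet> dir Fast) *\<^sub>R q Fast ((1 / 2) *\<^sub>R (zl + zr)) +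
          ((zr - zl) \<bullet> dir (opp Fast)) *\<^sub>R q (opp Fast) ((1 / 2) *\<^sub>R (zl + zr)))) \<le> \<eta> / 16 * (2 * \<epsilon>)\<^sup>2"
      and dn: "\<forall>z\<in>cball z0 (2 * \<epsilon>). \<forall>w\<in>cball z0 (2 * \<epsilon>).
        norm (q Fast z - q Fast w - (((z - w) \<bullet> dir Slow) *\<^sub>R Q Slow + ((z - w) \<bullet> dir Fast) *\<^sub>R Q Fast)) \<le> \<eta> / 4 * (2 * \<epsilon>)"
      and "0 < \<epsilon>" and ab: "\<bar>a\<bar> \<le> \<epsilon>" "\<bar>b\<bar> \<le> \<epsilon>"
    have ball: "z0 + x *\<^sub>R dir Slow + y *\<^sub>R dir Fast \<in> cball z0 (2 * \<epsilon>)" if "\<bar>x\<bar> \<le> \<epsilon>" "\<bar>y\<bar> \<le> \<epsilon>" for x y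
    proof -
      have "norm (x *\<^sub>R dir Slow + y *\<^sub>R dir Fast) \<le> \<bar>x\<bar> + \<bar>y\<bar>"
        by (rule norm_triangle_le) (simp del: dir.simps)
      then show ?thesis
        unfolding mem_cball dist_commute[of z0] unfolding dist_norm add.assoc add_diff_cancel_left' using that by linarith
    qed
    define A where "A = z0"
    define B where "B = z0 + b *\<^sub>R dir Fast"
    define C where "C = z0 + a *\<^sub>R dir Slow"
    define D where "D = z0 + a *\<^sub>R dir Slow + b *\<^sub>R dir Fast"
    have in_ball: "A \<in> cball z0 (2 * \<epsilon>)" "B \<in> cball z0 (2 * \<epsilon>)" "C \<in> cball z0 (2 * \<epsilon>)" "D \<in> cball z0 (2 * \<epsilon>)"
      using ball[of 0 0] ball[of 0 b] ball[of a 0] ball[of a b] ab \<open>0 < \<epsilon>\<close> by (simp_all add: A_def B_def C_def D_def del: dir.simps)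
    define m where "m = (1/2) *\<^sub>R (A + B)"
    define m' where "m' = (1/2) *\<^sub>R (C + D)"
    have m: "m \<in> cball z0 (2 * \<epsilon>)" "m' \<in> cball z0 (2 * \<epsilon>)"
      unfolding m_def m'_def using in_ball by (auto intro: midpoint_in_cball simp del: mem_cball)
    have "(B - A) \<bullet> dir Fast = b" "(B - A) \<bullet> dir (opp Fast) = 0"
      "(D - C) \<bullet> dir Fast = b" "(D - C) \<bullet> dir (opp Fast) = 0"
      by (simp_all add: A_def B_def C_def D_def)
    note increments = this
    have AB: "\<bar>\<Phi> B - \<Phi> A - b * q Fast m\<bar> \<le> \<eta> / 4 * \<epsilon>\<^sup>2"
      using sd[rule_format, OF in_ball(1,2), folded m_def, unfolded increments] by (simp add: power_mult_distrib)
    have CD: "\<bar>\<Phi> D - \<Phi> C - b * q Fast m'\<bar> \<le> \<eta> / 4 * \<epsilon>\<^sup>2"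
      using sd[rule_format, OF in_ball(3,4), folded m'_def, unfolded increments] by (simp add: power_mult_distrib)
    have "m' - m = a *\<^sub>R dir Slow"
      by (simp add: m_def m'_def A_def B_def C_def D_def prod_eq_iff field_simps)
    then have "\<bar>q Fast m' - q Fast m - a * Q Slow\<bar> \<le> \<eta> / 2 * \<epsilon>"
      using dn[rule_format, OF m(2,1)] by (simp del: dir.simps) (simp add: field_simps)
    then have "\<bar>b\<bar> * \<bar>q Fast m' - q Fast m - a * Q Slow\<bar> \<le> \<epsilon> * (\<eta> / 2 * \<epsilon>)"
      by (intro mult_mono ab) (use \<open>0 < \<epsilon>\<close> in auto)
    then have "\<bar>b * q Fast m' - b * q Fast m - a * b * Q Slow\<bar> \<le> \<eta> / 2 * \<epsilon>\<^sup>2"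
      unfolding abs_mult[symmetric] by (simp add: algebra_simps power2_eq_square)
    with AB CD have "\<bar>\<Phi> D + \<Phi> A - \<Phi> C - \<Phi> B - a * b * Q Slow\<bar> \<le> \<eta> * \<epsilon>\<^sup>2" by linarith
    then show "\<bar>\<Phi> (z0 + a *\<^sub>R dir Slow + b *\<^sub>R dir Fast) + \<Phi> z0 - \<Phi> (z0 + a *\<^sub>R dir Slow) - \<Phi> (z0 + b *\<^sub>R dir Fast)
       - a * b * Q Slow\<bar> \<le> \<eta> * \<epsilon>\<^sup>2" by (simp only: A_def B_def C_def D_def)
  qed
qed

section \<open>Two consecutive weak waves\<close>

context riemann_coordinates
begin

text \<open>The middle state has two coordinates, and each of the two waves prescribes one of them as a small
  continuous function of the middle state itself. Writing the middle state as the corner of the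
  rectangle plus \<open>w\<close>, these conditions are a fixed point equation for \<open>w\<close> in a small disc.\<close>
lemma consecutive_waves:
  assumes z0: "z0 \<in> V" and c: "separates c z0" and \<tau>: "\<And>k. \<tau> k = 1 \<or> \<tau> k = -1" and "\<eta> > 0"
  shows "\<forall>\<^sub>F \<epsilon> in at_right 0. \<exists>zm. norm (zm - (z0 + (\<epsilon> * \<tau> i) *\<^sub>R dir i)) \<le> \<eta> * \<epsilon>\<^sup>2 \<and>
    localized_wave c i z0 zm \<and>
    localized_wave c (opp i) zm (z0 + (\<epsilon> * \<tau> i) *\<^sub>R dir i + (\<epsilon> * \<tau> (opp i)) *\<^sub>R dir (opp i))"
proof -
  define j where "j = opp i"
  have ij: "opp j = i" "dir i \<bullet> dir i = 1" "dir j \<bullet> dir j = 1" "dir i \<bullet> dir j = 0" "dir j \<bullet> dir i = 0"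
    by (simp_all add: j_def)
  have "\<eta> / 32 > 0" "(4::real) > 0" using \<open>\<eta> > 0\<close> by auto
  have "1 / (2 * (\<eta> + 1)) > 0" using \<open>\<eta> > 0\<close> by simp
  show ?thesis
    using eventually_at_right_scale[OF wave_branch[OF z0 c \<tau>[of i] \<open>\<eta> / 32 > 0\<close>, of i] \<open>4 > 0\<close>]
      eventually_at_right_scale[OF wave_branch[OF z0 c \<tau>[of j] \<open>\<eta> / 32 > 0\<close>, of j] \<open>4 > 0\<close>]
      eventually_at_right_less[of "0::real"] eventually_at_right_0_le[OF \<open>1 / (2 * (\<eta> + 1)) > 0\<close>]
    unfolding j_def[symmetric] ij(1)
  proof eventually_elim
    case (elim \<epsilon>)
    \<comment> \<open>All states lie within \<open>4 \<epsilon>\<close> of \<open>z0\<close>, and every wave has strength at least \<open>\<epsilon> / 2 = \<rho> / 8\<close>.\<close>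
    define \<rho> where "\<rho> = 4 * \<epsilon>"
    obtain N where N: "continuous_on (wave_domain i (\<tau> i) z0 \<rho>) N"
      "\<And>zl zr. (zl, zr) \<in> wave_domain i (\<tau> i) z0 \<rho> \<Longrightarrow> \<bar>N (zl, zr)\<bar> \<le> \<eta> / 32 * \<rho>\<^sup>2"
      "\<And>zl zr. (zl, zr) \<in> wave_domain i (\<tau> i) z0 \<rho> \<Longrightarrow> (zr - zl) \<bullet> dir j = N (zl, zr) \<Longrightarrow> localized_wave c i zl zr"
      using elim(1) unfolding \<rho>_def by blast
    obtain N' where N': "continuous_on (wave_domain j (\<tau> j) z0 \<rho>) N'"
      "\<And>zl zr. (zl, zr) \<in> wave_domain j (\<tau> j) z0 \<rho> \<Longrightarrow> \<bar>N' (zl, zr)\<bar> \<le> \<eta> / 32 * \<rho>\<^sup>2"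
      "\<And>zl zr. (zl, zr) \<in> wave_domain j (\<tau> j) z0 \<rho> \<Longrightarrow> (zr - zl) \<bullet> dir i = N' (zl, zr) \<Longrightarrow> localized_wave c j zl zr"
      using elim(2) unfolding \<rho>_def by blast
    define \<delta> where "\<delta> = \<eta> * \<epsilon>\<^sup>2"
    have "\<epsilon> * (2 * (\<eta> + 1)) \<le> 1" using elim(4) \<open>\<eta> > 0\<close> by (simp add: field_simps)
    then have "\<epsilon> * \<eta> \<le> 1 / 2" using elim(3) by (simp add: algebra_simps)
    then have "\<epsilon> * (\<epsilon> * \<eta>) \<le> \<epsilon> * (1 / 2)" by (rule mult_left_mono) (use elim(3) in simp)
    then have \<delta>: "\<delta> \<le> \<epsilon> / 2" "0 < \<delta>"
      using \<open>\<eta> > 0\<close> elim(3) by (simp_all add: \<delta>_def power2_eq_square mult_ac)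
    define zm where "zm w = z0 + (\<epsilon> * \<tau> i) *\<^sub>R dir i + w" for w
    define zr where "zr = z0 + (\<epsilon> * \<tau> i) *\<^sub>R dir i + (\<epsilon> * \<tau> j) *\<^sub>R dir j"
    have \<tau>1: "\<bar>\<epsilon> * \<tau> k\<bar> = \<epsilon>" "\<tau> k * (\<epsilon> * \<tau> k) = \<epsilon>" for k using \<tau>[of k] elim(3) by auto
    have inc: "zm w - z0 = (\<epsilon> * \<tau> i) *\<^sub>R dir i + w" "zr - zm w = (\<epsilon> * \<tau> j) *\<^sub>R dir j - w" for w
      by (simp_all add: zm_def zr_def)
    have ball: "z0 \<in> cball z0 \<rho>" "zr \<in> cball z0 \<rho>" using elim(3)
    proof -
      have "norm (zr - z0) \<le> \<bar>\<epsilon> * \<tau> i\<bar> + \<bar>\<epsilon> * \<tau> j\<bar>"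
        unfolding zr_def by (simp only: add.assoc add_diff_cancel_left')
          (rule norm_triangle_le, simp)
      then show "zr \<in> cball z0 \<rho>" using \<tau>1 elim(3) by (simp add: \<rho>_def dist_norm norm_minus_commute)
    qed (simp add: \<rho>_def)
    have dom: "(z0, zm w) \<in> wave_domain i (\<tau> i) z0 \<rho>" "(zm w, zr) \<in> wave_domain j (\<tau> j) z0 \<rho>"
      if w: "w \<in> cball 0 \<delta>" for w
    proof -
      have nw: "norm w \<le> \<delta>" using w by simp
      have "norm (zm w - z0) \<le> \<bar>\<epsilon> * \<tau> i\<bar> + norm w"
        unfolding inc by (rule norm_triangle_le) simp
      then have "zm w \<in> cball z0 \<rho>" using \<tau>1 nw \<delta> elim(3) by (simp add: \<rho>_def dist_norm norm_minus_commute)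
      moreover have wk: "\<bar>\<tau> k * (w \<bullet> dir k)\<bar> \<le> \<epsilon> / 2" for k
      proof -
        have "\<bar>\<tau> k\<bar> = 1" using \<tau>[of k] by auto
        then have "\<bar>\<tau> k * (w \<bullet> dir k)\<bar> = \<bar>w \<bullet> dir k\<bar>" by (simp only: abs_mult mult_1)
        then show ?thesis using abs_inner_dir_le[of w k] nw \<delta>(1) by linarith
      qed
      have "\<rho> / 8 \<le> \<tau> i * ((zm w - z0) \<bullet> dir i)"
      proof -
        have "\<tau> i * ((zm w - z0) \<bullet> dir i) = \<tau> i * (\<epsilon> * \<tau> i) + \<tau> i * (w \<bullet> dir i)"
          unfolding inc by (simp add: inner_add_left ij distrib_left)
        then show ?thesis using wk[of i] \<tau>1(2)[of i] unfolding \<rho>_def by linarith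
      qed
      moreover have "\<rho> / 8 \<le> \<tau> j * ((zr - zm w) \<bullet> dir j)"
      proof -
        have "\<tau> j * ((zr - zm w) \<bullet> dir j) = \<tau> j * (\<epsilon> * \<tau> j) - \<tau> j * (w \<bullet> dir j)"
          unfolding inc by (simp add: inner_diff_left ij right_diff_distrib)
        then show ?thesis using wk[of j] \<tau>1(2)[of j] unfolding \<rho>_def by linarith
      qed
      ultimately show "(z0, zm w) \<in> wave_domain i (\<tau> i) z0 \<rho>" "(zm w, zr) \<in> wave_domain j (\<tau> j) z0 \<rho>"
        using ball unfolding wave_domain_def by auto
    qed
    \<comment> \<open>The first wave prescribes the coordinate of \<open>w\<close> in the direction \<open>j\<close>, the second the one in the direction \<open>i\<close>, measured back from \<open>zr\<close>.\<close>
    define T where "T w = N (z0, zm w) *\<^sub>R dir j - N' (zm w, zr) *\<^sub>R dir i" for w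
    have "continuous_on (cball 0 \<delta>) (\<lambda>w. N (z0, zm w))" "continuous_on (cball 0 \<delta>) (\<lambda>w. N' (zm w, zr))"
      unfolding zm_def
      by (rule continuous_on_compose2[OF N(1)] continuous_on_compose2[OF N'(1)],
          intro continuous_intros, use dom in \<open>auto simp: zm_def\<close>)+
    then have "continuous_on (cball 0 \<delta>) T"
      unfolding T_def by (intro continuous_intros)
    moreover have "T \<in> cball 0 \<delta> \<rightarrow> cball 0 \<delta>"
    proof
      fix w :: "real \<times> real" assume w: "w \<in> cball 0 \<delta>"
      have "norm (T w) \<le> \<bar>N (z0, zm w)\<bar> + \<bar>N' (zm w, zr)\<bar>"
        unfolding T_def by (rule order_trans[OF norm_triangle_ineq4]) simp
      also have "\<dots> \<le> \<eta> / 32 * \<rho>\<^sup>2 + \<eta> / 32 * \<rho>\<^sup>2"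
        by (intro add_mono N(2) N'(2) dom w)
      also have "\<dots> = \<delta>" by (simp add: \<delta>_def \<rho>_def power2_eq_square)
      finally show "T w \<in> cball 0 \<delta>" by simp
    qed
    ultimately obtain w where w: "w \<in> cball 0 \<delta>" "T w = w"
      using brouwer[of "cball 0 \<delta>" T] \<delta>(2) by auto
    have "w \<bullet> dir j = N (z0, zm w)" "w \<bullet> dir i = - N' (zm w, zr)"
      by (subst w(2)[symmetric], simp add: T_def inner_diff_left ij)+
    then have "(zm w - z0) \<bullet> dir j = N (z0, zm w)" "(zr - zm w) \<bullet> dir i = N' (zm w, zr)"
      unfolding inc by (simp_all add: inner_add_left inner_diff_left ij)
    then have "localized_wave c i z0 (zm w)" "localized_wave c j (zm w) zr"
      using N(3)[OF dom(1)[OF w(1)]] N'(3)[OF dom(2)[OF w(1)]] by simp_all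
    moreover have "norm (zm w - (z0 + (\<epsilon> * \<tau> i) *\<^sub>R dir i)) \<le> \<eta> * \<epsilon>\<^sup>2"
      using w(1) by (simp add: zm_def \<delta>_def)
    ultimately show ?case unfolding zr_def by blast
  qed
qed

end

section \<open>Vanishing of the mixed derivative\<close>

lemma has_partials_slices:
  assumes "has_partials g G (a, b)"
  shows "((\<lambda>x. g (x, b)) has_vector_derivative G Slow) (at a)"
    and "((\<lambda>y. g (a, y)) has_vector_derivative G Fast) (at b)"
proof -
  have "((\<lambda>x. (x, b)) has_derivative (\<lambda>h. (h, 0))) (at a)" "((\<lambda>y. (a, y)) has_derivative (\<lambda>h. (0, h))) (at b)"
    by (auto intro!: derivative_eq_intros)
  from this[THEN has_derivative_compose] assms[unfolded has_partials_def]
  show "((\<lambda>x. g (x, b)) has_vector_derivative G Slow) (at a)"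
    "((\<lambda>y. g (a, y)) has_vector_derivative G Fast) (at b)"
    unfolding has_vector_derivative_def by fastforce+
qed

lemma mono_on_signed:
  fixes p :: "real \<Rightarrow> real"
  assumes "mono_on T (\<lambda>t. \<kappa> * p t)" "\<kappa> = 1 \<or> \<kappa> = -1"
  shows "mono_on T p \<or> antimono_on T p"
  using assms by (auto simp: monotone_on_def)

context riemann_coordinates
begin

lemma separating_speed_exists:
  assumes "z \<in> V"
  obtains c where "separates c z"
  using strictly_hyperbolic[OF U_in[OF assms]] dense unfolding separates_def by blast

context
  fixes \<phi> :: "real^2 \<Rightarrow> real"
  assumes C2: "Ck_on 2 \<U> \<phi>"
begin

abbreviation "dphi i \<equiv> directional_derivative (R i) \<phi>"
abbreviation "mixed \<equiv> directional_derivative (R Slow) (directional_derivative (R Fast) \<phi>)"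

lemma dphi_C1: "Ck_on 1 \<U> (dphi i)"
  using C2 smooth_eigenvectors[of i] open_states
  by (intro Ck_on_directional_derivative) (simp_all only: smooth_on_def numeral_2_eq_2 One_nat_def)

lemma mixed_continuous: "continuous_on \<U> mixed"
proof -
  have "Ck_on 0 \<U> mixed"
  proof (rule Ck_on_directional_derivative[OF open_states])
    show "Ck_on (Suc 0) \<U> (dphi Fast)" using dphi_C1[of Fast] by (simp only: One_nat_def)
    show "Ck_on 0 \<U> (R Slow)" using smooth_eigenvectors[of Slow] unfolding smooth_on_def by blast
  qed
  then show ?thesis by simp
qed

lemma phi_has_partials:
  assumes "z \<in> V"
  shows "has_partials (\<lambda>z. \<phi> (U z)) (\<lambda>i. dphi i (U z)) z"
  using C2 by (intro compose_U_has_partials assms) (use U_in[OF assms] in \<open>simp add: numeral_2_eq_2\<close>)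

lemma dphi_differentiable: "u \<in> \<U> \<Longrightarrow> dphi i differentiable (at u)"
  using dphi_C1[of i] by simp

text \<open>The signs \<open>\<tau>\<close> fix the direction of the waves of each family. The hypotheses on the signs say that
  \<open>\<kappa> \<phi>\<close> increases across the fast waves and decreases across the slow waves, in which case the
  variation inequality becomes an inequality for the second difference of \<open>\<kappa> \<phi>\<close>. Replacing the true
  middle states \<open>B\<close> and \<open>C\<close> by the corners \<open>B0\<close> and \<open>C0\<close> costs \<open>o(\<epsilon>\<^sup>2)\<close>, since \<open>\<phi>\<close> is Lipschitz.\<close>
lemma corner_sign:
  assumes tvd: "glimm_tvd_field \<phi>" and z0: "z0 \<in> V"
    and \<tau>: "\<And>k. \<tau> k = 1 \<or> \<tau> k = -1" and \<kappa>: "\<kappa> = 1 \<or> \<kappa> = -1"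
    and inc: "\<tau> Fast * (\<kappa> * dphi Fast (U z0)) > 0" and dec: "\<tau> Slow * (- \<kappa> * dphi Slow (U z0)) > 0"
  shows "\<kappa> * (\<tau> Slow * \<tau> Fast * mixed (U z0)) \<le> 0"
proof -
  define \<Phi> where "\<Phi> z = \<phi> (U z)" for z
  define Q where "Q = mixed (U z0)"
  have \<Phi>: "\<forall>z\<in>V. has_partials \<Phi> (\<lambda>i. dphi i (U z)) z"
    unfolding \<Phi>_def[abs_def] using phi_has_partials by blast
  have qd: "\<forall>i. (\<lambda>z. dphi i (U z)) differentiable (at z0)"
    using compose_U_differentiable[OF z0] dphi_differentiable U_in[OF z0] by blast
  then have qc: "\<forall>i. continuous (at z0) (\<lambda>z. dphi i (U z))"
    using differentiable_imp_continuous_within by blast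
  have scaled: "\<forall>z\<in>V. has_partials (\<lambda>z. k * \<Phi> z) (\<lambda>i. k * dphi i (U z)) z"
    "\<forall>i. continuous (at z0) (\<lambda>z. k * dphi i (U z))" for k
  proof -
    show "\<forall>z\<in>V. has_partials (\<lambda>z. k * \<Phi> z) (\<lambda>i. k * dphi i (U z)) z"
    proof
      fix z assume "z \<in> V"
      with \<Phi> have "has_partials \<Phi> (\<lambda>i. dphi i (U z)) z" by blast
      from has_derivative_mult_right[OF this[unfolded has_partials_def], of k]
      show "has_partials (\<lambda>z. k * \<Phi> z) (\<lambda>i. k * dphi i (U z)) z"
        unfolding has_partials_def by (simp add: algebra_simps)
    qed
    show "\<forall>i. continuous (at z0) (\<lambda>z. k * dphi i (U z))"
      using qc by (intro allI continuous_intros) blast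
  qed
  have Q: "has_partials (\<lambda>z. dphi Fast (U z)) (\<lambda>i. directional_derivative (R i) (dphi Fast) (U z0)) z0"
    by (rule compose_U_has_partials[OF z0 dphi_differentiable[OF U_in[OF z0]]])
  obtain c where c: "separates c z0" using separating_speed_exists[OF z0] by blast
  obtain M where "M > 0" and M: "\<forall>\<^sub>F \<rho> in at_right 0. \<forall>zl\<in>cball z0 \<rho>. \<forall>zr\<in>cball z0 \<rho>.
     \<bar>\<Phi> zr - \<Phi> zl\<bar> \<le> M * norm (zr - zl)"
    using lipschitz_near[OF open_V z0 \<Phi> qc] by blast
  have bound: "\<kappa> * (\<tau> Slow * \<tau> Fast * Q) \<le> \<eta> * (2 * M + 1)" if \<eta>: "\<eta> > 0" "\<eta> \<le> 1" for \<eta>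
  proof -
    have four: "(4::real) > 0" and half: "(1/2::real) > 0" by simp_all
    have mF: "\<forall>\<^sub>F \<rho> in at_right 0. \<forall>zl\<in>cball z0 \<rho>. \<forall>zr\<in>cball z0 \<rho>.
       \<rho> / 8 \<le> \<tau> Fast * ((zr - zl) \<bullet> dir Fast) \<longrightarrow> \<bar>(zr - zl) \<bullet> dir (opp Fast)\<bar> \<le> \<rho>\<^sup>2 \<longrightarrow>
       mono_on {0..1} (\<lambda>t. \<kappa> * \<Phi> (zl + t *\<^sub>R (zr - zl)))"
      by (rule segment_monotone[OF open_V z0 scaled \<tau> inc])
    have mS: "\<forall>\<^sub>F \<rho> in at_right 0. \<forall>zl\<in>cball z0 \<rho>. \<forall>zr\<in>cball z0 \<rho>.
       \<rho> / 8 \<le> \<tau> Slow * ((zr - zl) \<bullet> dir Slow) \<longrightarrow> \<bar>(zr - zl) \<bullet> dir (opp Slow)\<bar> \<le> \<rho>\<^sup>2 \<longrightarrow>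
       mono_on {0..1} (\<lambda>t. - \<kappa> * \<Phi> (zl + t *\<^sub>R (zr - zl)))"
      by (rule segment_monotone[OF open_V z0 scaled \<tau> dec])
    note all = eventually_at_right_less[of "0::real"] eventually_at_right_0_le[OF half]
      eventually_at_right_scale[OF mF four] eventually_at_right_scale[OF mS four]
      eventually_at_right_scale[OF M four]
      second_difference[OF open_V z0 \<Phi> qd Q \<eta>(1)]
      consecutive_waves[where \<tau> = \<tau> and i = Slow, OF z0 c \<tau> \<eta>(1)]
      consecutive_waves[where \<tau> = \<tau> and i = Fast, OF z0 c \<tau> \<eta>(1)]
    have "\<forall>\<^sub>F \<epsilon> in at_right (0::real). \<kappa> * (\<tau> Slow * \<tau> Fast * Q) \<le> \<eta> * (2 * M + 1)"
      using all
    proof eventually_elim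
      case (elim \<epsilon>)
      define \<rho> where "\<rho> = 4 * \<epsilon>"
      define \<delta> where "\<delta> = \<eta> * \<epsilon>\<^sup>2"
      have "\<epsilon> > 0" "\<epsilon> \<le> 1/2" by fact+
      have "\<delta> \<le> \<epsilon>\<^sup>2" unfolding \<delta>_def using \<eta> by (intro mult_left_le_one_le) auto
      moreover have "\<epsilon>\<^sup>2 \<le> \<epsilon> / 2"
        unfolding power2_eq_square using mult_left_mono[OF \<open>\<epsilon> \<le> 1/2\<close>, of \<epsilon>] \<open>\<epsilon> > 0\<close> by simp
      moreover have "0 \<le> \<epsilon>\<^sup>2" by simp
      moreover have "\<rho>\<^sup>2 = 16 * \<epsilon>\<^sup>2" by (simp add: \<rho>_def power_mult_distrib)
      ultimately have \<delta>: "\<delta> \<le> \<epsilon> / 2" "\<delta> \<le> \<rho>\<^sup>2" by linarith+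
      have step: "\<rho> / 8 \<le> \<tau> k * (h \<bullet> dir k)" "\<bar>h \<bullet> dir (opp k)\<bar> \<le> \<rho>\<^sup>2" "norm h \<le> 2 * \<epsilon>"
        if h: "norm (h - (\<epsilon> * \<tau> k) *\<^sub>R dir k) \<le> \<delta>" for h k
      proof -
        define w where "w = h - (\<epsilon> * \<tau> k) *\<^sub>R dir k"
        have hw: "h = (\<epsilon> * \<tau> k) *\<^sub>R dir k + w" and nw: "norm w \<le> \<delta>" using h by (simp_all add: w_def)
        have t: "\<tau> k * (\<epsilon> * \<tau> k) = \<epsilon>" "\<bar>\<tau> k\<bar> = 1" using \<tau>[of k] by auto
        have "\<tau> k * (h \<bullet> dir k) = \<epsilon> + \<tau> k * (w \<bullet> dir k)"
          unfolding hw using t(1) by (simp add: inner_add_left distrib_left)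
        moreover have "\<bar>\<tau> k * (w \<bullet> dir k)\<bar> \<le> \<delta>"
          using abs_inner_dir_le[of w k] nw by (simp only: abs_mult t mult_1)
        ultimately show "\<rho> / 8 \<le> \<tau> k * (h \<bullet> dir k)" using \<delta>(1) unfolding \<rho>_def by linarith
        have "h \<bullet> dir (opp k) = w \<bullet> dir (opp k)" unfolding hw by (simp add: inner_add_left)
        then show "\<bar>h \<bullet> dir (opp k)\<bar> \<le> \<rho>\<^sup>2" using abs_inner_dir_le[of w "opp k"] nw \<delta>(2) by linarith
        have "norm h \<le> \<bar>\<epsilon> * \<tau> k\<bar> + norm w" unfolding hw by (rule norm_triangle_le) simp
        then show "norm h \<le> 2 * \<epsilon>" using nw \<delta>(1) \<open>\<epsilon> > 0\<close> t(2) by (simp add: abs_mult)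
      qed
      define B0 where "B0 = z0 + (\<epsilon> * \<tau> Fast) *\<^sub>R dir Fast"
      define C0 where "C0 = z0 + (\<epsilon> * \<tau> Slow) *\<^sub>R dir Slow"
      define D where "D = z0 + (\<epsilon> * \<tau> Slow) *\<^sub>R dir Slow + (\<epsilon> * \<tau> Fast) *\<^sub>R dir Fast"
      \<comment> \<open>The outgoing waves pass through \<open>C\<close>, the incoming waves through \<open>B\<close>.\<close>
      obtain C where C: "norm (C - C0) \<le> \<delta>" "localized_wave c Slow z0 C" "localized_wave c Fast C D"
        using elim(7) unfolding C0_def D_def \<delta>_def opp.simps by blast
      obtain B where B: "norm (B - B0) \<le> \<delta>" "localized_wave c Fast z0 B" "localized_wave c Slow B D"
        using elim(8) unfolding B0_def D_def \<delta>_def opp.simps add.assoc add.commute[of "(\<epsilon> * \<tau> Fast) *\<^sub>R dir Fast"] by blast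
      have "norm ((B - z0) - (\<epsilon> * \<tau> Fast) *\<^sub>R dir Fast) \<le> \<delta>" "norm ((C - z0) - (\<epsilon> * \<tau> Slow) *\<^sub>R dir Slow) \<le> \<delta>"
        using B(1) C(1) unfolding B0_def C0_def by (simp_all only: diff_diff_eq)
      note sB = step[OF this(1)] and sC = step[OF this(2)]
      have "(D - C) - (\<epsilon> * \<tau> Fast) *\<^sub>R dir Fast = - (C - C0)" "(D - B) - (\<epsilon> * \<tau> Slow) *\<^sub>R dir Slow = - (B - B0)"
        unfolding D_def C0_def B0_def by (simp_all del: dir.simps)
      then have "norm ((D - C) - (\<epsilon> * \<tau> Fast) *\<^sub>R dir Fast) \<le> \<delta>" "norm ((D - B) - (\<epsilon> * \<tau> Slow) *\<^sub>R dir Slow) \<le> \<delta>"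
        using B(1) C(1) by (simp_all only: norm_minus_cancel)
      note sCD = step[OF this(1)] and sBD = step[OF this(2)]
      have abs_step: "\<bar>\<epsilon> * \<tau> k\<bar> = \<epsilon>" for k using \<tau>[of k] \<open>\<epsilon> > 0\<close> by auto
      have "norm (B0 - z0) \<le> 2 * \<epsilon>" "norm (C0 - z0) \<le> 2 * \<epsilon>"
        using abs_step \<open>\<epsilon> > 0\<close> by (simp_all add: B0_def C0_def del: dir.simps)
      moreover have "norm (D - z0) \<le> norm (D - B) + norm (B - z0)"
        by (rule norm_diff_triangle_ineq[of D B B z0, simplified])
      ultimately have ball: "z0 \<in> cball z0 \<rho>" "B \<in> cball z0 \<rho>" "C \<in> cball z0 \<rho>" "D \<in> cball z0 \<rho>"
          "B0 \<in> cball z0 \<rho>" "C0 \<in> cball z0 \<rho>"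
        using sB(3) sC(3) sBD(3) \<open>\<epsilon> > 0\<close> unfolding \<rho>_def by (auto simp: dist_norm norm_minus_commute)
      have mAB: "mono_on {0..1} (\<lambda>t. \<kappa> * \<Phi> (z0 + t *\<^sub>R (B - z0)))"
        and mCD: "mono_on {0..1} (\<lambda>t. \<kappa> * \<Phi> (C + t *\<^sub>R (D - C)))"
        using elim(3)[folded \<rho>_def] ball sB sCD by blast+
      have mAC: "mono_on {0..1} (\<lambda>t. - \<kappa> * \<Phi> (z0 + t *\<^sub>R (C - z0)))"
        and mBD: "mono_on {0..1} (\<lambda>t. - \<kappa> * \<Phi> (B + t *\<^sub>R (D - B)))"
        using elim(4)[folded \<rho>_def] ball sC sBD by blast+
      have order: "\<kappa> * \<Phi> z0 \<le> \<kappa> * \<Phi> B" "\<kappa> * \<Phi> C \<le> \<kappa> * \<Phi> D"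
        "\<kappa> * \<Phi> C \<le> \<kappa> * \<Phi> z0" "\<kappa> * \<Phi> D \<le> \<kappa> * \<Phi> B"
        using mono_onD[OF mAB, of 0 1] mono_onD[OF mCD, of 0 1] mono_onD[OF mAC, of 0 1] mono_onD[OF mBD, of 0 1]
        by simp_all
      have "\<bar>\<Phi> C - \<Phi> z0\<bar> + \<bar>\<Phi> D - \<Phi> C\<bar> \<le> \<bar>\<Phi> B - \<Phi> z0\<bar> + \<bar>\<Phi> D - \<Phi> B\<bar>"
        unfolding \<Phi>_def
        by (rule head_on_inequality[OF tvd B(2,3) C(2,3) mono_on_signed[OF mAB[unfolded \<Phi>_def] \<kappa>]
              mono_on_signed[OF mBD[unfolded \<Phi>_def]]]) (use \<kappa> in auto)
      with order \<kappa> have corner: "\<kappa> * (\<Phi> D + \<Phi> z0 - \<Phi> C - \<Phi> B) \<le> 0"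
        by (elim disjE; simp only: mult_1 mult_minus1; linarith)
      have lip: "\<bar>\<Phi> B - \<Phi> B0\<bar> \<le> M * \<delta>" "\<bar>\<Phi> C - \<Phi> C0\<bar> \<le> M * \<delta>"
        using elim(5)[folded \<rho>_def, rule_format, OF ball(5) ball(2)] mult_left_mono[OF B(1), of M]
          elim(5)[folded \<rho>_def, rule_format, OF ball(6) ball(3)] mult_left_mono[OF C(1), of M] \<open>M > 0\<close>
        by linarith+
      have sd: "\<bar>\<Phi> D + \<Phi> z0 - \<Phi> C0 - \<Phi> B0 - (\<epsilon> * \<tau> Slow) * (\<epsilon> * \<tau> Fast) * Q\<bar> \<le> \<delta>"
        using elim(6)[rule_format, of "\<epsilon> * \<tau> Slow" "\<epsilon> * \<tau> Fast"] abs_step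
        unfolding D_def C0_def B0_def Q_def \<delta>_def by (simp del: dir.simps)
      have "\<kappa> * ((\<epsilon> * \<tau> Slow) * (\<epsilon> * \<tau> Fast) * Q) \<le> \<delta> + 2 * (M * \<delta>)"
        using \<kappa> corner lip sd by (elim disjE; simp only: mult_1 mult_minus1; linarith)
      then have "\<epsilon>\<^sup>2 * (\<kappa> * (\<tau> Slow * \<tau> Fast * Q)) \<le> \<epsilon>\<^sup>2 * (\<eta> * (2 * M + 1))"
        unfolding \<delta>_def by (simp add: power2_eq_square algebra_simps)
      then show ?case using \<open>\<epsilon> > 0\<close> by (simp add: mult_le_cancel_left)
    qed
    then show ?thesis by (simp add: eventually_const_iff)
  qed
  show ?thesis
  proof (rule ccontr)
    assume "\<not> ?thesis"
    then have pos: "\<kappa> * (\<tau> Slow * \<tau> Fast * Q) / 2 > 0" by (simp add: Q_def)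
    have "2 * M + 1 > 0" using \<open>M > 0\<close> by simp
    from small_factor[OF this pos] obtain \<eta> where "\<eta> > 0" "\<eta> \<le> 1" "\<eta> * (2 * M + 1) \<le> \<kappa> * (\<tau> Slow * \<tau> Fast * Q) / 2"
      by blast
    with bound[of \<eta>] pos show False by linarith
  qed
qed

text \<open>Changing \<open>\<kappa>\<close> reverses both waves, so the product of the two signs stays the same while the
  inequality is reversed.\<close>
lemma mixed_derivative_zero:
  assumes "glimm_tvd_field \<phi>" "z0 \<in> V" and nz: "dphi Slow (U z0) \<noteq> 0" "dphi Fast (U z0) \<noteq> 0"
  shows "mixed (U z0) = 0"
proof -
  \<comment> \<open>The directions in which \<open>\<kappa> \<phi>\<close> increases for fast and decreases for slow waves.\<close>
  define \<tau> where "\<tau> \<kappa> k = (case k of Fast \<Rightarrow> \<kappa> * sgn (dphi Fast (U z0)) | Slow \<Rightarrow> - \<kappa> * sgn (dphi Slow (U z0)))"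
    for \<kappa> :: real and k
  have "\<kappa> * (\<tau> \<kappa> Slow * \<tau> \<kappa> Fast * mixed (U z0)) \<le> 0" if "\<kappa> = 1 \<or> \<kappa> = -1" for \<kappa>
  proof (rule corner_sign[OF assms(1,2) _ that])
    show "\<tau> \<kappa> k = 1 \<or> \<tau> \<kappa> k = -1" for k
      using that nz by (cases k) (auto simp: \<tau>_def sgn_if)
    show "\<tau> \<kappa> Fast * (\<kappa> * dphi Fast (U z0)) > 0" "\<tau> \<kappa> Slow * (- \<kappa> * dphi Slow (U z0)) > 0"
      using that nz by (auto simp: \<tau>_def sgn_if)
  qed
  from this[of 1] this[of "-1"] have "sgn (dphi Slow (U z0)) * sgn (dphi Fast (U z0)) * mixed (U z0) = 0"
    by (simp add: \<tau>_def)
  then show ?thesis using nz by (simp add: sgn_eq_0_iff)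
qed

lemma decomposition_if_mixed_zero:
  assumes "open S" "convex S" "S \<subseteq> V" "\<And>z. z \<in> S \<Longrightarrow> mixed (U z) = 0"
  shows "\<exists>\<theta> \<psi>. \<forall>(a, b)\<in>S. \<phi> (U (a, b)) = \<theta> b - \<psi> a"
proof (rule sum_decomposition[OF assms(1,2), where \<Phi> = "\<lambda>z. \<phi> (U z)" and q = "\<lambda>z. dphi Fast (U z)"])
  fix a b assume ab: "(a, b) \<in> S"
  then have V: "(a, b) \<in> V" using assms(3) by blast
  show "((\<lambda>y. \<phi> (U (a, y))) has_real_derivative dphi Fast (U (a, b))) (at b)"
    using has_partials_slices(2)[OF phi_has_partials[OF V]]
    by (simp add: has_real_derivative_iff_has_vector_derivative)
  show "((\<lambda>x. dphi Fast (U (x, b))) has_real_derivative 0) (at a)"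
    using has_partials_slices(1)[OF compose_U_has_partials[OF V dphi_differentiable[OF U_in[OF V]]], of Fast] assms(4)[OF ab]
    by (simp add: has_real_derivative_iff_has_vector_derivative)
next
  show "continuous_on S (\<lambda>z. dphi Fast (U z))"
    by (rule compose_U_continuous_on[OF Ck_on_imp_continuous_on[OF dphi_C1] assms(3)])
qed

end

end

theorem theorem2p4:
  fixes \<U> :: "(real^2) set"
    and f :: "real^2 \<Rightarrow> real^2"
    and lam :: "wave_family \<Rightarrow> real^2 \<Rightarrow> real"
    and R L :: "wave_family \<Rightarrow> real^2 \<Rightarrow> real^2"
    and W :: "wave_family \<Rightarrow> real \<Rightarrow> real^2 \<Rightarrow> real^2"
    and r s :: "real^2 \<Rightarrow> real"
    and U :: "real \<times> real \<Rightarrow> real^2"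
    and \<phi> :: "real^2 \<Rightarrow> real"
    and V V' :: "(real \<times> real) set"
  assumes system: "hyperbolic_system \<U> f lam R L W"
    and commute: "\<forall>u\<in>\<U>. lie_bracket (R Fast) (R Slow) u = 0"
    and grad_r: "\<forall>u\<in>\<U>. grad r u \<bullet> R Slow u = 1 \<and> grad r u \<bullet> R Fast u = 0"
    and grad_s: "\<forall>u\<in>\<U>. grad s u \<bullet> R Slow u = 0 \<and> grad s u \<bullet> R Fast u = 1"
    and V_eq: "V = {(a, b). \<exists>u\<in>\<U>. r u = a \<and> s u = b}"
    and diffeo: "diffeomorphism_between V \<U> U (\<lambda>u. (r u, s u))"
    and C2: "Ck_on 2 \<U> \<phi>"
    and tvd: "conservation_law.glimm_tvd_field \<U> f lam R \<phi>"
    and V'_eq: "V' = {(a, b) \<in> V. deriv (\<lambda>x. \<phi> (U (x, b))) a \<noteq> 0 \<and>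
                                  deriv (\<lambda>y. \<phi> (U (a, y))) b \<noteq> 0}"
  shows "(\<forall>S. open S \<and> convex S \<and> S \<subseteq> V' \<longrightarrow>
            (\<exists>\<theta> \<psi> :: real \<Rightarrow> real. \<forall>(a, b)\<in>S. \<phi> (U (a, b)) = \<theta> b - \<psi> a)) \<and>
         (convex V \<and> V \<subseteq> closure V' \<longrightarrow>
            (\<exists>\<theta> \<psi> :: real \<Rightarrow> real. \<forall>(a, b)\<in>V. \<phi> (U (a, b)) = \<theta> b - \<psi> a))"
proof -
  interpret hyperbolic_system \<U> f lam R L W by (rule system)
  interpret riemann_coordinates \<U> f lam R L W r s U V
    by unfold_locales (use grad_r grad_s diffeo in auto)
  let ?m = "directional_derivative (R Slow) (directional_derivative (R Fast) \<phi>)"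
  have V'_sub: "V' \<subseteq> V" using V'_eq by auto
  have zero: "?m (U z) = 0" if "z \<in> V'" for z
  proof -
    obtain a b where z: "z = (a, b)" by (cases z)
    have V: "(a, b) \<in> V" using that V'_sub z by auto
    have "deriv (\<lambda>x. \<phi> (U (x, b))) a = directional_derivative (R Slow) \<phi> (U (a, b))"
      "deriv (\<lambda>y. \<phi> (U (a, y))) b = directional_derivative (R Fast) \<phi> (U (a, b))"
      using has_partials_slices[OF phi_has_partials[OF C2 V]]
      by (auto intro!: DERIV_imp_deriv simp: has_real_derivative_iff_has_vector_derivative)
    then show ?thesis
      using mixed_derivative_zero[OF C2 tvd V] that unfolding z V'_eq by auto
  qed
  show ?thesis
  proof (intro conjI allI impI)
    fix S assume S: "open S \<and> convex S \<and> S \<subseteq> V'"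
    show "\<exists>\<theta> \<psi>. \<forall>(a, b)\<in>S. \<phi> (U (a, b)) = \<theta> b - \<psi> a"
      by (rule decomposition_if_mixed_zero[OF C2]) (use S V'_sub zero in auto)
  next
    assume dense: "convex V \<and> V \<subseteq> closure V'"
    have "open (V \<inter> (\<lambda>z. ?m (U z)) -` (- {0}))"
      by (rule continuous_open_preimage[OF compose_U_continuous_on[OF mixed_continuous[OF C2] order_refl] open_V])
        auto
    moreover have "(V \<inter> (\<lambda>z. ?m (U z)) -` (- {0})) \<inter> V' = {}"
      using zero by auto
    ultimately have "(V \<inter> (\<lambda>z. ?m (U z)) -` (- {0})) \<inter> closure V' = {}"
      by (simp add: open_Int_closure_eq_empty)
    then have "?m (U z) = 0" if "z \<in> V" for z
      using that dense by blast
    then show "\<exists>\<theta> \<psi>. \<forall>(a, b)\<in>V. \<phi> (U (a, b)) = \<theta> b - \<psi> a"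
      by (intro decomposition_if_mixed_zero[OF C2]) (use dense open_V in auto)
  qed
qed

end
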